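(* There is $n_0$ such that every graph $G$ with $n\ge n_0$ vertices and $\Lambda_{4,3}(G)=\Lambda_{4,3}(n)$ is a (vertex-disjoint) union of two cliques or a complete bipartite graph.
   Context: Graphs are finite and simple. For a graph $G$, $\Lambda_{4,3}(G)$ denotes the number of $4$-subsets of $V(G)$ that span exactly $3$ edges of $G$, and $\Lambda_{4,3}(n):=\max\{\Lambda_{4,3}(G): G\text{ is an } n\text{-vertex graph}\}$. *)

theory Defs
  imports Main "HOL-Library.Ramsey"
begin

definition simple_graph :: "'a set \<Rightarrow> 'a set set \<Rightarrow> bool" where
  "simple_graph V E \<longleftrightarrow> finite V \<and> E \<subseteq> [V]\<^bsup>2\<^esup>"

definition Lambda :: "nat \<Rightarrow> nat \<Rightarrow> 'a set \<Rightarrow> 'a set set \<Rightarrow> nat" where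
  "Lambda k l V E = card {S \<in> [V]\<^bsup>k\<^esup>. card (E \<inter> [S]\<^bsup>2\<^esup>) = l}"

text \<open>The maximum over all n-vertex graphs; as it only depends on graphs up to isomorphism, it
  is taken over graphs whose vertices are natural numbers.\<close>

definition Lambda_max :: "nat \<Rightarrow> nat \<Rightarrow> nat \<Rightarrow> nat" where
  "Lambda_max k l n =
     Max {Lambda k l V E | (V :: nat set) E. simple_graph V E \<and> card V = n}"

text \<open>The set under the maximum is finite and nonempty, so the maximum is a genuine one.\<close>

lemma finite_Lambda_values:
  "finite {Lambda k l V E | (V :: nat set) E. simple_graph V E \<and> card V = n}"
proof -
  have "Lambda k l V E \<le> n choose k" if "simple_graph V E" "card V = n" for V :: "nat set" and E
  proof -
    have "finite V" using that by (simp add: simple_graph_def)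
    then have "card {S \<in> [V]\<^bsup>k\<^esup>. card (E \<inter> [S]\<^bsup>2\<^esup>) = l} \<le> card ([V]\<^bsup>k\<^esup>)"
      by (intro card_mono finite_imp_finite_nsets) auto
    then show ?thesis using that by (simp add: Lambda_def)
  qed
  then have "{Lambda k l V E | (V :: nat set) E. simple_graph V E \<and> card V = n} \<subseteq> {..n choose k}"
    by auto
  then show ?thesis by (rule finite_subset) simp
qed

lemma Lambda_values_nonempty:
  "{Lambda k l V E | (V :: nat set) E. simple_graph V E \<and> card V = n} \<noteq> {}"
proof -
  have "simple_graph {..<n} {} \<and> card {..<n} = n" by (simp add: simple_graph_def)
  then show ?thesis by blast
qed

text \<open>Cliques and the two sides of a bipartition are required to be nonempty.\<close>

definition union_of_two_cliques :: "'a set \<Rightarrow> 'a set set \<Rightarrow> bool" where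
  "union_of_two_cliques V E \<longleftrightarrow>
     (\<exists>A B. A \<noteq> {} \<and> B \<noteq> {} \<and> A \<inter> B = {} \<and> A \<union> B = V \<and> E = [A]\<^bsup>2\<^esup> \<union> [B]\<^bsup>2\<^esup>)"

definition complete_bipartite :: "'a set \<Rightarrow> 'a set set \<Rightarrow> bool" where
  "complete_bipartite V E \<longleftrightarrow>
     (\<exists>A B. A \<noteq> {} \<and> B \<noteq> {} \<and> A \<inter> B = {} \<and> A \<union> B = V \<and> E = {{a, b} | a b. a \<in> A \<and> b \<in> B})"

end

(*
  Call a triple of vertices odd if it spans an odd number of edges. In a union of two cliques every triple
  is odd, in a complete bipartite graph none is, and these are the only graphs of either kind.

  Summing 12 (3 - 6 [abcd spans 3 edges] - the three products of edge signs over the perfect matchings)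
  over ordered quadruples gives 36 (n^4 - 48 Lambda_{4,3}) minus a square. By a flag algebra certificate,
  after subtracting a positive semidefinite form in pairs of vertices rooted at a pair, every graph on 6
  vertices contributes at least 0, and at least 1 if between 5 and 15 of its 20 triples are odd. Hence a maximal graph has few such 6-subsets. A quadruple whose triples have equal parity and that
  lies in few of them yields a bipartition for which the graph or its complement (which spans 3 edges on the
  same 4-sets) differs from two cliques in o(n^2) pairs.

  Take the bipartition with the fewest wrong pairs. Re-attaching one vertex cannot improve the count, so
  every vertex has few wrong pairs; then inserting a missing edge inside a part would improve the count, so
  the parts are cliques. Finally m edges between cliques of sizes a and b change twice the count by at most
  m (n - (a - b)^2) - 2 m^2, which never makes up for a size difference other than about sqrt(3 n).
*)

theory Submission
  imports Defs Complex_Main "HOL-Library.Multiset"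
begin

section \<open>The certificate on six vertices\<close>

text \<open>Odd triples form a two-graph: each pair of a 4-set lies in two of its triples, so every
  4-set contains an even number of odd ones. This parity rule is what lets the neighbourhood of a
  single vertex reconstruct the bipartition.

  Both extremal families must be zeros of the certificate. The quadruple function vanishes on every
  4-set of either family, and a pair type gets weight only if u, v, w, z span triples of both
  parities, so the subtracted form vanishes there too.

  Strictness on all mixed graphs is impossible. Between two equal cliques, random edges of density x
  change the limiting proportion of 4-sets with three edges only at order x^2, so the certificate
  also has to vanish on six vertices that differ from two cliques in one crossing pair. Such a pair
  flips four triples, leaving 16 odd ones, or 4 after complementation; the range from 5 to 15 starts
  just beyond. It still suffices: outside it some 4-set has triples of equal parity, and two wrong
  pairs with a common vertex already fall inside.\<close>

datatype flag = FN | FBB | FAB0 | FAB1 | FDB0 | FDB1 | FCC | FAC0 | FAC1 | FDC0 | FDC1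

text \<open>The type of the pair w, z relative to the pair u, v, where e, a, b, c, d, s are the adjacencies of
  uv, uw, vw, uz, vz, wz. If uv is an edge, everything is complemented first. A vertex has type A, B, C, D
  if it is adjacent to both, to u only, to v only, to none of u and v; the digit is the adjacency of wz.
  Pairs that get no weight in the certificate have type FN.\<close>

definition flag6 :: "bool \<Rightarrow> bool \<Rightarrow> bool \<Rightarrow> bool \<Rightarrow> bool \<Rightarrow> bool \<Rightarrow> flag" where
  "flag6 e a b c d s =
    (if a = b then
       if c = d then FN
       else if c = e then
         (if a = e then if s = e then FDC0 else FDC1 else if s = e then FAC0 else FAC1)
       else
         (if a = e then if s = e then FDB0 else FDB1 else if s = e then FAB0 else FAB1)
     else if c = d then
       if a = e then
         (if c = e then if s = e then FDC0 else FDC1 else if s = e then FAC0 else FAC1)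
       else
         (if c = e then if s = e then FDB0 else FDB1 else if s = e then FAB0 else FAB1)
     else if a = c \<and> s = e then if a = e then FCC else FBB
     else FN)"

text \<open>A rounded solution of the semidefinite program of the flag algebra method. Exchanging u and v,
  hence B and C, splits it into a symmetric and an antisymmetric block; see the squares in
  \<open>gram_form_nonneg\<close>.\<close>

primrec gram_FBB :: "flag \<Rightarrow> int" where
  "gram_FBB FN = 0"
| "gram_FBB FBB = 96"
| "gram_FBB FAB0 = 41"
| "gram_FBB FAB1 = - 21"
| "gram_FBB FDB0 = 19"
| "gram_FBB FDB1 = 13"
| "gram_FBB FCC = - 96"
| "gram_FBB FAC0 = - 41"
| "gram_FBB FAC1 = 21"
| "gram_FBB FDC0 = - 19"
| "gram_FBB FDC1 = - 13"

primrec gram_FAB0 :: "flag \<Rightarrow> int" where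
  "gram_FAB0 FN = 0"
| "gram_FAB0 FBB = 41"
| "gram_FAB0 FAB0 = 56"
| "gram_FAB0 FAB1 = - 8"
| "gram_FAB0 FDB0 = 3"
| "gram_FAB0 FDB1 = - 13"
| "gram_FAB0 FCC = - 41"
| "gram_FAB0 FAC0 = - 20"
| "gram_FAB0 FAC1 = - 22"
| "gram_FAB0 FDC0 = - 3"
| "gram_FAB0 FDC1 = - 35"

primrec gram_FAB1 :: "flag \<Rightarrow> int" where
  "gram_FAB1 FN = 0"
| "gram_FAB1 FBB = - 21"
| "gram_FAB1 FAB0 = - 8"
| "gram_FAB1 FAB1 = 40"
| "gram_FAB1 FDB0 = - 9"
| "gram_FAB1 FDB1 = 17"
| "gram_FAB1 FCC = 21"
| "gram_FAB1 FAC0 = - 22"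
| "gram_FAB1 FAC1 = 0"
| "gram_FAB1 FDC0 = 9"
| "gram_FAB1 FDC1 = 15"

primrec gram_FDB0 :: "flag \<Rightarrow> int" where
  "gram_FDB0 FN = 0"
| "gram_FDB0 FBB = 19"
| "gram_FDB0 FAB0 = 3"
| "gram_FDB0 FAB1 = - 9"
| "gram_FDB0 FDB0 = 11"
| "gram_FDB0 FDB1 = 9"
| "gram_FDB0 FCC = - 19"
| "gram_FDB0 FAC0 = - 3"
| "gram_FDB0 FAC1 = 9"
| "gram_FDB0 FDC0 = - 11"
| "gram_FDB0 FDC1 = - 9"

primrec gram_FDB1 :: "flag \<Rightarrow> int" where
  "gram_FDB1 FN = 0"
| "gram_FDB1 FBB = 13"
| "gram_FDB1 FAB0 = - 13"
| "gram_FDB1 FAB1 = 17"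
| "gram_FDB1 FDB0 = 9"
| "gram_FDB1 FDB1 = 58"
| "gram_FDB1 FCC = - 13"
| "gram_FDB1 FAC0 = - 35"
| "gram_FDB1 FAC1 = 15"
| "gram_FDB1 FDC0 = - 9"
| "gram_FDB1 FDC1 = 16"

primrec gram_FAC0 :: "flag \<Rightarrow> int" where
  "gram_FAC0 FN = 0"
| "gram_FAC0 FBB = - 41"
| "gram_FAC0 FAB0 = - 20"
| "gram_FAC0 FAB1 = - 22"
| "gram_FAC0 FDB0 = - 3"
| "gram_FAC0 FDB1 = - 35"
| "gram_FAC0 FCC = 41"
| "gram_FAC0 FAC0 = 56"
| "gram_FAC0 FAC1 = - 8"
| "gram_FAC0 FDC0 = 3"
| "gram_FAC0 FDC1 = - 13"

primrec gram_FAC1 :: "flag \<Rightarrow> int" where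
  "gram_FAC1 FN = 0"
| "gram_FAC1 FBB = 21"
| "gram_FAC1 FAB0 = - 22"
| "gram_FAC1 FAB1 = 0"
| "gram_FAC1 FDB0 = 9"
| "gram_FAC1 FDB1 = 15"
| "gram_FAC1 FCC = - 21"
| "gram_FAC1 FAC0 = - 8"
| "gram_FAC1 FAC1 = 40"
| "gram_FAC1 FDC0 = - 9"
| "gram_FAC1 FDC1 = 17"

primrec gram_FDC1 :: "flag \<Rightarrow> int" where
  "gram_FDC1 FN = 0"
| "gram_FDC1 FBB = - 13"
| "gram_FDC1 FAB0 = - 35"
| "gram_FDC1 FAB1 = 15"
| "gram_FDC1 FDB0 = - 9"
| "gram_FDC1 FDB1 = 16"
| "gram_FDC1 FCC = 13"
| "gram_FDC1 FAC0 = - 13"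
| "gram_FDC1 FAC1 = 17"
| "gram_FDC1 FDC0 = 9"
| "gram_FDC1 FDC1 = 58"

primrec gram :: "flag \<Rightarrow> flag \<Rightarrow> int" where
  "gram FN j = 0"
| "gram FBB j = gram_FBB j"
| "gram FAB0 j = gram_FAB0 j"
| "gram FAB1 j = gram_FAB1 j"
| "gram FDB0 j = gram_FDB0 j"
| "gram FDB1 j = gram_FDB1 j"
| "gram FCC j = - gram_FBB j"
| "gram FAC0 j = gram_FAC0 j"
| "gram FAC1 j = gram_FAC1 j"
| "gram FDC0 j = - gram_FDB0 j"
| "gram FDC1 j = gram_FDC1 j"

text \<open>A table of the function expanded in \<open>quad_eq\<close>, branching on whether the two
  pairs of each perfect matching agree. It is 0 if all three agree or none does, the only cases that
  occur in two cliques or in a complete bipartite graph.\<close>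

definition quad6 :: "bool \<Rightarrow> bool \<Rightarrow> bool \<Rightarrow> bool \<Rightarrow> bool \<Rightarrow> bool \<Rightarrow> int" where
  "quad6 ab ac ad bc bd cd =
    (if ab = cd then
       (if ac = bd then if ad = bc then 0 else if ab = ac then 24 else - 48
        else if ad = bc then if ab = ad then 24 else - 48 else 48)
     else
       (if ac = bd then if ad = bc then if ac = ad then 24 else - 48 else 48
        else if ad = bc then 48 else 0))"

definition odd_b :: "bool \<Rightarrow> bool \<Rightarrow> bool \<Rightarrow> nat" where
  "odd_b a b c = (if (a = b) = c then 1 else 0)"

definition flag_of :: "('a \<Rightarrow> 'a \<Rightarrow> bool) \<Rightarrow> 'a \<Rightarrow> 'a \<Rightarrow> 'a \<Rightarrow> 'a \<Rightarrow> flag" where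
  "flag_of e u v w z = flag6 (e u v) (e u w) (e v w) (e u z) (e v z) (e w z)"

definition pair_form :: "('a \<Rightarrow> 'a \<Rightarrow> bool) \<Rightarrow> 'a \<Rightarrow> 'a \<Rightarrow> 'a \<Rightarrow> 'a \<Rightarrow> 'a \<Rightarrow> 'a \<Rightarrow> int" where
  "pair_form e u v w z x y = gram (flag_of e u v w z) (flag_of e u v x y)"

definition quad :: "('a \<Rightarrow> 'a \<Rightarrow> bool) \<Rightarrow> 'a \<Rightarrow> 'a \<Rightarrow> 'a \<Rightarrow> 'a \<Rightarrow> int" where
  "quad e a b c d = quad6 (e a b) (e a c) (e a d) (e b c) (e b d) (e c d)"

definition odd3 :: "('a \<Rightarrow> 'a \<Rightarrow> bool) \<Rightarrow> 'a \<Rightarrow> 'a \<Rightarrow> 'a \<Rightarrow> nat" where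
  "odd3 e a b c = odd_b (e a b) (e a c) (e b c)"

text \<open>The 45 pair forms are the 15 choices of a root pair times the 3 ways to split the other
  four vertices into two pairs.\<close>

definition cert :: "('a \<Rightarrow> 'a \<Rightarrow> bool) \<Rightarrow> 'a \<Rightarrow> 'a \<Rightarrow> 'a \<Rightarrow> 'a \<Rightarrow> 'a \<Rightarrow> 'a \<Rightarrow> int" where
  "cert e a b c d f g =
    (quad e a b c d +
     quad e a b c f +
     quad e a b c g +
     quad e a b d f +
     quad e a b d g +
     quad e a b f g +
     quad e a c d f +
     quad e a c d g +
     quad e a c f g +
     quad e a d f g +
     quad e b c d f +
     quad e b c d g +
     quad e b c f g +
     quad e b d f g +
     quad e c d f g) -
    (pair_form e a b c d f g +
     pair_form e a b c f d g +
     pair_form e a b c g d f +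
     pair_form e a c b d f g +
     pair_form e a c b f d g +
     pair_form e a c b g d f +
     pair_form e a d b c f g +
     pair_form e a d b f c g +
     pair_form e a d b g c f +
     pair_form e a f b c d g +
     pair_form e a f b d c g +
     pair_form e a f b g c d +
     pair_form e a g b c d f +
     pair_form e a g b d c f +
     pair_form e a g b f c d +
     pair_form e b c a d f g +
     pair_form e b c a f d g +
     pair_form e b c a g d f +
     pair_form e b d a c f g +
     pair_form e b d a f c g +
     pair_form e b d a g c f +
     pair_form e b f a c d g +
     pair_form e b f a d c g +
     pair_form e b f a g c d +
     pair_form e b g a c d f +
     pair_form e b g a d c f +
     pair_form e b g a f c d +
     pair_form e c d a b f g +
     pair_form e c d a f b g +
     pair_form e c d a g b f +
     pair_form e c f a b d g +
     pair_form e c f a d b g +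
     pair_form e c f a g b d +
     pair_form e c g a b d f +
     pair_form e c g a d b f +
     pair_form e c g a f b d +
     pair_form e d f a b c g +
     pair_form e d f a c b g +
     pair_form e d f a g b c +
     pair_form e d g a b c f +
     pair_form e d g a c b f +
     pair_form e d g a f b c +
     pair_form e f g a b c d +
     pair_form e f g a c b d +
     pair_form e f g a d b c)"

definition odd_triples :: "('a \<Rightarrow> 'a \<Rightarrow> bool) \<Rightarrow> 'a \<Rightarrow> 'a \<Rightarrow> 'a \<Rightarrow> 'a \<Rightarrow> 'a \<Rightarrow> 'a \<Rightarrow> nat" where
  "odd_triples e a b c d f g =
     odd3 e a b c +
     odd3 e a b d +
     odd3 e a b f +
     odd3 e a b g +
     odd3 e a c d +
     odd3 e a c f +
     odd3 e a c g +
     odd3 e a d f +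
     odd3 e a d g +
     odd3 e a f g +
     odd3 e b c d +
     odd3 e b c f +
     odd3 e b c g +
     odd3 e b d f +
     odd3 e b d g +
     odd3 e b f g +
     odd3 e c d f +
     odd3 e c d g +
     odd3 e c f g +
     odd3 e d f g"

text \<open>The certificate as a function of 15 bits, \<open>bij\<close> being the adjacency of the
  vertices i < j. Without a vertex type it can be evaluated by the code generator.\<close>

definition cert_b where "cert_b b01 b02 b03 b04 b05 b12 b13 b14 b15 b23 b24 b25 b34 b35 b45 =
  quad6 b01 b02 b03 b12 b13 b23 +
  quad6 b01 b02 b04 b12 b14 b24 +
  quad6 b01 b02 b05 b12 b15 b25 +
  quad6 b01 b03 b04 b13 b14 b34 +
  quad6 b01 b03 b05 b13 b15 b35 +
  quad6 b01 b04 b05 b14 b15 b45 +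
  quad6 b02 b03 b04 b23 b24 b34 +
  quad6 b02 b03 b05 b23 b25 b35 +
  quad6 b02 b04 b05 b24 b25 b45 +
  quad6 b03 b04 b05 b34 b35 b45 +
  quad6 b12 b13 b14 b23 b24 b34 +
  quad6 b12 b13 b15 b23 b25 b35 +
  quad6 b12 b14 b15 b24 b25 b45 +
  quad6 b13 b14 b15 b34 b35 b45 +
  quad6 b23 b24 b25 b34 b35 b45 -
  gram (flag6 b01 b02 b12 b03 b13 b23) (flag6 b01 b04 b14 b05 b15 b45) -
  gram (flag6 b01 b02 b12 b04 b14 b24) (flag6 b01 b03 b13 b05 b15 b35) -
  gram (flag6 b01 b02 b12 b05 b15 b25) (flag6 b01 b03 b13 b04 b14 b34) -
  gram (flag6 b02 b01 b12 b03 b23 b13) (flag6 b02 b04 b24 b05 b25 b45) -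
  gram (flag6 b02 b01 b12 b04 b24 b14) (flag6 b02 b03 b23 b05 b25 b35) -
  gram (flag6 b02 b01 b12 b05 b25 b15) (flag6 b02 b03 b23 b04 b24 b34) -
  gram (flag6 b03 b01 b13 b02 b23 b12) (flag6 b03 b04 b34 b05 b35 b45) -
  gram (flag6 b03 b01 b13 b04 b34 b14) (flag6 b03 b02 b23 b05 b35 b25) -
  gram (flag6 b03 b01 b13 b05 b35 b15) (flag6 b03 b02 b23 b04 b34 b24) -
  gram (flag6 b04 b01 b14 b02 b24 b12) (flag6 b04 b03 b34 b05 b45 b35) -
  gram (flag6 b04 b01 b14 b03 b34 b13) (flag6 b04 b02 b24 b05 b45 b25) -
  gram (flag6 b04 b01 b14 b05 b45 b15) (flag6 b04 b02 b24 b03 b34 b23) -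
  gram (flag6 b05 b01 b15 b02 b25 b12) (flag6 b05 b03 b35 b04 b45 b34) -
  gram (flag6 b05 b01 b15 b03 b35 b13) (flag6 b05 b02 b25 b04 b45 b24) -
  gram (flag6 b05 b01 b15 b04 b45 b14) (flag6 b05 b02 b25 b03 b35 b23) -
  gram (flag6 b12 b01 b02 b13 b23 b03) (flag6 b12 b14 b24 b15 b25 b45) -
  gram (flag6 b12 b01 b02 b14 b24 b04) (flag6 b12 b13 b23 b15 b25 b35) -
  gram (flag6 b12 b01 b02 b15 b25 b05) (flag6 b12 b13 b23 b14 b24 b34) -
  gram (flag6 b13 b01 b03 b12 b23 b02) (flag6 b13 b14 b34 b15 b35 b45) -
  gram (flag6 b13 b01 b03 b14 b34 b04) (flag6 b13 b12 b23 b15 b35 b25) -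
  gram (flag6 b13 b01 b03 b15 b35 b05) (flag6 b13 b12 b23 b14 b34 b24) -
  gram (flag6 b14 b01 b04 b12 b24 b02) (flag6 b14 b13 b34 b15 b45 b35) -
  gram (flag6 b14 b01 b04 b13 b34 b03) (flag6 b14 b12 b24 b15 b45 b25) -
  gram (flag6 b14 b01 b04 b15 b45 b05) (flag6 b14 b12 b24 b13 b34 b23) -
  gram (flag6 b15 b01 b05 b12 b25 b02) (flag6 b15 b13 b35 b14 b45 b34) -
  gram (flag6 b15 b01 b05 b13 b35 b03) (flag6 b15 b12 b25 b14 b45 b24) -
  gram (flag6 b15 b01 b05 b14 b45 b04) (flag6 b15 b12 b25 b13 b35 b23) -
  gram (flag6 b23 b02 b03 b12 b13 b01) (flag6 b23 b24 b34 b25 b35 b45) -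
  gram (flag6 b23 b02 b03 b24 b34 b04) (flag6 b23 b12 b13 b25 b35 b15) -
  gram (flag6 b23 b02 b03 b25 b35 b05) (flag6 b23 b12 b13 b24 b34 b14) -
  gram (flag6 b24 b02 b04 b12 b14 b01) (flag6 b24 b23 b34 b25 b45 b35) -
  gram (flag6 b24 b02 b04 b23 b34 b03) (flag6 b24 b12 b14 b25 b45 b15) -
  gram (flag6 b24 b02 b04 b25 b45 b05) (flag6 b24 b12 b14 b23 b34 b13) -
  gram (flag6 b25 b02 b05 b12 b15 b01) (flag6 b25 b23 b35 b24 b45 b34) -
  gram (flag6 b25 b02 b05 b23 b35 b03) (flag6 b25 b12 b15 b24 b45 b14) -
  gram (flag6 b25 b02 b05 b24 b45 b04) (flag6 b25 b12 b15 b23 b35 b13) -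
  gram (flag6 b34 b03 b04 b13 b14 b01) (flag6 b34 b23 b24 b35 b45 b25) -
  gram (flag6 b34 b03 b04 b23 b24 b02) (flag6 b34 b13 b14 b35 b45 b15) -
  gram (flag6 b34 b03 b04 b35 b45 b05) (flag6 b34 b13 b14 b23 b24 b12) -
  gram (flag6 b35 b03 b05 b13 b15 b01) (flag6 b35 b23 b25 b34 b45 b24) -
  gram (flag6 b35 b03 b05 b23 b25 b02) (flag6 b35 b13 b15 b34 b45 b14) -
  gram (flag6 b35 b03 b05 b34 b45 b04) (flag6 b35 b13 b15 b23 b25 b12) -
  gram (flag6 b45 b04 b05 b14 b15 b01) (flag6 b45 b24 b25 b34 b35 b23) -
  gram (flag6 b45 b04 b05 b24 b25 b02) (flag6 b45 b14 b15 b34 b35 b13) -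
  gram (flag6 b45 b04 b05 b34 b35 b03) (flag6 b45 b14 b15 b24 b25 b12)"

definition odd_triples_b where "odd_triples_b b01 b02 b03 b04 b05 b12 b13 b14 b15 b23 b24 b25 b34 b35 b45 =
  odd_b b01 b02 b12 + odd_b b01 b03 b13 + odd_b b01 b04 b14 + odd_b b01 b05 b15 + odd_b b02 b03 b23 + odd_b b02 b04 b24 + odd_b b02 b05 b25 + odd_b b03 b04 b34 + odd_b b03 b05 b35 + odd_b b04 b05 b45 + odd_b b12 b13 b23 + odd_b b12 b14 b24 + odd_b b12 b15 b25 + odd_b b13 b14 b34 + odd_b b13 b15 b35 + odd_b b14 b15 b45 + odd_b b23 b24 b34 + odd_b b23 b25 b35 + odd_b b24 b25 b45 + odd_b b34 b35 b45"

definition ok_b where "ok_b b01 b02 b03 b04 b05 b12 b13 b14 b15 b23 b24 b25 b34 b35 b45 \<longleftrightarrow>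
  (let r = cert_b b01 b02 b03 b04 b05 b12 b13 b14 b15 b23 b24 b25 b34 b35 b45 in 0 \<le> r \<and> (1 \<le> r \<or> odd_triples_b b01 b02 b03 b04 b05 b12 b13 b14 b15 b23 b24 b25 b34 b35 b45 \<le> 4 \<or> odd_triples_b b01 b02 b03 b04 b05 b12 b13 b14 b15 b23 b24 b25 b34 b35 b45 \<ge> 16))"

text \<open>Quantification over one bit as a conjunction: evaluating nested quantifiers is then a
  search in which the tests of \<open>ok_b_sorted\<close> cut off unsorted branches early.\<close>

definition all_b :: "(bool \<Rightarrow> bool) \<Rightarrow> bool" where "all_b P \<longleftrightarrow> P False \<and> P True"

definition code3 :: "bool \<Rightarrow> bool \<Rightarrow> bool \<Rightarrow> nat" where
  "code3 a b c = (if a then 4 else 0) + (if b then 2 else 0) + (if c then 1 else 0)"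

section \<open>Invariance of the certificate under permutations of the six vertices\<close>

lemma flag6_swap_uv_gram: "gram (flag6 e b a d c s) (flag6 e b' a' d' c' s') = gram (flag6 e a b c d s) (flag6 e a' b' c' d' s')"
  unfolding flag6_def by (simp split: if_split)

lemma gram_commute: "gram i j = gram j i"
  by (cases i; cases j; simp)

lemma flag6_swap: "flag6 e c d a b s = flag6 e a b c d s"
  unfolding flag6_def by (simp split: if_split; blast)

lemma flag6_compl: "flag6 (\<not> e) (\<not> a) (\<not> b) (\<not> c) (\<not> d) (\<not> s) = flag6 e a b c d s"
  unfolding flag6_def by simp

text \<open>Loops are allowed, because complements are taken by pointwise negation, which turns an
  irreflexive relation into a reflexive one.\<close>

locale sym_rel =
  fixes e :: "'a \<Rightarrow> 'a \<Rightarrow> bool"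
  assumes sym: "e x y = e y x"
begin

text \<open>Exchanging u and v turns type B into C, so the flags themselves change; what is
  invariant is the entry of \<open>gram\<close>, by its symmetry under this exchange.\<close>

lemma pair_form_syms:
  "pair_form e v u w z x y = pair_form e u v w z x y"
  "pair_form e u v z w x y = pair_form e u v w z x y"
  "pair_form e u v w z y x = pair_form e u v w z x y"
  "pair_form e u v x y w z = pair_form e u v w z x y"
  unfolding pair_form_def flag_of_def
  subgoal by (simp add: sym[of v u] flag6_swap_uv_gram)
  subgoal by (simp add: sym[of z w] flag6_swap)
  subgoal by (simp add: sym[of y x] flag6_swap)
  subgoal by (rule gram_commute)
  done

lemma quad_syms:
  "quad e b a c d = quad e a b c d"
  "quad e a c b d = quad e a b c d"
  "quad e a b d c = quad e a b c d"
  unfolding quad_def using sym[of a b] sym[of b c] sym[of c d]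
  by (auto simp: quad6_def)

lemma odd3_syms:
  "odd3 e b a c = odd3 e a b c"
  "odd3 e a c b = odd3 e a b c"
  unfolding odd3_def using sym[of a b] sym[of b c]
  by (auto simp: odd_b_def)

text \<open>Adjacent transpositions generate all permutations. Each of them permutes the 15
  quadruple terms and the 45 pair forms, up to the symmetries of a single term.\<close>

lemma cert_swap:
  "cert e b a c d f g = cert e a b c d f g"
  "cert e a c b d f g = cert e a b c d f g"
  "cert e a b d c f g = cert e a b c d f g"
  "cert e a b c f d g = cert e a b c d f g"
  "cert e a b c d g f = cert e a b c d f g"
  unfolding cert_def
  by (simp_all add: quad_syms pair_form_syms ac_simps)

lemma odd_triples_swap:
  "odd_triples e b a c d f g = odd_triples e a b c d f g"
  "odd_triples e a c b d f g = odd_triples e a b c d f g"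
  "odd_triples e a b d c f g = odd_triples e a b c d f g"
  "odd_triples e a b c f d g = odd_triples e a b c d f g"
  "odd_triples e a b c d g f = odd_triples e a b c d f g"
  unfolding odd_triples_def
  by (simp_all add: odd3_syms ac_simps)

end

text \<open>By Ramsey and complementation the first three vertices may be taken independent, and the other three
  may be sorted by their adjacencies to the first three. This leaves few enough graphs for the simplifier.\<close>

lemma ok_b_sorted:
  "all_b (\<lambda>b03. all_b (\<lambda>b13. all_b (\<lambda>b23. all_b (\<lambda>b04. all_b (\<lambda>b14. all_b (\<lambda>b24.
     if code3 b03 b13 b23 \<le> code3 b04 b14 b24 then
     all_b (\<lambda>b05. all_b (\<lambda>b15. all_b (\<lambda>b25.
       if code3 b04 b14 b24 \<le> code3 b05 b15 b25 then
       all_b (\<lambda>b34. all_b (\<lambda>b35. all_b (\<lambda>b45.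
         ok_b False False b03 b04 b05 False b13 b14 b15 b23 b24 b25 b34 b35 b45)))
       else True))) else True))))))"
  by code_simp

lemma all_bD: "all_b P \<Longrightarrow> P b"
  by (cases b) (auto simp: all_b_def)

lemma ok_b_sortedD:
  assumes "code3 b03 b13 b23 \<le> code3 b04 b14 b24" "code3 b04 b14 b24 \<le> code3 b05 b15 b25"
  shows "ok_b False False b03 b04 b05 False b13 b14 b15 b23 b24 b25 b34 b35 b45"
  using ok_b_sorted[THEN all_bD[of _ b03], THEN all_bD[of _ b13], THEN all_bD[of _ b23],
      THEN all_bD[of _ b04], THEN all_bD[of _ b14], THEN all_bD[of _ b24], unfolded if_P[OF assms(1)],
      THEN all_bD[of _ b05], THEN all_bD[of _ b15], THEN all_bD[of _ b25], unfolded if_P[OF assms(2)],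
      THEN all_bD[of _ b34], THEN all_bD[of _ b35], THEN all_bD[of _ b45]] .

section \<open>Reduction of all graphs on six vertices to the sorted ones\<close>

definition good6 :: "('a \<Rightarrow> 'a \<Rightarrow> bool) \<Rightarrow> 'a list \<Rightarrow> bool" where
  "good6 e xs \<longleftrightarrow> (case xs of [a, b, c, d, f, g] \<Rightarrow>
     0 \<le> cert e a b c d f g \<and>
     (odd_triples e a b c d f g \<in> {5..15} \<longrightarrow> 1 \<le> cert e a b c d f g) | _ \<Rightarrow> True)"

text \<open>Sorting by adjacent swaps: the head of \<open>xs\<close> is moved to the front of
  \<open>ys\<close>, and the induction continues behind the prefix \<open>zs\<close> extended by
  that head.\<close>

lemma adjacent_swap_invariant:
  assumes swap: "\<And>us x y vs. f (us @ x # y # vs) = f (us @ y # x # vs)"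
  shows "mset xs = mset ys \<Longrightarrow> f (zs @ xs) = f (zs @ ys)"
proof (induction xs arbitrary: ys zs)
  case Nil
  then show ?case by simp
next
  case (Cons x xs)
  then have "x \<in> set ys" by (metis list.set_intros(1) mset_eq_setD)
  then obtain us vs where ys: "ys = us @ x # vs" by (meson split_list)
  have move: "f (ws @ us @ x # vs) = f (ws @ x # us @ vs)" for ws us vs
  proof (induction us arbitrary: ws)
    case Nil
    show ?case by simp
  next
    case (Cons u us)
    have "f (ws @ (u # us) @ x # vs) = f (ws @ u # x # us @ vs)"
      using Cons[of "ws @ [u]"] by simp
    also have "\<dots> = f (ws @ x # (u # us) @ vs)"
      using swap[of "ws" u x "us @ vs"] by simp
    finally show ?case .
  qed
  have "mset xs = mset (us @ vs)" using Cons.prems ys by simp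
  then have "f ((zs @ [x]) @ xs) = f ((zs @ [x]) @ us @ vs)" by (rule Cons.IH)
  then show ?case using move[of zs us vs] ys by simp
qed

context sym_rel
begin

text \<open>The default value for other lengths makes the swap invariance true for arbitrary lists,
  as \<open>adjacent_swap_invariant\<close> requires.\<close>

lemma good6_length: "length xs \<noteq> 6 \<Longrightarrow> good6 e xs"
  unfolding good6_def by (auto split: list.split)

lemma length4E:
  assumes "length us + length vs = 4"
  obtains p q r s where "us = [] \<and> vs = [p, q, r, s] \<or> us = [p] \<and> vs = [q, r, s] \<or>
    us = [p, q] \<and> vs = [r, s] \<or> us = [p, q, r] \<and> vs = [s] \<or> us = [p, q, r, s] \<and> vs = []"
proof -
  define xs where "xs = us @ vs"
  have len: "length xs = 4" using assms by (simp add: xs_def)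
  have "us @ vs = [xs ! 0, xs ! 1, xs ! 2, xs ! 3]"
    unfolding xs_def[symmetric]
    by (rule nth_equalityI) (use len in \<open>auto simp: less_Suc_eq numeral_eq_Suc\<close>)
  then show ?thesis
    using that by (auto simp: append_eq_Cons_conv)
qed

lemma good6_swap: "good6 e (us @ x # y # vs) = good6 e (us @ y # x # vs)"
proof (cases "length us + length vs = 4")
  case False
  then show ?thesis using good6_length by simp
next
  case True
  then obtain p q r s where "us = [] \<and> vs = [p, q, r, s] \<or> us = [p] \<and> vs = [q, r, s] \<or>
    us = [p, q] \<and> vs = [r, s] \<or> us = [p, q, r] \<and> vs = [s] \<or> us = [p, q, r, s] \<and> vs = []"
    by (rule length4E)
  then show ?thesis
    by (elim disjE conjE) (simp_all add: good6_def cert_swap odd_triples_swap)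
qed

lemma good6_mset: "mset xs = mset ys \<Longrightarrow> good6 e xs = good6 e ys"
  using adjacent_swap_invariant[of "good6 e" xs ys "[]"] good6_swap by simp

lemma good6_sorted:
  assumes "\<not> e a b" "\<not> e a c" "\<not> e b c"
    and "code3 (e a d) (e b d) (e c d) \<le> code3 (e a f) (e b f) (e c f)"
    and "code3 (e a f) (e b f) (e c f) \<le> code3 (e a g) (e b g) (e c g)"
  shows "good6 e [a, b, c, d, f, g]"
proof -
  have bits: "cert e a b c d f g = cert_b (e a b) (e a c) (e a d) (e a f) (e a g) (e b c) (e b d) (e b f) (e b g)
     (e c d) (e c f) (e c g) (e d f) (e d g) (e f g)"
    unfolding cert_def cert_b_def quad_def pair_form_def flag_of_def
    by (simp only: sym[of b a] sym[of c a] sym[of d a] sym[of f a] sym[of g a] sym[of c b] sym[of d b] sym[of f b] sym[of g b]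
       sym[of d c] sym[of f c] sym[of g c] sym[of f d] sym[of g d] sym[of g f] diff_diff_eq add.assoc)
  have obits: "odd_triples e a b c d f g = odd_triples_b (e a b) (e a c) (e a d) (e a f) (e a g) (e b c) (e b d) (e b f) (e b g)
     (e c d) (e c f) (e c g) (e d f) (e d g) (e f g)"
    unfolding odd_triples_def odd_triples_b_def odd3_def by simp
  have "ok_b (e a b) (e a c) (e a d) (e a f) (e a g) (e b c) (e b d) (e b f) (e b g)
     (e c d) (e c f) (e c g) (e d f) (e d g) (e f g)"
    using ok_b_sortedD[OF assms(4,5)] assms(1-3) by simp
  then show ?thesis unfolding good6_def ok_b_def Let_def by (auto simp: bits obits)
qed

lemma good6_independent:
  assumes "\<not> e a b" "\<not> e a c" "\<not> e b c"
  shows "good6 e [a, b, c, d, f, g]"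
proof -
  define k where "k x = code3 (e a x) (e b x) (e c x)" for x
  have *: "good6 e [a, b, c, d', f', g']"
    if "k d' \<le> k f'" "k f' \<le> k g'" for d' f' g'
    using good6_sorted[OF assms] that unfolding k_def by blast
  consider "k d \<le> k f \<and> k f \<le> k g" | "k d \<le> k g \<and> k g \<le> k f" | "k f \<le> k d \<and> k d \<le> k g"
    | "k f \<le> k g \<and> k g \<le> k d" | "k g \<le> k d \<and> k d \<le> k f" | "k g \<le> k f \<and> k f \<le> k d"
    by linarith
  then have "\<exists>d' f' g'. k d' \<le> k f' \<and> k f' \<le> k g' \<and> mset [a, b, c, d, f, g] = mset [a, b, c, d', f', g']"
  proof cases
    case 1 then show ?thesis by (intro exI[of _ d] exI[of _ f] exI[of _ g]) simp
  next
    case 2 then show ?thesis by (intro exI[of _ d] exI[of _ g] exI[of _ f]) (simp add: add_mset_commute)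
  next
    case 3 then show ?thesis by (intro exI[of _ f] exI[of _ d] exI[of _ g]) (simp add: add_mset_commute)
  next
    case 4 then show ?thesis by (intro exI[of _ f] exI[of _ g] exI[of _ d]) (simp add: add_mset_commute)
  next
    case 5 then show ?thesis by (intro exI[of _ g] exI[of _ d] exI[of _ f]) (simp add: add_mset_commute)
  next
    case 6 then show ?thesis by (intro exI[of _ g] exI[of _ f] exI[of _ d]) (simp add: add_mset_commute)
  qed
  then show ?thesis using * good6_mset by blast
qed

definition mono3 :: "('a \<Rightarrow> 'a \<Rightarrow> bool) \<Rightarrow> 'a \<Rightarrow> 'a \<Rightarrow> 'a \<Rightarrow> bool" where
  "mono3 r x y z \<longleftrightarrow> r x y = r x z \<and> r x y = r y z"

text \<open>The Ramsey bound R(3,3) <= 6, as a propositional tautology in the 15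
  adjacencies.\<close>

lemma mono3_exists:
  "mono3 e a b c \<or>
    mono3 e a b d \<or>
    mono3 e a b f \<or>
    mono3 e a b g \<or>
    mono3 e a c d \<or>
    mono3 e a c f \<or>
    mono3 e a c g \<or>
    mono3 e a d f \<or>
    mono3 e a d g \<or>
    mono3 e a f g \<or>
    mono3 e b c d \<or>
    mono3 e b c f \<or>
    mono3 e b c g \<or>
    mono3 e b d f \<or>
    mono3 e b d g \<or>
    mono3 e b f g \<or>
    mono3 e c d f \<or>
    mono3 e c d g \<or>
    mono3 e c f g \<or>
    mono3 e d f g"
  unfolding mono3_def by sat

lemma mono3_front:
  "\<exists>ys. mset [a, b, c, d, f, g] = mset ys \<and> length ys = 6 \<and> mono3 e (ys ! 0) (ys ! 1) (ys ! 2)"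
  using mono3_exists[of a b c d f g]
  supply add_mset_commute [simp]
  apply (elim disjE)
  subgoal by (rule exI[of _ "[a, b, c, d, f, g]"]) simp
  subgoal by (rule exI[of _ "[a, b, d, c, f, g]"]) simp
  subgoal by (rule exI[of _ "[a, b, f, c, d, g]"]) simp
  subgoal by (rule exI[of _ "[a, b, g, c, d, f]"]) simp
  subgoal by (rule exI[of _ "[a, c, d, b, f, g]"]) simp
  subgoal by (rule exI[of _ "[a, c, f, b, d, g]"]) simp
  subgoal by (rule exI[of _ "[a, c, g, b, d, f]"]) simp
  subgoal by (rule exI[of _ "[a, d, f, b, c, g]"]) simp
  subgoal by (rule exI[of _ "[a, d, g, b, c, f]"]) simp
  subgoal by (rule exI[of _ "[a, f, g, b, c, d]"]) simp
  subgoal by (rule exI[of _ "[b, c, d, a, f, g]"]) simp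
  subgoal by (rule exI[of _ "[b, c, f, a, d, g]"]) simp
  subgoal by (rule exI[of _ "[b, c, g, a, d, f]"]) simp
  subgoal by (rule exI[of _ "[b, d, f, a, c, g]"]) simp
  subgoal by (rule exI[of _ "[b, d, g, a, c, f]"]) simp
  subgoal by (rule exI[of _ "[b, f, g, a, c, d]"]) simp
  subgoal by (rule exI[of _ "[c, d, f, a, b, g]"]) simp
  subgoal by (rule exI[of _ "[c, d, g, a, b, f]"]) simp
  subgoal by (rule exI[of _ "[c, f, g, a, b, d]"]) simp
  subgoal by (rule exI[of _ "[d, f, g, a, b, c]"]) simp
  done

end

section \<open>Complementation\<close>

lemma sym_rel_compl: "sym_rel e \<Longrightarrow> sym_rel (\<lambda>x y. \<not> e x y)"
  unfolding sym_rel_def by blast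

lemma quad_compl: "quad (\<lambda>x y. \<not> e x y) a b c d = quad e a b c d"
  unfolding quad_def quad6_def by auto

lemma pair_form_compl: "pair_form (\<lambda>x y. \<not> e x y) u v w z x y = pair_form e u v w z x y"
  unfolding pair_form_def flag_of_def by (simp only: flag6_compl)

lemma cert_compl: "cert (\<lambda>x y. \<not> e x y) a b c d f g = cert e a b c d f g"
  unfolding cert_def quad_compl pair_form_compl by simp

lemma odd3_compl: "odd3 (\<lambda>x y. \<not> e x y) a b c = 1 - odd3 e a b c"
  unfolding odd3_def odd_b_def by auto

lemma odd3_le: "odd3 e a b c \<le> 1"
  unfolding odd3_def odd_b_def by auto

lemma odd_triples_compl:
  "odd_triples (\<lambda>x y. \<not> e x y) a b c d f g = 20 - odd_triples e a b c d f g"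
proof -
  have s: "(1 - odd3 e x y z) + n = (1 + n) - odd3 e x y z" for x y z n using odd3_le[of e x y z] by simp
  define q where "q x y z = 1 - odd3 e x y z" for x y z
  have q: "odd3 e x y z = 1 - q x y z" "q x y z \<le> 1" for x y z using odd3_le[of e x y z] by (auto simp: q_def)
  have "int (q x y z) = 1 - int (odd3 e x y z)" for x y z using odd3_le[of e x y z] by (simp add: q_def)
  then have "int (odd_triples (\<lambda>x y. \<not> e x y) a b c d f g) = 20 - int (odd_triples e a b c d f g)"
    unfolding odd_triples_def odd3_compl q_def[symmetric] by simp
  then show ?thesis by linarith
qed

lemma good6_compl: "good6 (\<lambda>x y. \<not> e x y) xs \<longleftrightarrow> good6 e xs"
  unfolding good6_def cert_compl odd_triples_compl by (auto split: list.splits)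

theorem (in sym_rel) good6: "good6 e [a, b, c, d, f, g]"
proof -
  obtain ys where ys: "mset [a, b, c, d, f, g] = mset ys" "length ys = 6" "mono3 e (ys ! 0) (ys ! 1) (ys ! 2)"
    using mono3_front by blast
  obtain p q r s t u where ys': "ys = [p, q, r, s, t, u]"
  proof -
    have "ys = [ys ! 0, ys ! 1, ys ! 2, ys ! 3, ys ! 4, ys ! 5]"
      by (rule nth_equalityI) (use ys(2) in \<open>auto simp: less_Suc_eq numeral_eq_Suc\<close>)
    then show ?thesis using that by blast
  qed
  have "good6 e ys"
  proof (cases "e p q")
    case False
    then show ?thesis using ys(3) good6_independent[of p q r] by (simp add: ys' mono3_def)
  next
    case True
    interpret c: sym_rel "\<lambda>x y. \<not> e x y" by (rule sym_rel_compl) (rule sym_rel_axioms)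
    have "good6 (\<lambda>x y. \<not> e x y) ys"
      using True ys(3) c.good6_independent[of p q r] by (simp add: ys' mono3_def)
    then show ?thesis by (simp add: good6_compl)
  qed
  then show ?thesis using good6_mset[OF ys(1)] by blast
qed

section \<open>Counting ordered 6-tuples\<close>

text \<open>Each quadruple of positions, and below each rooted pair of pairs, is listed as a full
  permutation of the six positions. Every summand of the certificate thereby becomes one fixed
  function of a rearranged 6-tuple.\<close>

definition perms15 :: "nat list list" where
  "perms15 = [
   [0, 1, 2, 3, 4, 5], [0, 1, 2, 4, 3, 5], [0, 1, 2, 5, 3, 4],
   [0, 1, 3, 4, 2, 5], [0, 1, 3, 5, 2, 4], [0, 1, 4, 5, 2, 3],
   [0, 2, 3, 4, 1, 5], [0, 2, 3, 5, 1, 4], [0, 2, 4, 5, 1, 3],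
   [0, 3, 4, 5, 1, 2], [1, 2, 3, 4, 0, 5], [1, 2, 3, 5, 0, 4],
   [1, 2, 4, 5, 0, 3], [1, 3, 4, 5, 0, 2], [2, 3, 4, 5, 0, 1]]"

definition perms45 :: "nat list list" where
  "perms45 = [
   [0, 1, 2, 3, 4, 5], [0, 1, 2, 4, 3, 5], [0, 1, 2, 5, 3, 4],
   [0, 2, 1, 3, 4, 5], [0, 2, 1, 4, 3, 5], [0, 2, 1, 5, 3, 4],
   [0, 3, 1, 2, 4, 5], [0, 3, 1, 4, 2, 5], [0, 3, 1, 5, 2, 4],
   [0, 4, 1, 2, 3, 5], [0, 4, 1, 3, 2, 5], [0, 4, 1, 5, 2, 3],
   [0, 5, 1, 2, 3, 4], [0, 5, 1, 3, 2, 4], [0, 5, 1, 4, 2, 3],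
   [1, 2, 0, 3, 4, 5], [1, 2, 0, 4, 3, 5], [1, 2, 0, 5, 3, 4],
   [1, 3, 0, 2, 4, 5], [1, 3, 0, 4, 2, 5], [1, 3, 0, 5, 2, 4],
   [1, 4, 0, 2, 3, 5], [1, 4, 0, 3, 2, 5], [1, 4, 0, 5, 2, 3],
   [1, 5, 0, 2, 3, 4], [1, 5, 0, 3, 2, 4], [1, 5, 0, 4, 2, 3],
   [2, 3, 0, 1, 4, 5], [2, 3, 0, 4, 1, 5], [2, 3, 0, 5, 1, 4],
   [2, 4, 0, 1, 3, 5], [2, 4, 0, 3, 1, 5], [2, 4, 0, 5, 1, 3],
   [2, 5, 0, 1, 3, 4], [2, 5, 0, 3, 1, 4], [2, 5, 0, 4, 1, 3],
   [3, 4, 0, 1, 2, 5], [3, 4, 0, 2, 1, 5], [3, 4, 0, 5, 1, 2],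
   [3, 5, 0, 1, 2, 4], [3, 5, 0, 2, 1, 4], [3, 5, 0, 4, 1, 2],
   [4, 5, 0, 1, 2, 3], [4, 5, 0, 2, 1, 3], [4, 5, 0, 3, 1, 2]]"

lemma card_filter_eq_sum: "finite A \<Longrightarrow> int (card {x \<in> A. P x}) = (\<Sum>x\<in>A. of_bool (P x))"
proof -
  assume "finite A"
  moreover have "{x \<in> A. P x} = A \<inter> {x. P x}" by blast
  ultimately show ?thesis by (simp only: sum_of_bool_eq)
qed

definition lists_of :: "'a set \<Rightarrow> nat \<Rightarrow> 'a list set" where
  "lists_of V k = {xs. set xs \<subseteq> V \<and> length xs = k}"

definition dlists_of :: "'a set \<Rightarrow> nat \<Rightarrow> 'a list set" where
  "dlists_of V k = {xs \<in> lists_of V k. distinct xs}"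

definition quad_l :: "('a \<Rightarrow> 'a \<Rightarrow> bool) \<Rightarrow> 'a list \<Rightarrow> int" where
  "quad_l e xs = quad e (xs ! 0) (xs ! 1) (xs ! 2) (xs ! 3)"

definition pair_l :: "('a \<Rightarrow> 'a \<Rightarrow> bool) \<Rightarrow> 'a list \<Rightarrow> int" where
  "pair_l e xs = pair_form e (xs ! 0) (xs ! 1) (xs ! 2) (xs ! 3) (xs ! 4) (xs ! 5)"

definition cert_l :: "('a \<Rightarrow> 'a \<Rightarrow> bool) \<Rightarrow> 'a list \<Rightarrow> int" where
  "cert_l e xs = cert e (xs ! 0) (xs ! 1) (xs ! 2) (xs ! 3) (xs ! 4) (xs ! 5)"

definition odd_l :: "('a \<Rightarrow> 'a \<Rightarrow> bool) \<Rightarrow> 'a list \<Rightarrow> nat" where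
  "odd_l e xs = odd_triples e (xs ! 0) (xs ! 1) (xs ! 2) (xs ! 3) (xs ! 4) (xs ! 5)"

lemma cert_l_perms:
  "cert_l e xs = (\<Sum>p\<leftarrow>perms15. quad_l e (map ((!) xs) p)) - (\<Sum>p\<leftarrow>perms45. pair_l e (map ((!) xs) p))"
  unfolding cert_l_def cert_def perms15_def perms45_def quad_l_def pair_l_def
  by simp

lemma perms_are_perms:
  "p \<in> set perms15 \<union> set perms45 \<Longrightarrow> distinct p \<and> set p = {..<6}"
  unfolding perms15_def perms45_def by (auto simp: numeral_eq_Suc)

lemma finite_lists_of: "finite V \<Longrightarrow> finite (lists_of V k)"
  unfolding lists_of_def by (rule finite_lists_length_eq)

lemma finite_dlists_of: "finite V \<Longrightarrow> finite (dlists_of V k)"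
  by (simp add: dlists_of_def finite_lists_of)

lemma sum_dlists_permute:
  assumes V: "finite V" and p: "distinct p" "set p = {..<k}"
  shows "(\<Sum>xs\<in>dlists_of V k. F (map ((!) xs) p)) = (\<Sum>xs\<in>dlists_of V k. F xs)"
proof -
  have len: "length p = k" using p by (metis card_lessThan distinct_card)
  have into: "map ((!) xs) p \<in> dlists_of V k" if "xs \<in> dlists_of V k" for xs
    using that p len unfolding dlists_of_def lists_of_def
    by (auto simp: distinct_map inj_on_def nth_eq_iff_index_eq)
  have inj: "inj_on (\<lambda>xs. map ((!) xs) p) (dlists_of V k)"
  proof (rule inj_onI)
    fix xs ys assume xs: "xs \<in> dlists_of V k" and ys: "ys \<in> dlists_of V k"
      and eq: "map ((!) xs) p = map ((!) ys) p"
    from eq p(2) have "xs ! i = ys ! i" if "i < k" for i using that by (simp add: list_eq_iff_nth_eq) (metis in_set_conv_nth lessThan_iff p(2))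
    then show "xs = ys"
      using xs ys by (auto simp: dlists_of_def lists_of_def intro: nth_equalityI)
  qed
  have "bij_betw (\<lambda>xs. map ((!) xs) p) (dlists_of V k) (dlists_of V k)"
    unfolding bij_betw_def using inj endo_inj_surj[OF finite_dlists_of[OF V] _ inj] into by blast
  then show ?thesis by (rule sum.reindex_bij_betw)
qed

text \<open>Rearranging positions is a bijection on tuples of distinct vertices, so all 15 quadruple
  terms have the same sum, and so have all 45 pair forms.\<close>

lemma sum_cert_l:
  assumes V: "finite V"
  shows "(\<Sum>xs\<in>dlists_of V 6. cert_l e xs) =
    15 * (\<Sum>xs\<in>dlists_of V 6. quad_l e xs) - 45 * (\<Sum>xs\<in>dlists_of V 6. pair_l e xs)"
proof -
  have swap: "(\<Sum>xs\<in>dlists_of V 6. \<Sum>p\<leftarrow>ps. F (map ((!) xs) p)) = int (length ps) * (\<Sum>xs\<in>dlists_of V 6. F xs)"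
    if "set ps \<subseteq> set perms15 \<union> set perms45" for ps :: "nat list list" and F :: "'a list \<Rightarrow> int"
    using that
  proof (induction ps)
    case Nil
    show ?case by simp
  next
    case (Cons p ps)
    have "(\<Sum>xs\<in>dlists_of V 6. F (map ((!) xs) p)) = (\<Sum>xs\<in>dlists_of V 6. F xs)"
      using sum_dlists_permute[OF V] perms_are_perms[of p] Cons.prems by auto
    then show ?case using Cons by (simp add: sum.distrib algebra_simps)
  qed
  have "length perms15 = 15" "length perms45 = 45"
    by (simp_all add: perms15_def perms45_def)
  then show ?thesis
    unfolding cert_l_perms sum_subtractf using swap[of perms15] swap[of perms45] by simp
qed

lemma lists_of_0: "lists_of V 0 = {[]}"
  unfolding lists_of_def by auto

lemma sum_lists_of_Suc:
  "(\<Sum>xs\<in>lists_of V (Suc k). F xs) = (\<Sum>x\<in>V. \<Sum>xs\<in>lists_of V k. F (x # xs))"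
proof -
  have "lists_of V (Suc k) = (\<lambda>(x, xs). x # xs) ` (V \<times> lists_of V k)"
    unfolding lists_of_def by (auto simp: length_Suc_conv image_iff)
  moreover have "inj_on (\<lambda>(x, xs). x # xs) (V \<times> lists_of V k)"
    by (auto simp: inj_on_def)
  ultimately have "(\<Sum>xs\<in>lists_of V (Suc k). F xs) = (\<Sum>(x, xs)\<in>V \<times> lists_of V k. F (x # xs))"
    by (simp add: sum.reindex case_prod_unfold)
  then show ?thesis by (simp add: sum.cartesian_product)
qed

lemma card_lists_of: "finite V \<Longrightarrow> card (lists_of V k) = card V ^ k"
  unfolding lists_of_def by (rule card_lists_length_eq)

text \<open>The falling factorial of n with six factors is n^6 - 15 n^5 plus lower terms, where 15 =
  1 + 2 + 3 + 4 + 5, and these lower terms are nonnegative from n = 6 on. For smaller n, n^6 itself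
  is at most 15 n^5.\<close>

lemma card_nondistinct_lists:
  assumes "finite V"
  shows "card (lists_of V 6 - dlists_of V 6) \<le> 15 * card V ^ 5"
proof (cases "card V \<ge> 6")
  case True
  define n where "n = card V"
  have sub: "dlists_of V 6 \<subseteq> lists_of V 6" by (auto simp: dlists_of_def)
  have "dlists_of V 6 = {xs. length xs = 6 \<and> distinct xs \<and> set xs \<subseteq> V}"
    by (auto simp: dlists_of_def lists_of_def)
  then have "card (dlists_of V 6) = \<Prod>{n - 6 + 1..n}"
    using card_lists_distinct_length_eq[OF assms] True by (simp add: n_def)
  also obtain m where m: "n = m + 6" using True by (metis add.commute le_Suc_ex n_def)
  have "{n - 6 + 1..n} = {m + 6, m + 5, m + 4, m + 3, m + 2, m + 1}"
    unfolding m by auto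
  also have "\<Prod>\<dots> = (m + 6) * ((m + 5) * ((m + 4) * ((m + 3) * ((m + 2) * (m + 1)))))"
    by simp
  finally have d: "card (dlists_of V 6) = (m + 6) * ((m + 5) * ((m + 4) * ((m + 3) * ((m + 2) * (m + 1)))))" .
  define N where "N = int n"
  have "int (card (dlists_of V 6)) = N * (N - 1) * (N - 2) * (N - 3) * (N - 4) * (N - 5)"
  proof -
    have "int (m + 6) = N" "int (m + 5) = N - 1" "int (m + 4) = N - 2" "int (m + 3) = N - 3"
      "int (m + 2) = N - 4" "int (m + 1) = N - 5"
      by (simp_all add: N_def m)
    then show ?thesis unfolding d of_nat_mult by (simp only: mult.assoc)
  qed
  also have "\<dots> = N ^ 6 - 15 * N ^ 5 + (N ^ 3 * (85 * N - 225) + N * (274 * N - 120))"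
    by (simp add: algebra_simps power_numeral_reduce)
  also have "\<dots> \<ge> N ^ 6 - 15 * N ^ 5"
    using True by (simp add: N_def n_def)
  finally have "int (n ^ 6) \<le> int (card (dlists_of V 6) + 15 * n ^ 5)"
    by (simp add: N_def)
  then have "n ^ 6 \<le> card (dlists_of V 6) + 15 * n ^ 5"
    by (simp only: of_nat_le_iff)
  then show ?thesis
    using card_Diff_subset[OF finite_dlists_of[OF assms] sub] card_lists_of[OF assms] by (simp add: n_def)
next
  case False
  then have "card V * card V ^ 5 \<le> 15 * card V ^ 5"
    by (intro mult_right_mono) auto
  then have "card V ^ 6 \<le> 15 * card V ^ 5"
    by (simp add: power_numeral_reduce)
  moreover have "card (lists_of V 6 - dlists_of V 6) \<le> card V ^ 6"
    using card_mono[OF finite_lists_of[OF assms], of "lists_of V 6 - dlists_of V 6" 6] card_lists_of[OF assms] by simp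
  ultimately show ?thesis by simp
qed

section \<open>Bounds and positive semidefiniteness of the form\<close>

lemma gram_abs_le: "\<bar>gram i j\<bar> \<le> 96"
  by (cases i; cases j; simp)

lemma quad_abs_le: "\<bar>quad e a b c d\<bar> \<le> 48"
  unfolding quad_def quad6_def by auto

lemma UNIV_flag: "(UNIV :: flag set) = {FN, FBB, FAB0, FAB1, FDB0, FDB1, FCC, FAC0, FAC1, FDC0, FDC1}"
  by (auto intro: flag.exhaust)

text \<open>Repeated completion of the square in each of the two blocks. The rows of
  \<open>FBB\<close> and \<open>FCC\<close> are opposite, as are those of \<open>FDB0\<close> and
  \<open>FDC0\<close>, so these coordinates enter only through their differences and the symmetric
  block has just three variables.\<close>

lemma gram_form_nonneg:
  fixes X :: "flag \<Rightarrow> real"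
  shows "(\<Sum>i\<in>UNIV. \<Sum>j\<in>UNIV. of_int (gram i j) * X i * X j) \<ge> 0"
proof -
  define s1 where "s1 = X FAB0 + X FAC0"
  define s2 where "s2 = X FAB1 + X FAC1"
  define s4 where "s4 = X FDB1 + X FDC1"
  define t0 where "t0 = X FBB - X FCC"
  define t1 where "t1 = X FAB0 - X FAC0"
  define t2 where "t2 = X FAB1 - X FAC1"
  define t3 where "t3 = X FDB0 - X FDC0"
  define t4 where "t4 = X FDB1 - X FDC1"
  have "(\<Sum>i\<in>UNIV. \<Sum>j\<in>UNIV. of_int (gram i j) * X i * X j) =
     18 * s1\<^sup>2 + 20 * s2\<^sup>2 + 37 * s4\<^sup>2 - 30 * s1 * s2 - 48 * s1 * s4 + 32 * s2 * s4 +
     (96 * t0\<^sup>2 + 38 * t1\<^sup>2 + 20 * t2\<^sup>2 + 11 * t3\<^sup>2 + 21 * t4\<^sup>2 + 82 * t0 * t1 - 42 * t0 * t2 + 38 * t0 * t3 + 26 * t0 * t4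
      + 14 * t1 * t2 + 6 * t1 * t3 + 22 * t1 * t4 - 18 * t2 * t3 + 2 * t2 * t4 + 18 * t3 * t4)"
    unfolding UNIV_flag s1_def s2_def s4_def t0_def t1_def t2_def t3_def t4_def
    by (simp add: power2_eq_square algebra_simps)
  also have "\<dots> = 18 * (s1 - 5/6 * s2 - 4/3 * s4)\<^sup>2 + 15/2 * (s2 - 8/15 * s4)\<^sup>2 + 43/15 * s4\<^sup>2 +
     (96 * (t0 + 41/96 * t1 - 7/32 * t2 + 19/96 * t3 + 13/96 * t4)\<^sup>2
      + 1967/96 * (t1 + 219/281 * t2 - 491/1967 * t3 + 523/1967 * t4)\<^sup>2
      + 832/281 * (t2 - 241/832 * t3 - 113/832 * t4)\<^sup>2
      + 33281/5824 * (t3 + 44673/33281 * t4)\<^sup>2 + 247622/33281 * t4\<^sup>2)"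
    by (simp add: power2_eq_square algebra_simps)
  also have "\<dots> \<ge> 0" by simp
  finally show ?thesis .
qed

text \<open>Grouping the summands by flag turns the double sum into the quadratic form at the vector
  \<open>X\<close> of multiplicities.\<close>

lemma gram_sum_nonneg:
  assumes "finite I"
  shows "(\<Sum>p\<in>I. \<Sum>q\<in>I. gram (f p) (f q)) \<ge> 0"
proof -
  have fin: "finite (UNIV :: flag set)" unfolding UNIV_flag by simp
  define X :: "flag \<Rightarrow> real" where "X i = (\<Sum>p\<in>I. if f p = i then 1 else 0)" for i
  have one: "(\<Sum>p\<in>I. g (f p)) = (\<Sum>i\<in>UNIV. g i * X i)" for g :: "flag \<Rightarrow> real"
  proof -
    have "(\<Sum>i\<in>UNIV. g i * X i) = (\<Sum>i\<in>UNIV. \<Sum>p\<in>I. if f p = i then g i else 0)"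
      unfolding X_def by (simp add: sum_distrib_left if_distrib cong: if_cong)
    also have "\<dots> = (\<Sum>p\<in>I. \<Sum>i\<in>UNIV. if f p = i then g i else 0)" by (rule sum.swap)
    also have "\<dots> = (\<Sum>p\<in>I. g (f p))" using fin by (simp add: sum.delta)
    finally show ?thesis ..
  qed
  have "real_of_int (\<Sum>p\<in>I. \<Sum>q\<in>I. gram (f p) (f q)) = (\<Sum>p\<in>I. \<Sum>q\<in>I. of_int (gram (f p) (f q)))"
    by simp
  also have "\<dots> = (\<Sum>i\<in>UNIV. (\<Sum>j\<in>UNIV. of_int (gram i j) * X j) * X i)"
    unfolding one[of "\<lambda>j. of_int (gram (f _) j)"] by (rule one)
  also have "\<dots> = (\<Sum>i\<in>UNIV. \<Sum>j\<in>UNIV. of_int (gram i j) * X i * X j)"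
    by (simp add: sum_distrib_left sum_distrib_right mult_ac)
  also have "\<dots> \<ge> 0" by (rule gram_form_nonneg)
  finally show ?thesis by (simp only: of_int_0_le_iff)
qed

text \<open>Repeated vertices are essential here: only when w, z and x, y range independently over V
  is the sum over a root pair a value of the form. The passage to distinct vertices costs an error
  of order n^5.\<close>

lemma sum_pair_l_nonneg:
  assumes "finite V"
  shows "(\<Sum>xs\<in>lists_of V 6. pair_l e xs) \<ge> 0"
proof -
  have "(\<Sum>xs\<in>lists_of V 6. pair_l e xs) =
    (\<Sum>u\<in>V. \<Sum>v\<in>V. \<Sum>w\<in>V. \<Sum>z\<in>V. \<Sum>x\<in>V. \<Sum>y\<in>V. gram (flag_of e u v w z) (flag_of e u v x y))"
    by (simp add: numeral_eq_Suc sum_lists_of_Suc lists_of_0 pair_l_def pair_form_def)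
  also have "\<dots> = (\<Sum>u\<in>V. \<Sum>v\<in>V. \<Sum>p\<in>V \<times> V. \<Sum>q\<in>V \<times> V.
      gram (flag_of e u v (fst p) (snd p)) (flag_of e u v (fst q) (snd q)))"
    by (simp only: sum.cartesian_product' fst_conv snd_conv)
  also have "\<dots> \<ge> 0"
    by (intro sum_nonneg gram_sum_nonneg) (simp add: assms)
  finally show ?thesis .
qed

section \<open>The quadruple sum and ordered quadruples with three edges\<close>

definition three_edges :: "('a \<Rightarrow> 'a \<Rightarrow> bool) \<Rightarrow> 'a \<Rightarrow> 'a \<Rightarrow> 'a \<Rightarrow> 'a \<Rightarrow> bool" where
  "three_edges e a b c d \<longleftrightarrow>
     (of_bool (e a b) + of_bool (e a c) + of_bool (e a d) + of_bool (e b c) + of_bool (e b d) + of_bool (e c d) = (3 :: nat))"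

definition sgn_b :: "bool \<Rightarrow> int" where "sgn_b b = (if b then 1 else - 1)"

lemma quad_eq:
  "quad e a b c d = 36 - 72 * of_bool (three_edges e a b c d)
     - 12 * (sgn_b (e a b) * sgn_b (e c d)) - 12 * (sgn_b (e a c) * sgn_b (e b d)) - 12 * (sgn_b (e a d) * sgn_b (e b c))"
  unfolding quad_def quad6_def three_edges_def sgn_b_def by auto

text \<open>After reordering the sums, each of the three perfect matchings contributes the same
  square of the total sign S; the three squares are dropped.\<close>

lemma sum_quad_le:
  assumes "finite V"
  shows "(\<Sum>a\<in>V. \<Sum>b\<in>V. \<Sum>c\<in>V. \<Sum>d\<in>V. quad e a b c d) \<le>
    36 * int (card V) ^ 4 - 72 * (\<Sum>a\<in>V. \<Sum>b\<in>V. \<Sum>c\<in>V. \<Sum>d\<in>V. of_bool (three_edges e a b c d))"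
proof -
  define S where "S = (\<Sum>a\<in>V. \<Sum>b\<in>V. sgn_b (e a b))"
  have m1: "(\<Sum>a\<in>V. \<Sum>b\<in>V. \<Sum>c\<in>V. \<Sum>d\<in>V. sgn_b (e a b) * sgn_b (e c d)) = S * S"
  proof -
    have "(\<Sum>a\<in>V. \<Sum>b\<in>V. \<Sum>c\<in>V. \<Sum>d\<in>V. sgn_b (e a b) * sgn_b (e c d)) = (\<Sum>a\<in>V. \<Sum>b\<in>V. sgn_b (e a b) * S)"
      unfolding S_def sum_distrib_left ..
    also have "\<dots> = (\<Sum>a\<in>V. \<Sum>b\<in>V. sgn_b (e a b)) * S"
      unfolding sum_distrib_right ..
    finally show ?thesis by (simp only: S_def)
  qed
  have "(\<Sum>a\<in>V. \<Sum>b\<in>V. \<Sum>c\<in>V. \<Sum>d\<in>V. sgn_b (e a c) * sgn_b (e b d)) =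
      (\<Sum>a\<in>V. \<Sum>c\<in>V. \<Sum>b\<in>V. \<Sum>d\<in>V. sgn_b (e a c) * sgn_b (e b d))"
    by (rule sum.cong[OF refl], rule sum.swap)
  then have m2: "(\<Sum>a\<in>V. \<Sum>b\<in>V. \<Sum>c\<in>V. \<Sum>d\<in>V. sgn_b (e a c) * sgn_b (e b d)) = S * S"
    using m1 by simp
  have "(\<Sum>a\<in>V. \<Sum>b\<in>V. \<Sum>c\<in>V. \<Sum>d\<in>V. sgn_b (e a d) * sgn_b (e b c)) =
      (\<Sum>a\<in>V. \<Sum>b\<in>V. \<Sum>d\<in>V. \<Sum>c\<in>V. sgn_b (e a d) * sgn_b (e b c))"
    by (rule sum.cong[OF refl], rule sum.cong[OF refl], rule sum.swap)
  also have "\<dots> = (\<Sum>a\<in>V. \<Sum>d\<in>V. \<Sum>b\<in>V. \<Sum>c\<in>V. sgn_b (e a d) * sgn_b (e b c))"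
    by (rule sum.cong[OF refl], rule sum.swap)
  finally have m3: "(\<Sum>a\<in>V. \<Sum>b\<in>V. \<Sum>c\<in>V. \<Sum>d\<in>V. sgn_b (e a d) * sgn_b (e b c)) = S * S"
    using m1 by simp
  have c: "(\<Sum>a\<in>V. \<Sum>b\<in>V. \<Sum>c\<in>V. \<Sum>d\<in>V. k * F a b c d) = k * (\<Sum>a\<in>V. \<Sum>b\<in>V. \<Sum>c\<in>V. \<Sum>d\<in>V. F a b c d)"
    for k :: int and F
    by (simp only: sum_distrib_left)
  have "(\<Sum>a\<in>V. \<Sum>b\<in>V. \<Sum>c\<in>V. \<Sum>d\<in>V. quad e a b c d) =
    36 * int (card V) ^ 4 - 72 * (\<Sum>a\<in>V. \<Sum>b\<in>V. \<Sum>c\<in>V. \<Sum>d\<in>V. of_bool (three_edges e a b c d))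
     - 12 * (S * S) - 12 * (S * S) - 12 * (S * S)"
    unfolding quad_eq sum_subtractf c m1 m2 m3
    by (simp add: power_numeral_reduce)
  then show ?thesis by simp
qed

definition adj :: "'a set set \<Rightarrow> 'a \<Rightarrow> 'a \<Rightarrow> bool" where
  "adj E x y \<longleftrightarrow> {x, y} \<in> E"

lemma sym_rel_adj: "sym_rel (adj E)"
  unfolding sym_rel_def adj_def by (simp add: insert_commute)

lemma card_Int_eq_sum: "finite F \<Longrightarrow> card (E \<inter> F) = (\<Sum>x\<in>F. of_bool (x \<in> E))"
  by (simp add: Int_commute of_bool_def sum.If_cases)

lemma card_edges4:
  assumes "distinct [a, b, c, d]"
  shows "card (E \<inter> [{a, b, c, d}]\<^bsup>2\<^esup>) =
    of_bool (adj E a b) + of_bool (adj E a c) + of_bool (adj E a d) +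
    of_bool (adj E b c) + of_bool (adj E b d) + of_bool (adj E c d)"
proof -
  have "[{a, b, c, d}]\<^bsup>2\<^esup> = {{a, b}, {a, c}, {a, d}, {b, c}, {b, d}, {c, d}}"
    using assms unfolding nsets_2_eq by auto
  then show ?thesis
    using assms by (simp add: card_Int_eq_sum adj_def doubleton_eq_iff)
qed

lemma three_edges_adj:
  assumes "distinct [a, b, c, d]"
  shows "three_edges (adj E) a b c d \<longleftrightarrow> card (E \<inter> [{a, b, c, d}]\<^bsup>2\<^esup>) = 3"
  unfolding three_edges_def card_edges4[OF assms] ..

lemma list4_conv: "length xs = 4 \<Longrightarrow> xs = [xs ! 0, xs ! 1, xs ! 2, xs ! 3]"
  by (rule nth_equalityI) (auto simp: less_Suc_eq numeral_eq_Suc)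

text \<open>Each 4-set has 24 orderings. The right side may be larger, since tuples with a repeated
  vertex can satisfy \<open>three_edges\<close>: for a = b, an edge cd and an edge ac give three as
  well.\<close>

lemma Lambda_le_ordered:
  assumes V: "finite V"
  shows "24 * int (Lambda 4 3 V E) \<le> (\<Sum>a\<in>V. \<Sum>b\<in>V. \<Sum>c\<in>V. \<Sum>d\<in>V. of_bool (three_edges (adj E) a b c d))"
proof -
  define Q where "Q = {S \<in> [V]\<^bsup>4\<^esup>. card (E \<inter> [S]\<^bsup>2\<^esup>) = 3}"
  define P where "P S = {xs. length xs = 4 \<and> distinct xs \<and> set xs \<subseteq> S}" for S :: "'a set"
  define W where "W = {xs \<in> lists_of V 4. three_edges (adj E) (xs ! 0) (xs ! 1) (xs ! 2) (xs ! 3)}"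
  have finQ: "finite Q"
    unfolding Q_def using finite_imp_finite_nsets[OF V] by simp
  have Q: "finite S" "card S = 4" "S \<subseteq> V" if "S \<in> Q" for S
    using that by (auto simp: Q_def nsets_def)
  have setP: "set xs = S" if "S \<in> Q" "xs \<in> P S" for S xs
    using that Q[OF that(1)] by (simp add: P_def card_subset_eq distinct_card)
  have cardP: "card (P S) = 24" if "S \<in> Q" for S
    unfolding P_def using card_lists_distinct_length_eq[of S 4] Q[OF that]
    by (simp add: numeral_eq_Suc atLeastAtMostSuc_conv)
  have "(\<Union>S\<in>Q. P S) \<subseteq> W"
  proof
    fix xs assume "xs \<in> (\<Union>S\<in>Q. P S)"
    then obtain S where S: "S \<in> Q" and xP: "xs \<in> P S" by blast
    have "length xs = 4" and dist: "distinct xs" using xP by (simp_all add: P_def)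
    then obtain a b c d where abcd: "xs = [a, b, c, d]"
      using list4_conv by blast
    have set: "{a, b, c, d} = S" using setP[OF S xP] by (simp add: abcd)
    have "card (E \<inter> [S]\<^bsup>2\<^esup>) = 3" using S by (simp add: Q_def)
    then have "three_edges (adj E) a b c d"
      using three_edges_adj[of a b c d E] dist unfolding abcd set by blast
    moreover have "{a, b, c, d} \<subseteq> V" using set Q(3)[OF S] by blast
    ultimately show "xs \<in> W"
      by (simp add: W_def abcd lists_of_def)
  qed
  moreover have "finite W"
    unfolding W_def using finite_lists_of[OF V] by simp
  ultimately have "card (\<Union>S\<in>Q. P S) \<le> card W"
    by (simp add: card_mono)
  moreover have "card (\<Union>S\<in>Q. P S) = (\<Sum>S\<in>Q. card (P S))"
  proof (rule card_UN_disjoint[OF finQ])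
    show "\<forall>S\<in>Q. finite (P S)"
      using cardP by (metis card.infinite zero_neq_numeral)
    show "\<forall>S\<in>Q. \<forall>T\<in>Q. S \<noteq> T \<longrightarrow> P S \<inter> P T = {}"
      using setP by blast
  qed
  moreover have "(\<Sum>S\<in>Q. card (P S)) = 24 * card Q"
    using cardP by simp
  moreover have "int (card W) = (\<Sum>xs\<in>lists_of V 4. of_bool (three_edges (adj E) (xs ! 0) (xs ! 1) (xs ! 2) (xs ! 3)))"
    unfolding W_def by (rule card_filter_eq_sum[OF finite_lists_of[OF V]])
  moreover have "\<dots> = (\<Sum>a\<in>V. \<Sum>b\<in>V. \<Sum>c\<in>V. \<Sum>d\<in>V. of_bool (three_edges (adj E) a b c d))"
    by (simp add: numeral_eq_Suc sum_lists_of_Suc lists_of_0)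
  ultimately show ?thesis
    unfolding Lambda_def Q_def[symmetric] by linarith
qed

text \<open>The certificate is summed over distinct tuples, the square and the form over all tuples.
  The at most 15 n^5 tuples in between carry values up to 48 and 96, whence 75600 = 15 times 720
  plus 45 times 1440. The factor 540 is 15 times 36.\<close>

theorem card_nontight_le:
  assumes V: "finite V"
  defines "n \<equiv> int (card V)"
  shows "int (card {xs \<in> dlists_of V 6. odd_l (adj E) xs \<in> {5..15}}) \<le>
    540 * n ^ 2 * (n ^ 4 - 48 * int (Lambda 4 3 V E)) + 75600 * n ^ 5"
proof -
  let ?e = "adj E" and ?D = "dlists_of V 6" and ?L = "lists_of V 6"
  have fin: "finite ?D" "finite ?L" and sub: "?D \<subseteq> ?L"
    using finite_dlists_of[OF V] finite_lists_of[OF V] by (auto simp: dlists_of_def)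
  have diff: "int (card (?L - ?D)) \<le> 15 * n ^ 5"
    using card_nondistinct_lists[OF V] unfolding n_def by (simp flip: of_nat_power of_nat_mult of_nat_le_iff)
  have cert: "of_bool (odd_l ?e xs \<in> {5..15}) \<le> cert_l ?e xs" for xs
    using sym_rel.good6[OF sym_rel_adj, of E "xs ! 0" "xs ! 1" "xs ! 2" "xs ! 3" "xs ! 4" "xs ! 5"]
    unfolding good6_def odd_l_def cert_l_def by (simp add: of_bool_def)
  have "int (card {xs \<in> ?D. odd_l ?e xs \<in> {5..15}}) = (\<Sum>xs\<in>?D. of_bool (odd_l ?e xs \<in> {5..15}))"
    by (rule card_filter_eq_sum[OF fin(1)])
  also have "\<dots> \<le> (\<Sum>xs\<in>?D. cert_l ?e xs)"
    by (intro sum_mono cert)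
  also have "\<dots> = 15 * (\<Sum>xs\<in>?D. quad_l ?e xs) - 45 * (\<Sum>xs\<in>?D. pair_l ?e xs)"
    by (rule sum_cert_l[OF V])
  finally have main: "int (card {xs \<in> ?D. odd_l ?e xs \<in> {5..15}}) \<le> \<dots>" .
  have split: "(\<Sum>xs\<in>?D. F xs) = (\<Sum>xs\<in>?L. F xs) - (\<Sum>xs\<in>?L - ?D. F xs)" for F :: "'a list \<Rightarrow> int"
    using sum.subset_diff[OF sub fin(2), of F] by simp
  have "\<bar>\<Sum>xs\<in>?L - ?D. quad_l ?e xs\<bar> \<le> (\<Sum>xs\<in>?L - ?D. 48)"
    by (rule order_trans[OF sum_abs sum_mono]) (simp add: quad_l_def quad_abs_le)
  then have q: "\<bar>\<Sum>xs\<in>?L - ?D. quad_l ?e xs\<bar> \<le> 720 * n ^ 5"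
    using diff by simp
  have "\<bar>\<Sum>xs\<in>?L - ?D. pair_l ?e xs\<bar> \<le> (\<Sum>xs\<in>?L - ?D. 96)"
    by (rule order_trans[OF sum_abs sum_mono]) (simp add: pair_l_def pair_form_def gram_abs_le)
  then have p: "\<bar>\<Sum>xs\<in>?L - ?D. pair_l ?e xs\<bar> \<le> 1440 * n ^ 5"
    using diff by simp
  have "(\<Sum>xs\<in>?L. quad_l ?e xs) = n\<^sup>2 * (\<Sum>a\<in>V. \<Sum>b\<in>V. \<Sum>c\<in>V. \<Sum>d\<in>V. quad ?e a b c d)"
    unfolding n_def by (simp add: numeral_eq_Suc sum_lists_of_Suc lists_of_0 quad_l_def sum_distrib_left mult_ac card_lists_of[OF V])
  also have "\<dots> \<le> n\<^sup>2 * (36 * n ^ 4 - 72 * (24 * int (Lambda 4 3 V E)))"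
    using sum_quad_le[OF V, of ?e] Lambda_le_ordered[OF V, of E] unfolding n_def
    by (intro mult_left_mono) auto
  finally have "(\<Sum>xs\<in>?L. quad_l ?e xs) \<le> 36 * n\<^sup>2 * (n ^ 4 - 48 * int (Lambda 4 3 V E))"
    by (simp add: algebra_simps)
  then show ?thesis
    using main split[of "quad_l ?e"] split[of "pair_l ?e"] q p sum_pair_l_nonneg[OF V, of ?e] by linarith
qed

section \<open>Approximate structure\<close>

definition clean_l :: "('a \<Rightarrow> 'a \<Rightarrow> bool) \<Rightarrow> 'a list \<Rightarrow> bool" where
  "clean_l e xs \<longleftrightarrow> odd3 e (xs ! 0) (xs ! 1) (xs ! 2) + odd3 e (xs ! 0) (xs ! 1) (xs ! 3) +
     odd3 e (xs ! 0) (xs ! 2) (xs ! 3) + odd3 e (xs ! 1) (xs ! 2) (xs ! 3) \<in> {0, 4}"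

text \<open>Each of the 20 triples lies in three of the 15 quadruples. If no quadruple were clean,
  each would contain between 1 and 3 odd triples, so three times the number of odd triples would lie
  between 15 and 45.\<close>

lemma clean_exists:
  assumes "odd_l e xs \<notin> {5..15}"
  shows "\<exists>p\<in>set perms15. clean_l e (map ((!) xs) p)"
proof (rule ccontr)
  assume no: "\<not> ?thesis"
  define o3 where "o3 i j k = odd3 e (xs ! i) (xs ! j) (xs ! k)" for i j k
  define s where "s i j k l = o3 i j k + o3 i j l + o3 i k l + o3 j k l" for i j k l
  define P where "P i j k l \<longleftrightarrow> 1 \<le> s i j k l \<and> s i j k l \<le> 3" for i j k l
  have "P (p ! 0) (p ! 1) (p ! 2) (p ! 3)" if p: "p \<in> set perms15" for p
  proof -
    have "length p = 6" using p by (auto simp: perms15_def)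
    then have "o3 (p ! 0) (p ! 1) (p ! 2) + o3 (p ! 0) (p ! 1) (p ! 3) +
      o3 (p ! 0) (p ! 2) (p ! 3) + o3 (p ! 1) (p ! 2) (p ! 3) \<notin> {0, 4}"
      using no p unfolding clean_l_def o3_def by auto
    moreover have "o3 i j k \<le> 1" for i j k unfolding o3_def by (rule odd3_le)
    note this[of "p ! 0" "p ! 1" "p ! 2"] this[of "p ! 0" "p ! 1" "p ! 3"]
      this[of "p ! 0" "p ! 2" "p ! 3"] this[of "p ! 1" "p ! 2" "p ! 3"]
    ultimately show ?thesis unfolding P_def s_def by (simp only: insert_iff empty_iff) linarith
  qed
  then have "\<forall>p\<in>set perms15. P (p ! 0) (p ! 1) (p ! 2) (p ! 3)" by blast
  then have "P 0 1 2 3 \<and> P 0 1 2 4 \<and> P 0 1 2 5 \<and> P 0 1 3 4 \<and> P 0 1 3 5 \<and> P 0 1 4 5 \<and> P 0 2 3 4 \<and> P 0 2 3 5 \<and> P 0 2 4 5 \<and> P 0 3 4 5 \<and> P 1 2 3 4 \<and> P 1 2 3 5 \<and> P 1 2 4 5 \<and> P 1 3 4 5 \<and> P 2 3 4 5"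
    unfolding perms15_def by simp
  then have "15 \<le> s 0 1 2 3 + s 0 1 2 4 + s 0 1 2 5 + s 0 1 3 4 + s 0 1 3 5 + s 0 1 4 5 + s 0 2 3 4 + s 0 2 3 5 + s 0 2 4 5 + s 0 3 4 5 + s 1 2 3 4 + s 1 2 3 5 + s 1 2 4 5 + s 1 3 4 5 + s 2 3 4 5"
    and "s 0 1 2 3 + s 0 1 2 4 + s 0 1 2 5 + s 0 1 3 4 + s 0 1 3 5 + s 0 1 4 5 + s 0 2 3 4 + s 0 2 3 5 + s 0 2 4 5 + s 0 3 4 5 + s 1 2 3 4 + s 1 2 3 5 + s 1 2 4 5 + s 1 3 4 5 + s 2 3 4 5 \<le> 45"
    unfolding P_def by linarith+
  moreover have "s 0 1 2 3 + s 0 1 2 4 + s 0 1 2 5 + s 0 1 3 4 + s 0 1 3 5 + s 0 1 4 5 + s 0 2 3 4 + s 0 2 3 5 + s 0 2 4 5 + s 0 3 4 5 + s 1 2 3 4 + s 1 2 3 5 + s 1 2 4 5 + s 1 3 4 5 + s 2 3 4 5 = 3 * odd_l e xs"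
    unfolding s_def odd_l_def odd_triples_def o3_def by simp
  ultimately have "5 \<le> odd_l e xs \<and> odd_l e xs \<le> 15" by linarith
  then show False using assms by simp
qed

text \<open>A 6-tuple that is not bad has a clean quadruple in one of 15 position patterns. The
  patterns are equally frequent by symmetry, and a clean quadruple in front leaves at most n^2
  choices for the rest.\<close>

lemma card_clean_ge:
  assumes V: "finite V" and B: "card {xs \<in> dlists_of V 6. odd_l e xs \<in> {5..15}} \<le> b"
  shows "card V ^ 6 \<le> 15 * card V ^ 5 + b + 15 * (card {T \<in> dlists_of V 4. clean_l e T} * card V ^ 2)"
proof -
  let ?D = "dlists_of V 6" and ?B = "{xs \<in> dlists_of V 6. odd_l e xs \<in> {5..15}}"
  let ?C = "{T \<in> dlists_of V 4. clean_l e T}"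
  define G where "G = {xs \<in> ?D. clean_l e xs}"
  have fin: "finite ?D" by (rule finite_dlists_of[OF V])
  have G: "card {xs \<in> ?D. clean_l e (map ((!) xs) p)} = card G" if "p \<in> set perms15" for p
  proof -
    have "int (card {xs \<in> ?D. clean_l e (map ((!) xs) p)}) = int (card G)"
      unfolding G_def card_filter_eq_sum[OF fin]
      using sum_dlists_permute[OF V, of p 6 "\<lambda>xs. of_bool (clean_l e xs)"] perms_are_perms[of p] that by simp
    then show ?thesis by simp
  qed
  have "?D - ?B \<subseteq> (\<Union>p\<in>set perms15. {xs \<in> ?D. clean_l e (map ((!) xs) p)})"
    using clean_exists by blast
  then have "card (?D - ?B) \<le> card (\<Union>p\<in>set perms15. {xs \<in> ?D. clean_l e (map ((!) xs) p)})"
    using fin by (intro card_mono) auto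
  also have "\<dots> \<le> (\<Sum>p\<in>set perms15. card {xs \<in> ?D. clean_l e (map ((!) xs) p)})"
    by (rule card_UN_le) simp
  also have "\<dots> \<le> 15 * card G"
    using G card_length[of perms15] by (simp add: perms15_def)
  also have "card G \<le> card (?C \<times> lists_of V 2)"
  proof (rule card_inj_on_le[of "\<lambda>xs. (take 4 xs, drop 4 xs)"])
    show "inj_on (\<lambda>xs. (take 4 xs, drop 4 xs)) G"
      by (rule inj_onI) (metis append_take_drop_id prod.inject)
    show "(\<lambda>xs. (take 4 xs, drop 4 xs)) ` G \<subseteq> ?C \<times> lists_of V 2"
      by (auto simp: G_def dlists_of_def lists_of_def clean_l_def dest: in_set_takeD in_set_dropD)
    show "finite (?C \<times> lists_of V 2)"
      using finite_dlists_of[OF V] finite_lists_of[OF V] by simp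
  qed
  also have "\<dots> = card ?C * card V ^ 2"
    by (simp add: card_cartesian_product card_lists_of[OF V])
  finally have "card (?D - ?B) \<le> 15 * (card ?C * card V ^ 2)" by simp
  moreover have "card ?D \<le> card (?D - ?B) + b"
    using B card_Diff_subset[of ?B ?D] fin by simp
  moreover have "card V ^ 6 \<le> card ?D + 15 * card V ^ 5"
  proof -
    have "card (lists_of V 6 - ?D) = card V ^ 6 - card ?D"
      using card_Diff_subset[OF fin] card_lists_of[OF V] by (metis (no_types, lifting) dlists_of_def mem_Collect_eq subsetI)
    then show ?thesis using card_nondistinct_lists[OF V] by linarith
  qed
  ultimately show ?thesis by linarith
qed

lemma sum_card_ext2:
  assumes V: "finite V" and B: "B \<subseteq> dlists_of V 6"
  shows "(\<Sum>T\<in>dlists_of V 4. card {(x, y). T @ [x, y] \<in> B}) \<le> card B"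
proof -
  let ?X = "\<lambda>T. {(x, y). T @ [x, y] \<in> B}"
  have finB: "finite B" using B finite_dlists_of[OF V] finite_subset by blast
  have finX: "finite (?X T)" for T
  proof (rule finite_subset[of _ "V \<times> V"])
    show "?X T \<subseteq> V \<times> V" using B by (auto simp: dlists_of_def lists_of_def)
  qed (use V in simp)
  have "(\<Sum>T\<in>dlists_of V 4. card (?X T)) = card (SIGMA T:dlists_of V 4. ?X T)"
    using finX finite_dlists_of[OF V] by (simp add: card_SigmaI)
  also have "\<dots> \<le> card B"
    by (rule card_inj_on_le[of "\<lambda>(T, x, y). T @ [x, y]"]) (auto simp: inj_on_def finB)
  finally show ?thesis .
qed

text \<open>\<open>take 3\<close> forgets the last entry of T; its possible values account for the
  factor \<open>card V\<close>.\<close>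

lemma sum_card_ext3:
  assumes V: "finite V" and B: "B \<subseteq> dlists_of V 6"
  shows "(\<Sum>T\<in>dlists_of V 4. card {(x, y, z). take 3 T @ [x, y, z] \<in> B}) \<le> card V * card B"
proof -
  let ?X = "\<lambda>T. {(x, y, z). take 3 T @ [x, y, z] \<in> B}"
  have finB: "finite B" using B finite_dlists_of[OF V] finite_subset by blast
  have finX: "finite (?X T)" for T
  proof (rule finite_subset[of _ "V \<times> V \<times> V"])
    show "?X T \<subseteq> V \<times> V \<times> V" using B by (auto simp: dlists_of_def lists_of_def)
  qed (use V in simp)
  have "(\<Sum>T\<in>dlists_of V 4. card (?X T)) = card (SIGMA T:dlists_of V 4. ?X T)"
    using finX finite_dlists_of[OF V] by (simp add: card_SigmaI)
  also have "\<dots> \<le> card (V \<times> B)"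
  proof (rule card_inj_on_le[of "\<lambda>(T, x, y, z). (T ! 3, take 3 T @ [x, y, z])"])
    have eq: "T = take 3 T @ [T ! 3]" if "length T = 4" for T :: "'a list"
      using that by (metis Suc_eq_numeral lessI numeral_3_eq_3 numeral_eq_Suc pred_numeral_simps(3) take_Suc_conv_app_nth take_all_iff order_refl semiring_norm(26,27) num.size eval_nat_numeral)
    show "inj_on (\<lambda>(T, x, y, z). (T ! 3, take 3 T @ [x, y, z])) (SIGMA T:dlists_of V 4. ?X T)"
    proof (rule inj_onI)
      fix s t assume st: "s \<in> (SIGMA T:dlists_of V 4. ?X T)" "t \<in> (SIGMA T:dlists_of V 4. ?X T)"
        and eq2: "(\<lambda>(T, x, y, z). (T ! 3, take 3 T @ [x, y, z])) s = (\<lambda>(T, x, y, z). (T ! 3, take 3 T @ [x, y, z])) t"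
      obtain T x y z T' x' y' z' where s: "s = (T, x, y, z)" and t: "t = (T', x', y', z')"
        by (metis prod.exhaust)
      have len: "length T = 4" "length T' = 4"
        using st by (auto simp: s t dlists_of_def lists_of_def)
      have "T ! 3 = T' ! 3" "take 3 T = take 3 T'" "x = x'" "y = y'" "z = z'"
        using eq2 by (auto simp: s t)
      then show "s = t"
        using eq[OF len(1)] eq[OF len(2)] by (simp add: s t)
    qed
    show "(\<lambda>(T, x, y, z). (T ! 3, take 3 T @ [x, y, z])) ` (SIGMA T:dlists_of V 4. ?X T) \<subseteq> V \<times> B"
      by (auto simp: dlists_of_def lists_of_def intro: subsetD[OF _ nth_mem])
    show "finite (V \<times> B)" using V finB by simp
  qed
  finally show ?thesis by (simp add: card_cartesian_product)
qed

text \<open>Averaging over clean quadruples. With the pair count weighted by n, both counts together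
  sum to at most 2 K n^6, while for large n at least n^4 / 30 quadruples are clean; hence the
  constant 60. The two counts serve different purposes: the first controls vertices that do not fit
  the core, the second wrong pairs among those that do.\<close>

lemma good_core_exists:
  assumes V: "finite V" and n: "n = card V" "n \<ge> 1"
    and B: "B = {xs \<in> dlists_of V 6. odd_l e xs \<in> {5..15}}" "card B \<le> K * n ^ 5"
    and big: "n \<ge> 2 * (K + 15)"
  obtains T where "T \<in> dlists_of V 4" "clean_l e T"
    "card {(x, y). T @ [x, y] \<in> B} \<le> 60 * K * n"
    "card {(x, y, z). take 3 T @ [x, y, z] \<in> B} \<le> 60 * K * n ^ 2"
proof -
  let ?N = "\<lambda>T. card {(x, y). T @ [x, y] \<in> B}" and ?M = "\<lambda>T. card {(x, y, z). take 3 T @ [x, y, z] \<in> B}"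
  let ?C = "{T \<in> dlists_of V 4. clean_l e T}"
  have sub: "B \<subseteq> dlists_of V 6" using B by auto
  have "\<exists>T\<in>?C. ?N T \<le> 60 * K * n \<and> ?M T \<le> 60 * K * n ^ 2"
  proof (rule ccontr)
    assume no: "\<not> ?thesis"
    \<comment> \<open>The extra 1 makes the total strictly too large once some clean quadruple
      exists.\<close>
    have "60 * K * n ^ 2 + 1 \<le> n * ?N T + ?M T" if "T \<in> ?C" for T
    proof -
      have "60 * K * n < ?N T \<or> 60 * K * n ^ 2 < ?M T"
        using no that not_le by blast
      then show ?thesis
      proof
        assume "60 * K * n < ?N T"
        then have "n * (60 * K * n + 1) \<le> n * ?N T" by (intro mult_left_mono) auto
        moreover have "60 * K * n ^ 2 + 1 \<le> n * (60 * K * n + 1)" using n(2) by (simp add: power2_eq_square algebra_simps)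
        ultimately show ?thesis by linarith
      qed linarith
    qed
    then have "(\<Sum>T\<in>?C. 60 * K * n ^ 2 + 1) \<le> (\<Sum>T\<in>?C. n * ?N T + ?M T)"
      by (rule sum_mono)
    also have "\<dots> \<le> (\<Sum>T\<in>dlists_of V 4. n * ?N T + ?M T)"
      by (rule sum_mono2) (use finite_dlists_of[OF V] in auto)
    also have "\<dots> = n * (\<Sum>T\<in>dlists_of V 4. ?N T) + (\<Sum>T\<in>dlists_of V 4. ?M T)"
      by (simp add: sum.distrib sum_distrib_left)
    also have "\<dots> \<le> n * card B + n * card B"
      using sum_card_ext2[OF V sub] sum_card_ext3[OF V sub] n(1) by (intro add_mono mult_left_mono) auto
    also have "\<dots> \<le> 2 * K * n ^ 6"
    proof -
      have "n * card B \<le> n * (K * n ^ 5)" by (rule mult_left_mono[OF B(2)]) simp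
      also have "\<dots> = K * n ^ 6" by (simp add: power_numeral_reduce mult_ac)
      finally show ?thesis by linarith
    qed
    finally have 1: "card ?C * (60 * K * n ^ 2 + 1) \<le> 2 * K * n ^ 6" by simp
    have "n ^ 6 \<le> 15 * n ^ 5 + K * n ^ 5 + 15 * (card ?C * n ^ 2)"
      using card_clean_ge[OF V, of e "K * n ^ 5"] B n by simp
    moreover have "2 * (15 * n ^ 5 + K * n ^ 5) \<le> n ^ 6"
      using mult_right_mono[OF big, of "n ^ 5"] by (simp add: power_numeral_reduce algebra_simps)
    moreover have "a \<le> 30 * c" if "a \<le> b + 15 * c" "2 * b \<le> a" for a b c :: nat
      using that by linarith
    ultimately have 2: "n ^ 6 \<le> 30 * (card ?C * n ^ 2)" by blast
    have "n ^ 6 > 0" using n(2) by simp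
    then have "card ?C > 0" using 2 by (cases "card ?C") auto
    moreover have "2 * K * n ^ 6 \<le> 2 * K * (30 * (card ?C * n ^ 2))"
      by (rule mult_left_mono[OF 2]) simp
    moreover have "2 * K * (30 * (card ?C * n ^ 2)) = card ?C * (60 * K * n ^ 2)"
      by (simp add: mult_ac)
    moreover have "card ?C * (60 * K * n ^ 2 + 1) = card ?C * (60 * K * n ^ 2) + card ?C"
      by simp
    ultimately show False using 1 by linarith
  qed
  then show ?thesis using that by blast
qed

section \<open>Propagation of parities from a clean quadruple\<close>

definition odd_triple :: "('a \<Rightarrow> 'a \<Rightarrow> bool) \<Rightarrow> 'a \<Rightarrow> 'a \<Rightarrow> 'a \<Rightarrow> bool" where
  "odd_triple e a b c \<longleftrightarrow> (e a b = e a c) = e b c"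

lemma odd3_eq: "odd3 e a b c = of_bool (odd_triple e a b c)"
  unfolding odd3_def odd_b_def odd_triple_def by simp

text \<open>Each of the six pairs lies in exactly two of the four triples, so the number of odd
  triples is even.\<close>

lemma odd_triple_parity: "(odd_triple e a b c = odd_triple e a b d) = (odd_triple e a c d = odd_triple e b c d)"
  unfolding odd_triple_def by blast

definition consistent :: "('a \<Rightarrow> 'a \<Rightarrow> bool) \<Rightarrow> bool \<Rightarrow> 'a \<Rightarrow> 'a \<Rightarrow> 'a \<Rightarrow> 'a \<Rightarrow> 'a \<Rightarrow> bool" where
  "consistent e s p q r t x \<longleftrightarrow> odd_triple e p q x = s \<and> odd_triple e p r x = s \<and> odd_triple e q r x = s \<and>
     odd_triple e p t x = s \<and> odd_triple e q t x = s \<and> odd_triple e r t x = s"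

text \<open>Call a pair of core vertices wrong if its triple with x does not have parity s. By
  \<open>odd_triple_parity\<close>, each triangle of the core contains an even number of wrong
  pairs, so the wrong pairs form a cut of four points. A nonempty cut has 3 or 4 of the 6
  pairs.\<close>

lemma inconsistent_count:
  assumes "odd_triple e p q r = s" "odd_triple e p q t = s" "odd_triple e p r t = s" "odd_triple e q r t = s"
    and "\<not> consistent e s p q r t x"
  shows "of_bool (odd_triple e p q x) + of_bool (odd_triple e p r x) + of_bool (odd_triple e q r x) +
      of_bool (odd_triple e p t x) + of_bool (odd_triple e q t x) + of_bool (odd_triple e r t x) \<in> (if s then {2, 3} else {3, 4 :: nat})"
  using assms(5) odd_triple_parity[of e p q r x] odd_triple_parity[of e p q t x] odd_triple_parity[of e p r t x] odd_triple_parity[of e q r t x]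
  unfolding consistent_def assms(1-4)
  by (cases s; cases "odd_triple e p q x"; cases "odd_triple e p r x"; cases "odd_triple e q r x";
      cases "odd_triple e p t x"; cases "odd_triple e q t x"; cases "odd_triple e r t x"; simp)

text \<open>Whatever the four triples through both x and y are, the total is between 8 and 14 if s
  holds and between 6 and 12 otherwise.\<close>

lemma odd_l_two_inconsistent:
  assumes T: "odd_triple e p q r = s" "odd_triple e p q t = s" "odd_triple e p r t = s" "odd_triple e q r t = s"
    and xy: "\<not> consistent e s p q r t x" "\<not> consistent e s p q r t y"
  shows "odd_l e [p, q, r, t, x, y] \<in> {5..15}"
proof -
  define i :: "bool \<Rightarrow> nat" where "i = of_bool"
  define g where "g x = i (odd_triple e p q x) + i (odd_triple e p r x) + i (odd_triple e q r x) +
    i (odd_triple e p t x) + i (odd_triple e q t x) + i (odd_triple e r t x)" for x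
  define h where "h = i (odd_triple e p x y) + i (odd_triple e q x y) + i (odd_triple e r x y) + i (odd_triple e t x y)"
  have "i b \<le> 1" for b by (simp add: i_def)
  note this[of "odd_triple e p x y"] this[of "odd_triple e q x y"] this[of "odd_triple e r x y"] this[of "odd_triple e t x y"]
  then have "h \<le> 4" unfolding h_def by linarith
  have "odd_l e [p, q, r, t, x, y] = 4 * i s + g x + g y + h"
    unfolding odd_l_def odd_triples_def odd3_eq g_def h_def by (simp add: T i_def)
  moreover have "g x \<in> (if s then {2, 3} else {3, 4})" "g y \<in> (if s then {2, 3} else {3, 4})"
    using inconsistent_count[OF T xy(1)] inconsistent_count[OF T xy(2)] unfolding g_def i_def .
  ultimately show ?thesis
    using \<open>h \<le> 4\<close> by (cases s) (auto simp: i_def)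
qed

text \<open>By parity, a pair of x, y, z is wrong with all of p, q, r or with none, and the triple
  xyz is wrong exactly if the pair yz is. So 6 or 10 of the 20 triples are wrong. A single wrong
  pair would give only 4, which the certificate does not detect; this is why pairs of wrong pairs
  are counted.\<close>

lemma odd_l_cherry:
  assumes "odd_triple e p q r = s" "odd_triple e p q x = s" "odd_triple e p r x = s" "odd_triple e q r x = s"
    "odd_triple e p q y = s" "odd_triple e p r y = s" "odd_triple e q r y = s" "odd_triple e p q z = s" "odd_triple e p r z = s" "odd_triple e q r z = s"
    and "odd_triple e p x y \<noteq> s" "odd_triple e p x z \<noteq> s"
  shows "odd_l e [p, q, r, x, y, z] \<in> {5..15}"
proof -
  have "odd_triple e q x y = odd_triple e p x y" "odd_triple e q x z = odd_triple e p x z" "odd_triple e q y z = odd_triple e p y z"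
    using odd_triple_parity[of e p q x y] odd_triple_parity[of e p q x z] odd_triple_parity[of e p q y z] assms by auto
  moreover have "odd_triple e r x y = odd_triple e p x y" "odd_triple e r x z = odd_triple e p x z" "odd_triple e r y z = odd_triple e p y z"
    using odd_triple_parity[of e p r x y] odd_triple_parity[of e p r x z] odd_triple_parity[of e p r y z] assms by auto
  moreover have "odd_triple e x y z = odd_triple e p y z"
    using odd_triple_parity[of e p x y z] assms by auto
  ultimately show ?thesis
    using assms unfolding odd_l_def odd_triples_def odd3_eq
    by (cases s; cases "odd_triple e p y z") simp_all
qed

text \<open>The wrong pairs for the bipartition into A and its complement, as ordered pairs, so that
  each of them counts twice.\<close>

definition mismatch :: "('a \<Rightarrow> 'a \<Rightarrow> bool) \<Rightarrow> 'a set \<Rightarrow> 'a set \<Rightarrow> ('a \<times> 'a) set" where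
  "mismatch e V A = {(x, y) \<in> V \<times> V. x \<noteq> y \<and> e x y \<noteq> ((x \<in> A) = (y \<in> A))}"

lemma card_off_diagonal:
  assumes "finite S"
  shows "card {(y, z) \<in> S \<times> S. y \<noteq> z} = card S * (card S - 1)"
proof -
  have "{(y, z) \<in> S \<times> S. y \<noteq> z} = S \<times> S - (\<lambda>x. (x, x)) ` S" by auto
  moreover have "card ((\<lambda>x. (x, x)) ` S) = card S" by (rule card_image) (simp add: inj_on_def)
  ultimately show ?thesis
    using assms by (simp add: card_Diff_subset image_subset_iff card_cartesian_product diff_mult_distrib2)
qed

text \<open>Any two of the m vertices inconsistent with the core give a bad 6-tuple, so m has order
  sqrt n. Among the others, the wrong pairs form a graph with few paths of length two, and such a
  graph has few edges. The parameter L is a degree threshold, left open so that it can be chosen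
  later.\<close>

lemma near_structure:
  assumes V: "finite V" and n: "n = card V" "n \<ge> 1" and e: "sym_rel e"
    and B: "card {xs \<in> dlists_of V 6. odd_l e xs \<in> {5..15}} \<le> K * n ^ 5"
    and big: "n \<ge> 2 * (K + 15)"
  obtains A m f e' where "A \<subseteq> V" "e' = e \<or> e' = (\<lambda>x y. \<not> e x y)"
    "m \<le> n" "m * (m - 1) \<le> 60 * K * n" "\<And>L. L * f \<le> L\<^sup>2 * n + 60 * K * n\<^sup>2"
    "card (mismatch e' V A) \<le> f + 2 * (n * (m + 4))"
proof -
  define Bd where "Bd = {xs \<in> dlists_of V 6. odd_l e xs \<in> {5..15}}"
  obtain T where T: "T \<in> dlists_of V 4" "clean_l e T"
    and N: "card {(x, y). T @ [x, y] \<in> Bd} \<le> 60 * K * n"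
    and M: "card {(x, y, z). take 3 T @ [x, y, z] \<in> Bd} \<le> 60 * K * n ^ 2"
    using good_core_exists[OF V n Bd_def _ big] B unfolding Bd_def by blast
  have "length T = 4" using T by (simp add: dlists_of_def lists_of_def)
  then obtain p q r t where pqrt: "T = [p, q, r, t]" using list4_conv by blast
  have in_V: "{p, q, r, t} \<subseteq> V" and dist: "distinct [p, q, r, t]"
    using T(1) by (auto simp: pqrt dlists_of_def lists_of_def)
  define s where "s = odd_triple e p q r"
  have s: "odd_triple e p q r = s" "odd_triple e p q t = s" "odd_triple e p r t = s" "odd_triple e q r t = s"
    using T(2) unfolding clean_l_def pqrt odd3_eq s_def by (auto simp: of_bool_def split: if_splits)
  define U where "U = V - {p, q, r, t}"
  define X where "X = {x \<in> U. \<not> consistent e s p q r t x}"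
  define Y where "Y = U - X"
  have fin: "finite U" "finite X" "finite Y" using V by (auto simp: U_def X_def Y_def)
  define m where "m = card X"
  have "m * (m - 1) = card {(x, y) \<in> X \<times> X. x \<noteq> y}"
    unfolding m_def by (rule card_off_diagonal[OF fin(2), symmetric])
  also have "\<dots> \<le> card {(x, y). T @ [x, y] \<in> Bd}"
  proof (rule card_mono)
    show "finite {(x, y). T @ [x, y] \<in> Bd}"
      by (rule finite_subset[of _ "V \<times> V"]) (auto simp: Bd_def dlists_of_def lists_of_def V)
    show "{(x, y) \<in> X \<times> X. x \<noteq> y} \<subseteq> {(x, y). T @ [x, y] \<in> Bd}"
      using odd_l_two_inconsistent[OF s] in_V dist
      by (auto simp: pqrt Bd_def X_def U_def dlists_of_def lists_of_def simp del: atLeastAtMost_iff)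
  qed
  finally have m: "m * (m - 1) \<le> 60 * K * n" using N by linarith
  define F where "F x = {y \<in> Y. y \<noteq> x \<and> odd_triple e p x y \<noteq> s}" for x
  have finF: "finite (F x)" for x using fin by (simp add: F_def)
  define f where "f = (\<Sum>x\<in>Y. card (F x))"
  have Ycons: "consistent e s p q r t x" "x \<in> V" "x \<noteq> p" "x \<noteq> q" "x \<noteq> r" if "x \<in> Y" for x
    using that by (auto simp: Y_def X_def U_def)
  have "finite {(y, z) \<in> F x \<times> F x. y \<noteq> z}" for x
    by (rule finite_subset[of _ "F x \<times> F x"]) (use finF in auto)
  then have "card (SIGMA x:Y. {(y, z) \<in> F x \<times> F x. y \<noteq> z}) = (\<Sum>x\<in>Y. card {(y, z) \<in> F x \<times> F x. y \<noteq> z})"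
    by (intro card_SigmaI[OF fin(3)]) blast
  then have "(\<Sum>x\<in>Y. card (F x) * (card (F x) - 1)) = card (SIGMA x:Y. {(y, z) \<in> F x \<times> F x. y \<noteq> z})"
    by (simp only: card_off_diagonal[OF finF])
  also have "\<dots> \<le> card {(x, y, z). take 3 T @ [x, y, z] \<in> Bd}"
  proof (rule card_mono)
    show "finite {(x, y, z). take 3 T @ [x, y, z] \<in> Bd}"
      by (rule finite_subset[of _ "V \<times> V \<times> V"]) (auto simp: Bd_def dlists_of_def lists_of_def V)
    show "(SIGMA x:Y. {(y, z) \<in> F x \<times> F x. y \<noteq> z}) \<subseteq> {(x, y, z). take 3 T @ [x, y, z] \<in> Bd}"
    proof (clarify)
      fix x y z assume x: "x \<in> Y" and "y \<in> F x" "z \<in> F x" "y \<noteq> z"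
      then have yz: "y \<in> Y" "z \<in> Y" "y \<noteq> x" "z \<noteq> x" "odd_triple e p x y \<noteq> s" "odd_triple e p x z \<noteq> s" by (auto simp: F_def)
      have "odd_l e [p, q, r, x, y, z] \<in> {5..15}"
        by (rule odd_l_cherry[of e p q r s])
          (use s(1) yz Ycons(1)[OF x] Ycons(1)[OF yz(1)] Ycons(1)[OF yz(2)] in \<open>simp_all add: consistent_def\<close>)
      then show "take 3 T @ [x, y, z] \<in> Bd"
        using x yz \<open>y \<noteq> z\<close> Ycons[OF x] Ycons[OF yz(1)] Ycons[OF yz(2)] in_V dist
        by (auto simp: pqrt Bd_def dlists_of_def lists_of_def simp del: atLeastAtMost_iff)
    qed
  qed
  finally have cherries: "(\<Sum>x\<in>Y. card (F x) * (card (F x) - 1)) \<le> 60 * K * n ^ 2" using M by linarith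
  have Lf: "L * f \<le> L\<^sup>2 * n + 60 * K * n\<^sup>2" for L
  proof -
    \<comment> \<open>A degree up to L is paid for by the square of L, a larger one by d - 1 >=
      L.\<close>
    have d: "L * d \<le> L\<^sup>2 + d * (d - 1)" for d
    proof (cases "d \<le> L")
      case True then show ?thesis using mult_left_mono[OF True, of L] unfolding power2_eq_square by linarith
    next
      case False
      then have "d * L \<le> d * (d - 1)" by (intro mult_left_mono) auto
      then show ?thesis using mult.commute[of d L] by linarith
    qed
    have "L * f = (\<Sum>x\<in>Y. L * card (F x))" by (simp add: f_def sum_distrib_left)
    also have "\<dots> \<le> (\<Sum>x\<in>Y. L\<^sup>2 + card (F x) * (card (F x) - 1))" by (intro sum_mono d)
    also have "\<dots> = card Y * L\<^sup>2 + (\<Sum>x\<in>Y. card (F x) * (card (F x) - 1))" by (simp add: sum.distrib)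
    also have "card Y * L\<^sup>2 \<le> n * L\<^sup>2"
      unfolding n(1) by (intro mult_right_mono card_mono V) (auto simp: Y_def U_def)
    finally show ?thesis using cherries by (simp add: mult.commute)
  qed
  \<comment> \<open>If the triple p, x, y is odd, then x and y are adjacent exactly when they agree
    in their adjacency to p; if it is even, this describes the complement.\<close>
  define A where "A = {x \<in> V. e p x}"
  define e' where "e' = (if s then e else (\<lambda>x y. \<not> e x y))"
  define Z where "Z = X \<union> {p, q, r, t}"
  have "card Z \<le> m + 4"
    unfolding Z_def m_def using card_Un_le[of X "{p, q, r, t}"] card_length[of "[p, q, r, t]"] by simp
  have Zfin: "finite Z" using fin by (simp add: Z_def)
  have sub: "mismatch e' V A \<subseteq> (SIGMA x:Y. F x) \<union> (Z \<times> V \<union> V \<times> Z)"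
  proof
    fix w assume w: "w \<in> mismatch e' V A"
    obtain x y where xy: "w = (x, y)" by (cases w)
    have *: "x \<in> V" "y \<in> V" "x \<noteq> y" "e' x y \<noteq> ((x \<in> A) = (y \<in> A))"
      using w by (auto simp: xy mismatch_def)
    show "w \<in> (SIGMA x:Y. F x) \<union> (Z \<times> V \<union> V \<times> Z)"
    proof (cases "x \<in> Z \<or> y \<in> Z")
      case True then show ?thesis using * by (auto simp: xy)
    next
      case False
      then have "x \<in> Y" "y \<in> Y" using * by (auto simp: Y_def U_def Z_def)
      moreover have "odd_triple e p x y \<noteq> s"
        using * by (auto simp: A_def e'_def odd_triple_def split: if_splits)
      ultimately show ?thesis using * by (simp add: xy F_def)
    qed
  qed
  have "card (mismatch e' V A) \<le> card (SIGMA x:Y. F x) + (card (Z \<times> V) + card (V \<times> Z))"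
  proof -
    have "card (mismatch e' V A) \<le> card ((SIGMA x:Y. F x) \<union> (Z \<times> V \<union> V \<times> Z))"
      by (rule card_mono[OF _ sub]) (use fin finF Zfin V in auto)
    also have "\<dots> \<le> card (SIGMA x:Y. F x) + card (Z \<times> V \<union> V \<times> Z)" by (rule card_Un_le)
    also have "card (Z \<times> V \<union> V \<times> Z) \<le> card (Z \<times> V) + card (V \<times> Z)" by (rule card_Un_le)
    finally show ?thesis by simp
  qed
  also have "card (SIGMA x:Y. F x) = f" using fin finF by (simp add: card_SigmaI f_def)
  also have "card (Z \<times> V) + card (V \<times> Z) = 2 * (n * card Z)" by (simp add: card_cartesian_product n(1))
  also have "\<dots> \<le> 2 * (n * (m + 4))" using \<open>card Z \<le> m + 4\<close> by simp
  finally have le: "card (mismatch e' V A) \<le> f + 2 * (n * (m + 4))" by simp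
  have "m \<le> n"
    unfolding m_def n(1) by (rule card_mono[OF V]) (auto simp: X_def U_def)
  show ?thesis
    by (rule that[of A e' m f]) (fact m Lf le \<open>m \<le> n\<close> | simp add: A_def e'_def)+
qed

lemma small_mismatch:
  fixes K :: nat and \<epsilon> :: real
  assumes "\<epsilon> > 0"
  obtains n0 where "\<And>V e n. \<lbrakk>finite V; n = card V; n \<ge> n0; sym_rel (e :: 'a \<Rightarrow> 'a \<Rightarrow> bool);
      card {xs \<in> dlists_of V 6. odd_l e xs \<in> {5..15}} \<le> K * n ^ 5\<rbrakk> \<Longrightarrow>
      \<exists>A \<subseteq> V. real (card (mismatch e V A)) \<le> \<epsilon> * real n ^ 2 \<or>
        real (card (mismatch (\<lambda>x y. \<not> e x y) V A)) \<le> \<epsilon> * real n ^ 2"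
proof -
  define C where "C = real (60 * K + 1)"
  \<comment> \<open>The term \<open>64 / \<epsilon>\<close> pays for rounding L and for the four
    core vertices, \<open>256 * C / \<epsilon>\<^sup>2\<close> for the inconsistent vertices and the
    wrong pairs.\<close>
  define b where "b = Max {real (2 * (K + 15)), 256 * C / \<epsilon>\<^sup>2, 64 / \<epsilon>, 1}"
  have b: "b \<ge> real (2 * (K + 15))" "b \<ge> 256 * C / \<epsilon>\<^sup>2" "b \<ge> 64 / \<epsilon>" "b \<ge> 1"
    unfolding b_def by (intro Max_ge; simp)+
  show ?thesis
  proof (rule that[of "nat \<lceil>b\<rceil>"])
    fix V :: "'a set" and e n
    assume V: "finite V" and n: "n = card V" and big: "n \<ge> nat \<lceil>b\<rceil>" and e: "sym_rel e"
      and B: "card {xs \<in> dlists_of V 6. odd_l e xs \<in> {5..15}} \<le> K * n ^ 5"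
    have nb: "real n \<ge> b" using big by linarith
    have n1: "n \<ge> 1" "n \<ge> 2 * (K + 15)" using nb b(1,4) by linarith+
    obtain A m f e' where A: "A \<subseteq> V" and e': "e' = e \<or> e' = (\<lambda>x y. \<not> e x y)"
      and mn: "m \<le> n"
      and m: "m * (m - 1) \<le> 60 * K * n" and f: "\<And>L. L * f \<le> L\<^sup>2 * n + 60 * K * n\<^sup>2"
      and le: "card (mismatch e' V A) \<le> f + 2 * (n * (m + 4))"
      by (rule near_structure[OF V n n1(1) e B n1(2)], rule that, assumption+)
    define N where "N = real n"
    have N: "N \<ge> 1" "\<epsilon> * N \<ge> 64" "\<epsilon>\<^sup>2 * N \<ge> 256 * C"
      using nb b(2-4) assms by (auto simp: N_def field_simps intro: order_trans)
    have C: "C \<ge> 1" by (simp add: C_def)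
    have "m * m = m * (m - 1) + m" by (cases m) auto
    also have "\<dots> \<le> 60 * K * n + n" using m mn by linarith
    also have "\<dots> = (60 * K + 1) * n" by (simp add: algebra_simps)
    finally have "real (m * m) \<le> real ((60 * K + 1) * n)" by (simp only: of_nat_le_iff)
    then have "real m ^ 2 \<le> C * N"
      unfolding C_def N_def power2_eq_square of_nat_mult .
    also have "\<dots> \<le> (\<epsilon> * N / 16) ^ 2"
      using mult_right_mono[OF N(3), of N] N(1) by (simp add: power2_eq_square field_simps)
    finally have m': "real m \<le> \<epsilon> * N / 16"
      using N(2) power2_le_imp_le by fastforce
    \<comment> \<open>The bound on f is L n + 60 K n^2 / L. With L a small multiple of n, the first
      term is a small multiple of n^2 and the second is only linear in n.\<close>
    define L where "L = nat \<lfloor>\<epsilon> * N / 4\<rfloor>"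
    have L: "real L \<le> \<epsilon> * N / 4" "real L \<ge> \<epsilon> * N / 8" "real L > 0"
      unfolding L_def using N(2) by linarith+
    have "real (L * f) \<le> real (L\<^sup>2 * n + 60 * K * n\<^sup>2)"
      using f[of L] by (simp only: of_nat_le_iff)
    then have "L * f \<le> L * (L * N) + 60 * K * N\<^sup>2"
      by (simp add: N_def power2_eq_square algebra_simps)
    also have "\<dots> \<le> L * (L * N) + C * N\<^sup>2"
      by (simp add: C_def distrib_right)
    also have "C * N\<^sup>2 \<le> L * (\<epsilon> * N\<^sup>2 / 32)"
    proof -
      have "C * N\<^sup>2 \<le> (\<epsilon>\<^sup>2 * N / 256) * N\<^sup>2"
        using N(3) by (intro mult_right_mono) auto
      also have "\<dots> = (\<epsilon> * N / 8) * (\<epsilon> * N\<^sup>2 / 32)" by (simp add: power2_eq_square)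
      also have "\<dots> \<le> L * (\<epsilon> * N\<^sup>2 / 32)"
        using L(2) assms by (intro mult_right_mono) auto
      finally show ?thesis .
    qed
    finally have "L * f \<le> L * (L * N + \<epsilon> * N\<^sup>2 / 32)" by (simp add: distrib_left)
    then have "f \<le> L * N + \<epsilon> * N\<^sup>2 / 32" using L(3) by simp
    also have "L * N \<le> \<epsilon> * N\<^sup>2 / 4"
      using mult_right_mono[OF L(1), of N] N(1) by (simp add: power2_eq_square)
    finally have f': "f \<le> \<epsilon> * N\<^sup>2 / 4 + \<epsilon> * N\<^sup>2 / 32" by simp
    have "N * (real m + 4) \<le> N * (\<epsilon> * N / 8)"
      using m' N(1,2) by (intro mult_left_mono) auto
    then have "2 * (N * (real m + 4)) \<le> \<epsilon> * N\<^sup>2 / 4"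
      by (simp add: power2_eq_square algebra_simps)
    moreover have "real (card (mismatch e' V A)) \<le> f + 2 * (N * (real m + 4))"
      using le unfolding N_def by (simp flip: of_nat_le_iff[where 'a = real])
    moreover have "\<epsilon> * N\<^sup>2 / 4 + \<epsilon> * N\<^sup>2 / 32 + \<epsilon> * N\<^sup>2 / 4 \<le> \<epsilon> * N\<^sup>2"
      using assms by simp
    ultimately have "real (card (mismatch e' V A)) \<le> \<epsilon> * real n ^ 2"
      using f' unfolding N_def by linarith
    then show "\<exists>A \<subseteq> V. real (card (mismatch e V A)) \<le> \<epsilon> * real n ^ 2 \<or>
        real (card (mismatch (\<lambda>x y. \<not> e x y) V A)) \<le> \<epsilon> * real n ^ 2"
      using A e' by blast
  qed
qed

section \<open>Counting 4-sets with three edges\<close>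

lemma card_dlists_nsets:
  assumes U: "finite U"
  shows "card {xs \<in> dlists_of U k. Q (set xs)} = fact k * card {S \<in> [U]\<^bsup>k\<^esup>. Q S}"
proof -
  define P where "P S = {xs. length xs = k \<and> distinct xs \<and> set xs \<subseteq> S}" for S :: "'a set"
  define W where "W = {S \<in> [U]\<^bsup>k\<^esup>. Q S}"
  have W: "finite S" "card S = k" "S \<subseteq> U" "Q S" if "S \<in> W" for S
    using that by (auto simp: W_def nsets_def)
  have setP: "set xs = S" if "S \<in> W" "xs \<in> P S" for S xs
    using that W[OF that(1)] by (simp add: P_def card_subset_eq distinct_card)
  have cardP: "card (P S) = fact k" if "S \<in> W" for S
    unfolding P_def using card_lists_distinct_length_eq[of S k] W[OF that] by (simp add: fact_prod)
  have "{xs \<in> dlists_of U k. Q (set xs)} = (\<Union>S\<in>W. P S)"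
  proof (intro equalityI subsetI)
    fix xs assume "xs \<in> {xs \<in> dlists_of U k. Q (set xs)}"
    then have "set xs \<in> W" "xs \<in> P (set xs)"
      by (auto simp: W_def P_def nsets_def dlists_of_def lists_of_def distinct_card)
    then show "xs \<in> (\<Union>S\<in>W. P S)" by blast
  next
    fix xs assume "xs \<in> (\<Union>S\<in>W. P S)"
    then obtain S where S: "S \<in> W" "xs \<in> P S" by blast
    then show "xs \<in> {xs \<in> dlists_of U k. Q (set xs)}"
      using setP[OF S] W[OF S(1)] by (auto simp: P_def dlists_of_def lists_of_def)
  qed
  moreover have "card (\<Union>S\<in>W. P S) = (\<Sum>S\<in>W. card (P S))"
  proof (rule card_UN_disjoint)
    show "finite W" unfolding W_def using finite_imp_finite_nsets[OF U] by simp
    show "\<forall>S\<in>W. finite (P S)"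
      using cardP by (metis card.infinite fact_nonzero)
    show "\<forall>S\<in>W. \<forall>T\<in>W. S \<noteq> T \<longrightarrow> P S \<inter> P T = {}"
      using setP by blast
  qed
  ultimately show ?thesis
    using cardP by (simp add: W_def)
qed

lemma card_pairs_nsets:
  assumes U: "finite U"
  shows "card {(x, y). x \<in> U \<and> y \<in> U \<and> x \<noteq> y \<and> Q {x, y}} = 2 * card {S \<in> [U]\<^bsup>2\<^esup>. Q S}"
proof -
  have "bij_betw (\<lambda>(x, y). [x, y]) {(x, y). x \<in> U \<and> y \<in> U \<and> x \<noteq> y \<and> Q {x, y}}
      {xs \<in> dlists_of U 2. Q (set xs)}"
    unfolding bij_betw_def
    by (auto simp: inj_on_def dlists_of_def lists_of_def numeral_eq_Suc length_Suc_conv image_iff)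
  then show ?thesis
    using card_dlists_nsets[OF U, of 2 Q] by (simp add: bij_betw_same_card)
qed

lemma card_triples_nsets:
  assumes U: "finite U"
  shows "card {(x, y, z). x \<in> U \<and> y \<in> U \<and> z \<in> U \<and> x \<noteq> y \<and> x \<noteq> z \<and> y \<noteq> z \<and> Q {x, y, z}} =
    6 * card {S \<in> [U]\<^bsup>3\<^esup>. Q S}"
proof -
  have "bij_betw (\<lambda>(x, y, z). [x, y, z])
      {(x, y, z). x \<in> U \<and> y \<in> U \<and> z \<in> U \<and> x \<noteq> y \<and> x \<noteq> z \<and> y \<noteq> z \<and> Q {x, y, z}}
      {xs \<in> dlists_of U 3. Q (set xs)}"
    unfolding bij_betw_def
    by (auto simp: inj_on_def dlists_of_def lists_of_def numeral_eq_Suc length_Suc_conv image_iff)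
  then show ?thesis
    using card_dlists_nsets[OF U, of 3 Q] by (simp add: bij_betw_same_card fact_numeral)
qed

lemma card_nsets_containing:
  assumes R: "finite R" "R \<subseteq> V" and k: "k = card R + j"
  shows "card {S \<in> [V]\<^bsup>k\<^esup>. R \<subseteq> S \<and> Q S} = card {P \<in> [V - R]\<^bsup>j\<^esup>. Q (R \<union> P)}"
proof (rule bij_betw_same_card[symmetric], rule bij_betw_imageI)
  show "inj_on ((\<union>) R) {P \<in> [V - R]\<^bsup>j\<^esup>. Q (R \<union> P)}"
    by (rule inj_onI) (auto simp: nsets_def)
  show "(\<union>) R ` {P \<in> [V - R]\<^bsup>j\<^esup>. Q (R \<union> P)} = {S \<in> [V]\<^bsup>k\<^esup>. R \<subseteq> S \<and> Q S}"
  proof (intro equalityI subsetI)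
    fix S assume "S \<in> (\<union>) R ` {P \<in> [V - R]\<^bsup>j\<^esup>. Q (R \<union> P)}"
    then obtain P where P: "P \<subseteq> V - R" "finite P" "card P = j" "Q (R \<union> P)" "S = R \<union> P"
      by (auto simp: nsets_def)
    moreover have "card (R \<union> P) = card R + card P" using P R by (intro card_Un_disjoint) auto
    ultimately show "S \<in> {S \<in> [V]\<^bsup>k\<^esup>. R \<subseteq> S \<and> Q S}" using R k by (auto simp: nsets_def)
  next
    fix S assume S: "S \<in> {S \<in> [V]\<^bsup>k\<^esup>. R \<subseteq> S \<and> Q S}"
    then have "S = R \<union> (S - R)" "S - R \<in> [V - R]\<^bsup>j\<^esup>"
      using R k by (auto simp: nsets_def card_Diff_subset)
    then show "S \<in> (\<union>) R ` {P \<in> [V - R]\<^bsup>j\<^esup>. Q (R \<union> P)}"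
      using S by (metis (mono_tags, lifting) image_eqI mem_Collect_eq)
  qed
qed

lemma card_split: "finite {S \<in> N. C S} \<Longrightarrow>
    card {S \<in> N. C S} = card {S \<in> N. P S \<and> C S} + card {S \<in> N. \<not> P S \<and> C S}"
  by (subst card_Un_disjoint[symmetric]) (auto intro: arg_cong[of _ _ card] elim: rev_finite_subset)

section \<open>Changing one edge, one vertex, all edges, or the names of the vertices\<close>

definition ext_pairs :: "'a set \<Rightarrow> 'a set set \<Rightarrow> 'a \<Rightarrow> 'a \<Rightarrow> nat \<Rightarrow> ('a \<times> 'a) set" where
  "ext_pairs V E u v k = {(x, y). x \<in> V - {u, v} \<and> y \<in> V - {u, v} \<and> x \<noteq> y \<and> card (E \<inter> [{u, v, x, y}]\<^bsup>2\<^esup>) = k}"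

lemma card_ext_pairs:
  assumes V: "finite V" and uv: "u \<in> V" "v \<in> V" "u \<noteq> v"
  shows "card (ext_pairs V E u v k) = 2 * card {S \<in> [V]\<^bsup>4\<^esup>. {u, v} \<subseteq> S \<and> card (E \<inter> [S]\<^bsup>2\<^esup>) = k}"
  unfolding ext_pairs_def
  using card_pairs_nsets[of "V - {u, v}" "\<lambda>P. card (E \<inter> [{u, v} \<union> P]\<^bsup>2\<^esup>) = k"]
    card_nsets_containing[of "{u, v}" V 4 2 "\<lambda>S. card (E \<inter> [S]\<^bsup>2\<^esup>) = k"] V uv
  by (simp del: Un_insert_right)

text \<open>Only 4-sets through u and v are affected: those with two edges are gained, those with
  three are lost. The factor 2 comes from ordering the other two vertices.\<close>

lemma Lambda_insert_edge:
  assumes V: "finite V" and uv: "u \<in> V" "v \<in> V" "u \<noteq> v" and new: "{u, v} \<notin> E"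
  shows "2 * Lambda 4 3 V (insert {u, v} E) + card (ext_pairs V E u v 3) =
    2 * Lambda 4 3 V E + card (ext_pairs V E u v 2)"
proof -
  let ?N = "[V]\<^bsup>4\<^esup>" and ?c = "\<lambda>E S. card (E \<inter> [S]\<^bsup>2\<^esup>)"
  have fin: "finite {S \<in> ?N. C S}" for C using finite_imp_finite_nsets[OF V] by simp
  have out: "?c (insert {u, v} E) S = ?c E S" if "\<not> {u, v} \<subseteq> S" for S
    using that by (intro arg_cong[of _ _ card]) auto
  have inn: "?c (insert {u, v} E) S = Suc (?c E S)" if "S \<in> ?N" "{u, v} \<subseteq> S" for S
  proof -
    have "insert {u, v} E \<inter> [S]\<^bsup>2\<^esup> = insert {u, v} (E \<inter> [S]\<^bsup>2\<^esup>)" using that uv by auto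
    moreover have "finite ([S]\<^bsup>2\<^esup>)" using that finite_imp_finite_nsets[of S] by (simp add: nsets_def)
    ultimately show ?thesis using new by simp
  qed
  have "Lambda 4 3 V (insert {u, v} E) = card {S \<in> ?N. {u, v} \<subseteq> S \<and> ?c (insert {u, v} E) S = 3}
      + card {S \<in> ?N. \<not> {u, v} \<subseteq> S \<and> ?c (insert {u, v} E) S = 3}"
    unfolding Lambda_def by (rule card_split[OF fin])
  moreover have "{S \<in> ?N. {u, v} \<subseteq> S \<and> ?c (insert {u, v} E) S = 3} = {S \<in> ?N. {u, v} \<subseteq> S \<and> ?c E S = 2}"
    using inn by (auto simp: numeral_eq_Suc)
  moreover have "{S \<in> ?N. \<not> {u, v} \<subseteq> S \<and> ?c (insert {u, v} E) S = 3} = {S \<in> ?N. \<not> {u, v} \<subseteq> S \<and> ?c E S = 3}"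
    using out by metis
  moreover have "Lambda 4 3 V E = card {S \<in> ?N. {u, v} \<subseteq> S \<and> ?c E S = 3} + card {S \<in> ?N. \<not> {u, v} \<subseteq> S \<and> ?c E S = 3}"
    unfolding Lambda_def by (rule card_split[OF fin])
  ultimately show ?thesis unfolding card_ext_pairs[OF V uv] by simp
qed

definition ext_triples :: "'a set \<Rightarrow> 'a set set \<Rightarrow> 'a \<Rightarrow> ('a \<times> 'a \<times> 'a) set" where
  "ext_triples V E v = {(x, y, z). x \<in> V - {v} \<and> y \<in> V - {v} \<and> z \<in> V - {v} \<and> x \<noteq> y \<and> x \<noteq> z \<and> y \<noteq> z \<and>
     card (E \<inter> [{v, x, y, z}]\<^bsup>2\<^esup>) = 3}"

lemma Lambda_change_vertex:
  assumes V: "finite V" and v: "v \<in> V"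
    and eq: "\<And>x y. x \<noteq> v \<Longrightarrow> y \<noteq> v \<Longrightarrow> {x, y} \<in> E \<longleftrightarrow> {x, y} \<in> E'"
  shows "6 * Lambda 4 3 V E' + card (ext_triples V E v) = 6 * Lambda 4 3 V E + card (ext_triples V E' v)"
proof -
  let ?N = "[V]\<^bsup>4\<^esup>" and ?c = "\<lambda>E S. card (E \<inter> [S]\<^bsup>2\<^esup>)"
  have fin: "finite {S \<in> ?N. C S}" for C using finite_imp_finite_nsets[OF V] by simp
  have ext: "card (ext_triples V D v) = 6 * card {S \<in> ?N. {v} \<subseteq> S \<and> ?c D S = 3}" for D
    unfolding ext_triples_def
    using card_triples_nsets[of "V - {v}" "\<lambda>P. ?c D ({v} \<union> P) = 3"]
      card_nsets_containing[of "{v}" V 4 3 "\<lambda>S. ?c D S = 3"] V v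
    by (simp del: Un_insert_right)
  have "E \<inter> [S]\<^bsup>2\<^esup> = E' \<inter> [S]\<^bsup>2\<^esup>" if S: "\<not> {v} \<subseteq> S" for S
  proof -
    have "t \<in> E \<longleftrightarrow> t \<in> E'" if "t \<in> [S]\<^bsup>2\<^esup>" for t
    proof -
      obtain x y where "t = {x, y}" "x \<in> S" "y \<in> S" using \<open>t \<in> [S]\<^bsup>2\<^esup>\<close> by (rule nsets2_E)
      then show ?thesis using eq[of x y] S by auto
    qed
    then show ?thesis by blast
  qed
  then have "{S \<in> ?N. \<not> {v} \<subseteq> S \<and> ?c E S = 3} = {S \<in> ?N. \<not> {v} \<subseteq> S \<and> ?c E' S = 3}"
    by metis
  moreover have "Lambda 4 3 V D = card {S \<in> ?N. {v} \<subseteq> S \<and> ?c D S = 3} + card {S \<in> ?N. \<not> {v} \<subseteq> S \<and> ?c D S = 3}" for D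
    unfolding Lambda_def by (rule card_split[OF fin])
  ultimately show ?thesis unfolding ext by simp
qed

lemma Lambda_compl:
  assumes V: "finite V"
  shows "Lambda 4 3 V ([V]\<^bsup>2\<^esup> - E) = Lambda 4 3 V E"
proof -
  have "card (([V]\<^bsup>2\<^esup> - E) \<inter> [S]\<^bsup>2\<^esup>) = 6 - card (E \<inter> [S]\<^bsup>2\<^esup>) \<and> card (E \<inter> [S]\<^bsup>2\<^esup>) \<le> 6" if S: "S \<in> [V]\<^bsup>4\<^esup>" for S
  proof -
    have S': "S \<subseteq> V" "finite S" "card S = 4" using S by (auto simp: nsets_def)
    have fin: "finite ([S]\<^bsup>2\<^esup>)" using finite_imp_finite_nsets S' by blast
    have "[S]\<^bsup>2\<^esup> \<subseteq> [V]\<^bsup>2\<^esup>" by (rule nsets_mono) (rule S')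
    then have "([V]\<^bsup>2\<^esup> - E) \<inter> [S]\<^bsup>2\<^esup> = [S]\<^bsup>2\<^esup> - E \<inter> [S]\<^bsup>2\<^esup>" by blast
    moreover have "card ([S]\<^bsup>2\<^esup>) = 6" using S' by (simp add: choose_two)
    ultimately show ?thesis
      using fin card_mono[OF fin, of "E \<inter> [S]\<^bsup>2\<^esup>"] by (simp add: card_Diff_subset)
  qed
  then have "card (([V]\<^bsup>2\<^esup> - E) \<inter> [S]\<^bsup>2\<^esup>) = 3 \<longleftrightarrow> card (E \<inter> [S]\<^bsup>2\<^esup>) = 3" if "S \<in> [V]\<^bsup>4\<^esup>" for S
    using that by fastforce
  then show ?thesis unfolding Lambda_def by (metis (mono_tags, lifting) Collect_cong)
qed

lemma Lambda_image:
  assumes "inj_on h V" and E: "E \<subseteq> [V]\<^bsup>2\<^esup>"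
  shows "Lambda k l (h ` V) ((`) h ` E) = Lambda k l V E"
proof -
  have bij: "bij_betw (\<lambda>S. h ` S) ([V]\<^bsup>j\<^esup>) ([h ` V]\<^bsup>j\<^esup>)" for j
    by (rule bij_betw_nsets) (simp add: assms bij_betw_def)
  have inj2: "inj_on (\<lambda>S. h ` S) ([V]\<^bsup>j\<^esup>)" for j using bij by (simp add: bij_betw_def)
  have c: "card ((`) h ` E \<inter> [h ` S]\<^bsup>2\<^esup>) = card (E \<inter> [S]\<^bsup>2\<^esup>)" if S: "S \<in> [V]\<^bsup>k\<^esup>" for S
  proof -
    have SV: "S \<subseteq> V" using S by (simp add: nsets_def)
    have "bij_betw (\<lambda>S. h ` S) ([S]\<^bsup>2\<^esup>) ([h ` S]\<^bsup>2\<^esup>)"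
      by (rule bij_betw_nsets) (simp add: bij_betw_def inj_on_subset[OF assms(1) SV])
    then have img: "[h ` S]\<^bsup>2\<^esup> = (`) h ` [S]\<^bsup>2\<^esup>" by (simp add: bij_betw_def)
    have "(`) h ` E \<inter> (`) h ` [S]\<^bsup>2\<^esup> = (`) h ` (E \<inter> [S]\<^bsup>2\<^esup>)"
      using inj_on_image_Int[OF inj2[of 2] E nsets_mono[OF SV]] by simp
    moreover have "inj_on ((`) h) (E \<inter> [S]\<^bsup>2\<^esup>)" using inj_on_subset[OF inj2[of 2]] E by blast
    ultimately show ?thesis by (simp add: img card_image)
  qed
  have "{T \<in> [h ` V]\<^bsup>k\<^esup>. card ((`) h ` E \<inter> [T]\<^bsup>2\<^esup>) = l} = (`) h ` {S \<in> [V]\<^bsup>k\<^esup>. card (E \<inter> [S]\<^bsup>2\<^esup>) = l}"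
  proof -
    have "[h ` V]\<^bsup>k\<^esup> = (`) h ` [V]\<^bsup>k\<^esup>" using bij[of k] by (simp add: bij_betw_def)
    then show ?thesis using c by auto
  qed
  moreover have "inj_on ((`) h) {S \<in> [V]\<^bsup>k\<^esup>. card (E \<inter> [S]\<^bsup>2\<^esup>) = l}"
    by (rule inj_on_subset[OF inj2[of k]]) blast
  ultimately show ?thesis unfolding Lambda_def by (simp add: card_image)
qed

text \<open>\<open>Lambda_max\<close> ranges over graphs on natural numbers, so the graph is first
  carried there by a bijection.\<close>

lemma Lambda_le_max:
  assumes V: "finite V" and E: "E \<subseteq> [V]\<^bsup>2\<^esup>"
  shows "Lambda k l V E \<le> Lambda_max k l (card V)"
proof -
  obtain h :: "'a \<Rightarrow> nat" where h: "bij_betw h V {0..<card V}"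
    using ex_bij_betw_finite_nat[OF V] by blast
  then have inj: "inj_on h V" and img: "h ` V = {0..<card V}" by (auto simp: bij_betw_def)
  have "(`) h ` E \<subseteq> [h ` V]\<^bsup>2\<^esup>"
    using E bij_betw_nsets[OF bij_betw_imageI[OF inj refl], of 2] by (auto simp: bij_betw_def)
  then have "simple_graph (h ` V) ((`) h ` E)" using V by (simp add: simple_graph_def)
  moreover have "card (h ` V) = card V" using inj by (rule card_image)
  ultimately have "Lambda k l V E \<in> {Lambda k l V' E' | (V' :: nat set) E'. simple_graph V' E' \<and> card V' = card V}"
    using Lambda_image[OF inj E, of k l] by (metis (mono_tags, lifting) mem_Collect_eq)
  then show ?thesis unfolding Lambda_max_def by (rule Max_ge[OF finite_Lambda_values])
qed

section \<open>4-sets in a union of two cliques\<close>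

lemma card_nsets_split:
  assumes A: "finite A" and B: "finite B" and dis: "A \<inter> B = {}" and k: "k = i + j"
  shows "card {S \<in> [A \<union> B]\<^bsup>k\<^esup>. card (S \<inter> A) = i} = (card A choose i) * (card B choose j)"
proof -
  have "bij_betw (\<lambda>(P, R). P \<union> R) ([A]\<^bsup>i\<^esup> \<times> [B]\<^bsup>j\<^esup>) {S \<in> [A \<union> B]\<^bsup>k\<^esup>. card (S \<inter> A) = i}"
  proof (rule bij_betw_byWitness[where f' = "\<lambda>S. (S \<inter> A, S \<inter> B)"])
    show "\<forall>a\<in>[A]\<^bsup>i\<^esup> \<times> [B]\<^bsup>j\<^esup>. ((case a of (P, R) \<Rightarrow> P \<union> R) \<inter> A, (case a of (P, R) \<Rightarrow> P \<union> R) \<inter> B) = a"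
      using dis by (auto simp: nsets_def)
    show "\<forall>S\<in>{S \<in> [A \<union> B]\<^bsup>k\<^esup>. card (S \<inter> A) = i}. (case (S \<inter> A, S \<inter> B) of (P, R) \<Rightarrow> P \<union> R) = S"
      by (auto simp: nsets_def)
    show "(\<lambda>(P, R). P \<union> R) ` ([A]\<^bsup>i\<^esup> \<times> [B]\<^bsup>j\<^esup>) \<subseteq> {S \<in> [A \<union> B]\<^bsup>k\<^esup>. card (S \<inter> A) = i}"
    proof clarify
      fix P R assume "P \<in> [A]\<^bsup>i\<^esup>" "R \<in> [B]\<^bsup>j\<^esup>"
      then have *: "P \<subseteq> A" "R \<subseteq> B" "finite P" "finite R" "card P = i" "card R = j" by (auto simp: nsets_def)
      have "(P \<union> R) \<inter> A = P" "P \<inter> R = {}" using * dis by auto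
      then show "P \<union> R \<in> [A \<union> B]\<^bsup>k\<^esup> \<and> card ((P \<union> R) \<inter> A) = i"
        using * k by (auto simp: nsets_def card_Un_disjoint)
    qed
    show "(\<lambda>S. (S \<inter> A, S \<inter> B)) ` {S \<in> [A \<union> B]\<^bsup>k\<^esup>. card (S \<inter> A) = i} \<subseteq> [A]\<^bsup>i\<^esup> \<times> [B]\<^bsup>j\<^esup>"
    proof clarify
      fix S assume S: "S \<in> [A \<union> B]\<^bsup>k\<^esup>" "i = card (S \<inter> A)"
      have "S = (S \<inter> A) \<union> (S \<inter> B)" using S by (auto simp: nsets_def)
      then have "card S = card (S \<inter> A) + card (S \<inter> B)"
        using A B dis by (metis card_Un_disjoint finite_Int inf_assoc inf_bot_right inf_left_commute)
      then show "S \<inter> A \<in> [A]\<^bsup>card (S \<inter> A)\<^esup> \<and> S \<inter> B \<in> [B]\<^bsup>j\<^esup>"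
        using S k A B by (auto simp: nsets_def)
    qed
  qed
  then show ?thesis
    by (simp add: bij_betw_same_card[symmetric] card_cartesian_product)
qed

lemma card_cliques_edges:
  assumes A: "finite A" and B: "finite B" and dis: "A \<inter> B = {}" and S: "S \<subseteq> A \<union> B"
  shows "card (([A]\<^bsup>2\<^esup> \<union> [B]\<^bsup>2\<^esup>) \<inter> [S]\<^bsup>2\<^esup>) = (card (S \<inter> A) choose 2) + (card (S \<inter> B) choose 2)"
proof -
  have "([A]\<^bsup>2\<^esup> \<union> [B]\<^bsup>2\<^esup>) \<inter> [S]\<^bsup>2\<^esup> = [S \<inter> A]\<^bsup>2\<^esup> \<union> [S \<inter> B]\<^bsup>2\<^esup>"
    by (auto simp: nsets_def)
  moreover have "[S \<inter> A]\<^bsup>2\<^esup> \<inter> [S \<inter> B]\<^bsup>2\<^esup> = {}"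
    using dis by (auto simp: nsets_def) (metis card.empty inf.orderE inf_bot_right inf_left_commute le_inf_iff subset_empty zero_neq_numeral)
  ultimately show ?thesis
    using A B by (simp add: card_Un_disjoint finite_imp_finite_nsets)
qed

text \<open>A 4-set split as 4 + 0, 3 + 1 or 2 + 2 spans 6, 3 or 2 edges, so exactly the splits 3 +
  1 count.\<close>

lemma Lambda_cliques:
  assumes A: "finite A" and B: "finite B" and dis: "A \<inter> B = {}"
  shows "Lambda 4 3 (A \<union> B) ([A]\<^bsup>2\<^esup> \<union> [B]\<^bsup>2\<^esup>) = (card A choose 3) * card B + card A * (card B choose 3)"
proof -
  let ?N = "[A \<union> B]\<^bsup>4\<^esup>"
  have fin: "finite {S \<in> ?N. C S}" for C
    using finite_imp_finite_nsets[of "A \<union> B"] A B by simp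
  have *: "card (([A]\<^bsup>2\<^esup> \<union> [B]\<^bsup>2\<^esup>) \<inter> [S]\<^bsup>2\<^esup>) = 3 \<longleftrightarrow> card (S \<inter> A) = 3 \<or> card (S \<inter> A) = 1" if S: "S \<in> ?N" for S
  proof -
    have SS: "S \<subseteq> A \<union> B" "finite S" "card S = 4" using S by (auto simp: nsets_def)
    have "S = (S \<inter> A) \<union> (S \<inter> B)" using SS by auto
    then have "card (S \<inter> A) + card (S \<inter> B) = 4"
      using A B dis SS by (metis card_Un_disjoint finite_Int inf_assoc inf_bot_right inf_left_commute)
    then obtain i where "card (S \<inter> A) = i" "card (S \<inter> B) = 4 - i" "i \<le> 4" by (metis diff_add_inverse le_add1)
    moreover from this have "i = 0 \<or> i = 1 \<or> i = 2 \<or> i = 3 \<or> i = 4" by linarith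
    ultimately show ?thesis
      unfolding card_cliques_edges[OF A B dis SS(1)] by (auto simp: choose_two)
  qed
  have "Lambda 4 3 (A \<union> B) ([A]\<^bsup>2\<^esup> \<union> [B]\<^bsup>2\<^esup>) = card {S \<in> ?N. card (S \<inter> A) = 3 \<or> card (S \<inter> A) = 1}"
    unfolding Lambda_def using * by (metis (mono_tags, lifting) Collect_cong)
  also have "{S \<in> ?N. card (S \<inter> A) = 3 \<or> card (S \<inter> A) = 1} =
     {S \<in> ?N. card (S \<inter> A) = 3} \<union> {S \<in> ?N. card (S \<inter> A) = 1}" by blast
  also have "card \<dots> = card {S \<in> ?N. card (S \<inter> A) = 3} + card {S \<in> ?N. card (S \<inter> A) = 1}"
    by (rule card_Un_disjoint[OF fin fin]) auto
  also have "card {S \<in> ?N. card (S \<inter> A) = 3} = (card A choose 3) * card B"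
    using card_nsets_split[OF A B dis, of 4 3 1] by simp
  also have "card {S \<in> ?N. card (S \<inter> A) = 1} = card A * (card B choose 3)"
    using card_nsets_split[OF A B dis, of 4 1 3] by simp
  finally show ?thesis .
qed

lemma six_choose_three: "6 * real (k choose 3) = real k * (real k - 1) * (real k - 2)"
proof (cases "k \<ge> 2")
  case True
  have "real (k choose 3) = (\<Prod>i<3. real k - real i) / fact 3"
    by (simp add: binomial_gbinomial gbinomial_prod_rev atLeast0LessThan)
  then show ?thesis by (simp add: numeral_eq_Suc fact_numeral field_simps)
next
  case False
  then have "k = 0 \<or> k = 1" by auto
  then show ?thesis by auto
qed

text \<open>For fixed n this is a parabola in the squared size difference with its maximum at 3 n -
  4, not at 0. This is where the optimal difference of about sqrt (3 n) comes from.\<close>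

lemma Lambda_cliques_real:
  assumes A: "finite A" and B: "finite B" and dis: "A \<inter> B = {}"
    and n: "n = real (card A) + real (card B)" and d: "d = real (card A) - real (card B)"
  shows "48 * real (Lambda 4 3 (A \<union> B) ([A]\<^bsup>2\<^esup> \<union> [B]\<^bsup>2\<^esup>)) = (n\<^sup>2 - 3 * n + 4)\<^sup>2 - (3 * n - 4 - d\<^sup>2)\<^sup>2"
proof -
  define a b where "a = real (card A)" and "b = real (card B)"
  have "6 * real (Lambda 4 3 (A \<union> B) ([A]\<^bsup>2\<^esup> \<union> [B]\<^bsup>2\<^esup>)) =
     6 * real (card A choose 3) * b + a * (6 * real (card B choose 3))"
    unfolding Lambda_cliques[OF A B dis] by (simp add: a_def b_def)
  also have "\<dots> = a * (a - 1) * (a - 2) * b + a * (b * (b - 1) * (b - 2))"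
    unfolding six_choose_three a_def b_def ..
  finally show ?thesis
    unfolding n d a_def[symmetric] b_def[symmetric] by (simp add: algebra_simps power2_eq_square)
qed

section \<open>The neighbourhood of a vertex\<close>

text \<open>The leading term of six times the number of 4-sets with three edges through a vertex that has
  a1 neighbours and a0 non-neighbours in one clique, and b1 and b0 in the other.\<close>

definition star_poly :: "real \<Rightarrow> real \<Rightarrow> real \<Rightarrow> real \<Rightarrow> real" where
  "star_poly a1 a0 b1 b0 = a0 ^ 3 + b0 ^ 3 + 3 * a1\<^sup>2 * b0 + 6 * a1 * a0 * b1 + 3 * b1\<^sup>2 * a0 + 6 * b1 * b0 * a1"

text \<open>Here p and q are the proportions of neighbours in the two cliques. The maximum 4 is
  attained at p = 1, q = 0, and the deficit depends only on s = p + q and on pq. For s <= 1 its form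
  in pq has nonnegative terms, for s > 1 its form in (1 - p)(1 - q) has. Hence s is close to 1 and
  the respective product close to 0.\<close>

lemma star_poly_near_max:
  assumes p: "0 \<le> p" "p \<le> 1" and q: "0 \<le> q" "q \<le> p"
    and max: "star_poly p (1 - p) q (1 - q) \<ge> 4 - 1 / 10000"
  shows "(1 - p) + q \<le> 1 / 100"
proof -
  define s where "s = p + q"
  define \<pi> where "\<pi> = p * q"
  have s: "0 \<le> s" "s \<le> 2" using p q by (auto simp: s_def)
  have \<pi>: "\<pi> \<ge> 0" using p q by (simp add: \<pi>_def)
  have eq: "4 - star_poly p (1 - p) q (1 - q) = (1 - s) * (2 + 5 * s - s\<^sup>2) + 6 * \<pi> * s"
    unfolding star_poly_def s_def \<pi>_def by (simp add: power2_eq_square power3_eq_cube algebra_simps)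
  show ?thesis
  proof (cases "s \<le> 1")
    case True
    have "s\<^sup>2 \<le> s" using mult_left_mono[OF True s(1)] by (simp add: power2_eq_square)
    then have "(1 - s) * 2 \<le> (1 - s) * (2 + 5 * s - s\<^sup>2)" using True s by (intro mult_left_mono) auto
    moreover have "0 \<le> 6 * \<pi> * s" using \<pi> s by simp
    ultimately have 1: "1 - s \<le> 1 / 20000" and 2: "6 * \<pi> * s \<le> 1 / 10000" using eq max True by auto
    have "p \<ge> 1 / 4" using 1 q by (simp add: s_def)
    then have "q * (1 / 4) \<le> \<pi>" unfolding \<pi>_def using mult_left_mono[of "1/4" p q] q by (simp add: mult.commute)
    moreover have "6 * \<pi> * (1 / 2) \<le> 6 * \<pi> * s" using 1 \<pi> by (intro mult_left_mono) auto
    ultimately have "q \<le> 4 / 30000" using 2 by linarith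
    then show ?thesis using 1 by (simp add: s_def)
  next
    case False
    define c where "c = (1 - p) * (1 - q)"
    have "(1 - s) * (2 + 5 * s - s\<^sup>2) + 6 * \<pi> * s = 6 * s * c + (s - 1)\<^sup>2 * (s + 2)"
      unfolding c_def \<pi>_def s_def by (simp add: power2_eq_square algebra_simps)
    then have le: "6 * s * c + (s - 1)\<^sup>2 * (s + 2) \<le> 1 / 10000" using eq max by linarith
    have c: "c \<ge> 0" using p q by (simp add: c_def)
    have "(s - 1)\<^sup>2 * 3 \<le> (s - 1)\<^sup>2 * (s + 2)" using False by (intro mult_left_mono) auto
    moreover have sc: "6 * 1 * c \<le> 6 * s * c" using False c by (intro mult_right_mono) auto
    ultimately have "(s - 1)\<^sup>2 \<le> (1 / 170)\<^sup>2" using le c by (simp add: power2_eq_square)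
    then have s1: "s - 1 \<le> 1 / 170" by (rule power2_le_imp_le) simp
    have "(s - 1)\<^sup>2 * (s + 2) \<ge> 0" using s by simp
    then have "c \<le> 1 / 60000" using le sc by linarith
    moreover have "(1 - p) * (1 / 4) \<le> c"
      unfolding c_def using s1 q p by (intro mult_left_mono) (auto simp: s_def)
    ultimately have "(1 - p) * (1 / 4) \<le> 1 / 60000" by (rule order_trans[rotated])
    then have "1 - p \<le> 4 / 60000" by simp
    then show ?thesis using s1 by (simp add: s_def)
  qed
qed

lemma star_poly_commute: "star_poly a1 a0 b1 b0 = star_poly b1 b0 a1 a0"
  unfolding star_poly_def by (simp add: algebra_simps)

lemma star_poly_scale_le:
  assumes "0 \<le> a" "a \<le> M" "0 \<le> b" "b \<le> M" "0 \<le> p" "p \<le> 1" "0 \<le> q" "q \<le> 1"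
  shows "star_poly (a * p) (a * (1 - p)) (b * q) (b * (1 - q)) \<le> M ^ 3 * star_poly p (1 - p) q (1 - q)"
proof -
  have m: "x * y * z \<le> M ^ 3" if "0 \<le> x" "x \<le> M" "0 \<le> y" "y \<le> M" "0 \<le> z" "z \<le> M" for x y z
    unfolding power3_eq_cube using that by (intro mult_mono) auto
  have t: "x * y * z * c \<le> M ^ 3 * c" if "0 \<le> x" "x \<le> M" "0 \<le> y" "y \<le> M" "0 \<le> z" "z \<le> M" "0 \<le> c" for x y z c
    using m[OF that(1-6)] that(7) by (rule mult_right_mono)
  have "star_poly (a * p) (a * (1 - p)) (b * q) (b * (1 - q)) =
    a * a * a * (1 - p) ^ 3 + b * b * b * (1 - q) ^ 3 + a * a * b * (3 * p\<^sup>2 * (1 - q)) +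
    a * a * b * (6 * p * (1 - p) * q) + b * b * a * (3 * q\<^sup>2 * (1 - p)) + b * b * a * (6 * q * (1 - q) * p)"
    unfolding star_poly_def by (simp add: power2_eq_square power3_eq_cube mult_ac)
  also have "\<dots> \<le> M ^ 3 * (1 - p) ^ 3 + M ^ 3 * (1 - q) ^ 3 + M ^ 3 * (3 * p\<^sup>2 * (1 - q)) +
    M ^ 3 * (6 * p * (1 - p) * q) + M ^ 3 * (3 * q\<^sup>2 * (1 - p)) + M ^ 3 * (6 * q * (1 - q) * p)"
    using assms by (intro add_mono t) auto
  also have "\<dots> = M ^ 3 * star_poly p (1 - p) q (1 - q)"
    unfolding star_poly_def by (simp add: distrib_left mult_ac)
  finally show ?thesis .
qed

text \<open>The hypothesis \<open>star\<close> says that the vertex does nearly as well as one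
  joined to exactly one clique. Scaling both cliques to size one, with relative errors of 10^-6,
  brings it into the form needed by \<open>star_poly_near_max\<close>. The two outcomes correspond
  to the two cliques.\<close>

lemma vertex_dichotomy:
  fixes a b a1 b1 n f :: real
  assumes a1: "0 \<le> a1" "a1 \<le> a" and b1: "0 \<le> b1" "b1 \<le> b" and n: "a + b = n" "n \<ge> 10 ^ 7"
    and bal: "\<bar>a - b\<bar> \<le> n / 10 ^ 6" and f: "f \<le> n\<^sup>2 / 10 ^ 6"
    and star: "b ^ 3 + 3 * a\<^sup>2 * b \<le> star_poly a1 (a - a1) b1 (b - b1) + 6 * f * n + 6 * n\<^sup>2"
  shows "(a - a1) + b1 \<le> n / 100 \<or> a1 + (b - b1) \<le> n / 100"
proof -
  define h where "h = n / 2"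
  define \<delta> :: real where "\<delta> = 1 / 10 ^ 6"
  define M m where "M = h * (1 + \<delta>)" and "m = h * (1 - \<delta>)"
  have h: "h > 0" using n by (simp add: h_def)
  have ab: "m \<le> a" "m \<le> b" "a \<le> M" "b \<le> M"
  proof -
    have "a - b \<le> n / 10 ^ 6" "b - a \<le> n / 10 ^ 6" using bal by linarith+
    then show "m \<le> a" "m \<le> b" "a \<le> M" "b \<le> M"
      using n(1) unfolding M_def m_def h_def \<delta>_def by (simp_all add: field_simps)
  qed
  have m0: "m > 0" using h by (simp add: m_def \<delta>_def)
  define p q where "p = a1 / a" and "q = b1 / b"
  have p: "0 \<le> p" "p \<le> 1" "a1 = a * p" "a - a1 = a * (1 - p)" and q: "0 \<le> q" "q \<le> 1" "b1 = b * q" "b - b1 = b * (1 - q)"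
    using a1 b1 ab m0 by (auto simp: p_def q_def field_simps)
  have "4 * m ^ 3 \<le> b ^ 3 + 3 * (a\<^sup>2 * b)"
  proof -
    have "m ^ 3 \<le> b ^ 3" using ab m0 by (intro power_mono) auto
    moreover have "m\<^sup>2 * m \<le> a\<^sup>2 * b" using ab m0 by (intro mult_mono power_mono) auto
    ultimately show ?thesis by (simp add: power2_eq_square power3_eq_cube)
  qed
  also have "\<dots> = b ^ 3 + 3 * a\<^sup>2 * b" by simp
  also have "\<dots> \<le> star_poly a1 (a - a1) b1 (b - b1) + 6 * f * n + 6 * n\<^sup>2" by (rule star)
  also have "\<dots> = star_poly a1 (a - a1) b1 (b - b1) + (6 * f * n + 6 * n\<^sup>2)" by simp
  also have "star_poly a1 (a - a1) b1 (b - b1) \<le> M ^ 3 * star_poly p (1 - p) q (1 - q)"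
    using star_poly_scale_le[of a M b p q] ab m0 p q by simp
  \<comment> \<open>In units of h^3 = n^3 / 8, the wrong pairs cost at most 48 millionths and the
    quadratic term 4.8 millionths, since n >= 10^7.\<close>
  also have "6 * f * n + 6 * n\<^sup>2 \<le> h ^ 3 * (54 / 10 ^ 6)"
  proof -
    have "6 * F + 6 * Q \<le> H * (54 / 10 ^ 6)" if "F \<le> X / 10 ^ 6" "Q * 10 ^ 7 \<le> X" "H = X / 8" "0 \<le> H" for F Q H X :: real
      using that by simp
    moreover have "f * n \<le> (n\<^sup>2 / 10 ^ 6) * n" using f n by (intro mult_right_mono) auto
    then have "f * n \<le> n\<^sup>2 * n / 10 ^ 6" by simp
    moreover have "n\<^sup>2 * 10 ^ 7 \<le> n\<^sup>2 * n" using n by (intro mult_left_mono) auto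
    moreover have "h ^ 3 = n\<^sup>2 * n / 8" by (simp add: h_def power2_eq_square power3_eq_cube)
    moreover have "0 \<le> h ^ 3" using h by simp
    ultimately have "6 * (f * n) + 6 * n\<^sup>2 \<le> h ^ 3 * (54 / 10 ^ 6)" by blast
    then show ?thesis by (simp add: mult.assoc)
  qed
  finally have "h ^ 3 * (4 * (1 - \<delta>) ^ 3) \<le> h ^ 3 * ((1 + \<delta>) ^ 3 * star_poly p (1 - p) q (1 - q) + 54 / 10 ^ 6)"
    unfolding M_def m_def power_mult_distrib by (simp add: algebra_simps)
  then have "4 * (1 - \<delta>) ^ 3 \<le> (1 + \<delta>) ^ 3 * star_poly p (1 - p) q (1 - q) + 54 / 10 ^ 6"
    using h by simp
  moreover have "(4 - 1 / 10000) * (1 + \<delta>) ^ 3 + 54 / 10 ^ 6 \<le> 4 * (1 - \<delta>) ^ 3"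
    unfolding \<delta>_def by (simp add: power3_eq_cube)
  ultimately have "(1 + \<delta>) ^ 3 * (4 - 1 / 10000) \<le> (1 + \<delta>) ^ 3 * star_poly p (1 - p) q (1 - q)"
    by (simp add: mult.commute)
  then have max: "star_poly p (1 - p) q (1 - q) \<ge> 4 - 1 / 10000"
    by (simp add: \<delta>_def)
  have bound: "a * x + b * y \<le> n / 100" if "x + y \<le> 1 / 100" "0 \<le> x" "0 \<le> y" for x y
  proof -
    have "a * x + b * y \<le> n * x + n * y" using that ab m0 n by (intro add_mono mult_right_mono) auto
    also have "\<dots> = n * (x + y)" by (simp add: distrib_left)
    also have "\<dots> \<le> n * (1 / 100)" using that n by (intro mult_left_mono) auto
    finally show ?thesis by simp
  qed
  show ?thesis
  proof (cases "q \<le> p")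
    case True
    then have "(1 - p) + q \<le> 1 / 100" using star_poly_near_max[of p q] p q max by auto
    then show ?thesis using bound[of "1 - p" q] p q by simp
  next
    case False
    then have "(1 - q) + p \<le> 1 / 100" using star_poly_near_max[of q p] p q max star_poly_commute[of p] by auto
    then show ?thesis using bound[of p "1 - q"] p q by (simp add: add.commute)
  qed
qed

section \<open>Counting 4-sets through a vertex up to wrong pairs\<close>

lemma card_triple_le:
  assumes W: "finite W" and V: "finite V" and n: "n = card V"
    and bad: "\<And>x y z. (x, y, z) \<in> T \<Longrightarrow> x \<in> V \<and> y \<in> V \<and> z \<in> V \<and> ((x, y) \<in> W \<or> (x, z) \<in> W \<or> (y, z) \<in> W)"
  shows "card T \<le> 3 * card W * n"
proof -
  let ?X = "(\<lambda>((x, y), z). (x, y, z)) ` (W \<times> V)" and ?Y = "(\<lambda>((x, z), y). (x, y, z)) ` (W \<times> V)"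
    and ?Z = "(\<lambda>((y, z), x). (x, y, z)) ` (W \<times> V)"
  have "T \<subseteq> ?X \<union> (?Y \<union> ?Z)"
  proof
    fix t assume "t \<in> T"
    moreover obtain x y z where t: "t = (x, y, z)" by (cases t)
    ultimately consider "(x, y) \<in> W" "z \<in> V" | "(x, z) \<in> W" "y \<in> V" | "(y, z) \<in> W" "x \<in> V" using bad by blast
    then show "t \<in> ?X \<union> (?Y \<union> ?Z)"
      by cases (force simp: t image_iff)+
  qed
  then have "card T \<le> card (?X \<union> (?Y \<union> ?Z))" by (rule card_mono[rotated]) (use W V in auto)
  also have "\<dots> \<le> card ?X + card (?Y \<union> ?Z)" by (rule card_Un_le)
  also have "card (?Y \<union> ?Z) \<le> card ?Y + card ?Z" by (rule card_Un_le)
  finally have "card T \<le> card ?X + (card ?Y + card ?Z)" by simp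
  moreover have "card (g ` (W \<times> V)) \<le> card W * n" for g :: "('a \<times> 'a) \<times> 'a \<Rightarrow> 'a \<times> 'a \<times> 'a"
    using card_image_le[of "W \<times> V" g] W V n by (simp add: card_cartesian_product)
  note this[of "\<lambda>((x, y), z). (x, y, z)"] this[of "\<lambda>((x, z), y). (x, y, z)"] this[of "\<lambda>((y, z), x). (x, y, z)"]
  ultimately show ?thesis by linarith
qed

lemma card_Union_list_le: "card (\<Union>(set Xs)) \<le> sum_list (map card Xs)"
proof (induction Xs)
  case (Cons X Xs)
  then show ?case using card_Un_le[of X "\<Union>(set Xs)"] by simp
qed simp

lemma adj_commute: "adj E x y = adj E y x"
  unfolding adj_def by (simp add: insert_commute)

text \<open>If x, y, z contain no wrong pair, the number of edges on v, x, y, z depends only on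
  their classes among A1, A0, B1, B0. The twenty boxes in \<open>Xs\<close> after T are the
  orderings of the six class combinations that give three edges; these are the monomials of
  \<open>star_poly\<close>.\<close>

lemma card_ext_triples_le:
  assumes V: "finite V" and n: "n = card V" and A: "A \<subseteq> V" and v: "v \<in> V"
    and A1: "A1 = {x \<in> A. adj E v x}" and B1: "B1 = {x \<in> V - A. adj E v x}"
  shows "real (card (ext_triples V E v)) \<le>
    star_poly (card A1) (real (card A) - card A1) (card B1) (real (card (V - A)) - card B1) +
    3 * card (mismatch (adj E) V A) * n"
proof -
  let ?M = "mismatch (adj E) V A"
  define A0 where "A0 = A - A1"
  define B0 where "B0 = V - A - B1"
  define T where "T = {(x, y, z) \<in> ext_triples V E v. (x, y) \<in> ?M \<or> (x, z) \<in> ?M \<or> (y, z) \<in> ?M}"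
  define Xs where "Xs = [T, A0 \<times> A0 \<times> A0, B0 \<times> B0 \<times> B0,
     A1 \<times> A1 \<times> B0, A1 \<times> B0 \<times> A1, B0 \<times> A1 \<times> A1,
     A1 \<times> A0 \<times> B1, A1 \<times> B1 \<times> A0, A0 \<times> A1 \<times> B1, B1 \<times> A1 \<times> A0, A0 \<times> B1 \<times> A1, B1 \<times> A0 \<times> A1,
     B1 \<times> B1 \<times> A0, B1 \<times> A0 \<times> B1, A0 \<times> B1 \<times> B1,
     B1 \<times> B0 \<times> A1, B1 \<times> A1 \<times> B0, B0 \<times> B1 \<times> A1, A1 \<times> B1 \<times> B0, B0 \<times> A1 \<times> B1, A1 \<times> B0 \<times> B1]"
  have finA: "finite A" using A V finite_subset by blast
  have fin: "finite A1" "finite A0" "finite B1" "finite B0"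
    using finA V by (auto simp: A1 A0_def B1 B0_def)
  have sub: "A1 \<subseteq> A" "B1 \<subseteq> V - A" by (auto simp: A1 B1)
  have finM: "finite ?M" by (rule finite_subset[of _ "V \<times> V"]) (auto simp: mismatch_def V)
  have T: "card T \<le> 3 * card ?M * n"
    by (rule card_triple_le[OF finM V n]) (auto simp: T_def ext_triples_def)
  have finT: "finite T"
    by (rule finite_subset[of _ "V \<times> V \<times> V"]) (auto simp: T_def ext_triples_def V)
  have "ext_triples V E v \<subseteq> \<Union>(set Xs)"
  proof
    fix t assume t: "t \<in> ext_triples V E v"
    obtain x y z where xyz: "t = (x, y, z)" by (cases t)
    have d: "distinct [v, x, y, z]" and inV: "x \<in> V" "y \<in> V" "z \<in> V"
      and three: "card (E \<inter> [{v, x, y, z}]\<^bsup>2\<^esup>) = 3"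
      using t by (auto simp: xyz ext_triples_def)
    show "t \<in> \<Union>(set Xs)"
    proof (cases "t \<in> T")
      case True then show ?thesis by (simp add: Xs_def)
    next
      case False
      then have e: "adj E x y = ((x \<in> A) = (y \<in> A))" "adj E x z = ((x \<in> A) = (z \<in> A))" "adj E y z = ((y \<in> A) = (z \<in> A))"
        using t d inV by (auto simp: T_def xyz mismatch_def)
      have cls: "w \<in> A0 \<longleftrightarrow> w \<in> A \<and> \<not> adj E v w" "w \<in> A1 \<longleftrightarrow> w \<in> A \<and> adj E v w"
        "w \<in> B0 \<longleftrightarrow> w \<notin> A \<and> \<not> adj E v w" "w \<in> B1 \<longleftrightarrow> w \<notin> A \<and> adj E v w" if "w \<in> V" for w
        using that by (auto simp: A0_def A1 B0_def B1)
      have "of_bool (adj E v x) + of_bool (adj E v y) + of_bool (adj E v z) +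
        of_bool ((x \<in> A) = (y \<in> A)) + of_bool ((x \<in> A) = (z \<in> A)) + of_bool ((y \<in> A) = (z \<in> A)) = (3 :: nat)"
        using three unfolding card_edges4[OF d] e .
      then show ?thesis
        unfolding Xs_def xyz
        by (cases "x \<in> A"; cases "y \<in> A"; cases "z \<in> A"; cases "adj E v x"; cases "adj E v y"; cases "adj E v z")
          (simp_all add: cls[OF inV(1)] cls[OF inV(2)] cls[OF inV(3)])
    qed
  qed
  then have "card (ext_triples V E v) \<le> card (\<Union>(set Xs))"
    by (rule card_mono[rotated]) (use fin finT in \<open>simp add: Xs_def\<close>)
  also have "\<dots> \<le> sum_list (map card Xs)" by (rule card_Union_list_le)
  finally have "real (card (ext_triples V E v)) \<le> real (sum_list (map card Xs))" by simp
  also have "\<dots> = real (card T) + star_poly (card A1) (card A0) (card B1) (card B0)"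
    unfolding Xs_def star_poly_def by (simp add: card_cartesian_product power2_eq_square power3_eq_cube algebra_simps)
  also have "real (card A0) = real (card A) - card A1"
    unfolding A0_def using sub finA card_mono[OF finA sub(1)] by (simp add: card_Diff_subset finite_subset of_nat_diff)
  also have "real (card B0) = real (card (V - A)) - card B1"
    unfolding B0_def using sub V card_mono[OF _ sub(2)] by (simp add: card_Diff_subset finite_subset of_nat_diff)
  finally show ?thesis using T by (simp flip: of_nat_le_iff[where 'a = real])
qed

text \<open>The competitor in which v is attached to exactly A. It is used for vertices on both
  sides: as the sides are nearly equal, either one gives the same leading term.\<close>

definition join_side :: "'a set set \<Rightarrow> 'a \<Rightarrow> 'a set \<Rightarrow> 'a set set" where
  "join_side E v A = {t \<in> E. v \<notin> t} \<union> {{v, x} | x. x \<in> A - {v}}"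

lemma adj_join_side:
  "x \<noteq> v \<Longrightarrow> y \<noteq> v \<Longrightarrow> adj (join_side E v A) x y = adj E x y"
  "x \<noteq> v \<Longrightarrow> adj (join_side E v A) v x \<longleftrightarrow> x \<in> A"
  unfolding adj_def join_side_def by (auto simp: doubleton_eq_iff)

text \<open>Without wrong pairs, v and x, y, z span three edges if all three lie outside A, or two
  in A and one outside. The term 6 n^2 covers the degenerate triples: three possible equalities
  among x, y, z and three with v.\<close>

lemma card_ext_triples_join_ge:
  assumes V: "finite V" and n: "n = card V" and A: "A \<subseteq> V" and v: "v \<in> V"
  shows "card (V - A) ^ 3 + 3 * card A ^ 2 * card (V - A) \<le>
    card (ext_triples V (join_side E v A) v) + 3 * card (mismatch (adj E) V A) * n + 6 * n ^ 2"
proof -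
  let ?M = "mismatch (adj E) V A" and ?B = "V - A"
  define W where "W = ?B \<times> ?B \<times> ?B \<union> (A \<times> A \<times> ?B \<union> (A \<times> ?B \<times> A \<union> ?B \<times> A \<times> A))"
  define T where "T = {(x, y, z) \<in> W. (x, y) \<in> ?M \<or> (x, z) \<in> ?M \<or> (y, z) \<in> ?M}"
  define D where "D = (\<lambda>x. (x, x)) ` V \<union> ({v} \<times> V)"
  define D' where "D' = {(x, y, z) \<in> W. x = y \<or> x = z \<or> y = z \<or> x = v \<or> y = v \<or> z = v}"
  have finA: "finite A" using A V finite_subset by blast
  have W: "card W = card ?B ^ 3 + 3 * card A ^ 2 * card ?B"
  proof -
    have "card W = card (?B \<times> ?B \<times> ?B) + (card (A \<times> A \<times> ?B) + (card (A \<times> ?B \<times> A) + card (?B \<times> A \<times> A)))"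
      unfolding W_def using V finA by (subst card_Un_disjoint, simp, simp, blast)+ simp
    then show ?thesis by (simp add: card_cartesian_product power2_eq_square power3_eq_cube algebra_simps)
  qed
  have WV: "W \<subseteq> V \<times> V \<times> V" using A by (auto simp: W_def)
  have finM: "finite ?M" by (rule finite_subset[of _ "V \<times> V"]) (auto simp: mismatch_def V)
  have T: "card T \<le> 3 * card ?M * n"
    by (rule card_triple_le[OF finM V n]) (use WV in \<open>auto simp: T_def\<close>)
  have "card D' \<le> 6 * n ^ 2"
  proof -
    let ?l = "[(\<lambda>(x, y). (x, x, y)) ` (V \<times> V), (\<lambda>(x, y). (x, y, x)) ` (V \<times> V), (\<lambda>(x, y). (y, x, x)) ` (V \<times> V),
      (\<lambda>(x, y). (v, x, y)) ` (V \<times> V), (\<lambda>(x, y). (x, v, y)) ` (V \<times> V), (\<lambda>(x, y). (x, y, v)) ` (V \<times> V)]"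
    have "D' \<subseteq> \<Union>(set ?l)" using WV unfolding D'_def by (auto simp: image_iff)
    then have "card D' \<le> card (\<Union>(set ?l))" by (rule card_mono[rotated]) (use V in auto)
    also have "\<dots> \<le> sum_list (map card ?l)" by (rule card_Union_list_le)
    also have "\<dots> \<le> 6 * n ^ 2"
    proof -
      have "card (g ` (V \<times> V)) \<le> n ^ 2" for g :: "'a \<times> 'a \<Rightarrow> 'a \<times> 'a \<times> 'a"
        using card_image_le[of "V \<times> V" g] V n by (simp add: card_cartesian_product power2_eq_square)
      note * = this[of "\<lambda>(x, y). (x, x, y)"] this[of "\<lambda>(x, y). (x, y, x)"] this[of "\<lambda>(x, y). (y, x, x)"]
        this[of "\<lambda>(x, y). (v, x, y)"] this[of "\<lambda>(x, y). (x, v, y)"] this[of "\<lambda>(x, y). (x, y, v)"]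
      have "sum_list (map card ?l) = card ((\<lambda>(x, y). (x, x, y)) ` (V \<times> V)) + card ((\<lambda>(x, y). (x, y, x)) ` (V \<times> V)) +
         card ((\<lambda>(x, y). (y, x, x)) ` (V \<times> V)) + card ((\<lambda>(x, y). (v, x, y)) ` (V \<times> V)) +
         card ((\<lambda>(x, y). (x, v, y)) ` (V \<times> V)) + card ((\<lambda>(x, y). (x, y, v)) ` (V \<times> V))" by simp
      then show ?thesis using * by linarith
    qed
    finally show ?thesis .
  qed
  moreover have "W \<subseteq> ext_triples V (join_side E v A) v \<union> (T \<union> D')"
  proof
    fix t assume t: "t \<in> W"
    obtain x y z where xyz: "t = (x, y, z)" by (cases t)
    show "t \<in> ext_triples V (join_side E v A) v \<union> (T \<union> D')"
    proof (cases "t \<in> T \<union> D'")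
      case False
      have inV: "x \<in> V" "y \<in> V" "z \<in> V" using t WV by (auto simp: xyz)
      have d: "distinct [v, x, y, z]" using False t by (auto simp: D'_def xyz)
      then have e: "adj E x y = ((x \<in> A) = (y \<in> A))" "adj E x z = ((x \<in> A) = (z \<in> A))" "adj E y z = ((y \<in> A) = (z \<in> A))"
        using False t inV by (auto simp: T_def xyz mismatch_def)
      have "card (join_side E v A \<inter> [{v, x, y, z}]\<^bsup>2\<^esup>) = 3"
        unfolding card_edges4[OF d] using d t
        by (auto simp: adj_join_side e W_def xyz)
      then show ?thesis using d inV by (auto simp: ext_triples_def xyz)
    qed blast
  qed
  then have "card W \<le> card (ext_triples V (join_side E v A) v) + (card T + card D')"
  proof -
    assume sub: "W \<subseteq> ext_triples V (join_side E v A) v \<union> (T \<union> D')"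
    have finV3: "finite (V \<times> V \<times> V)" using V by simp
    have "finite W" using WV finV3 finite_subset by blast
    then have "finite (T \<union> D')" by (auto simp: T_def D'_def intro: finite_subset[of _ W])
    moreover have "finite (ext_triples V (join_side E v A) v)"
      by (rule finite_subset[OF _ finV3]) (auto simp: ext_triples_def)
    ultimately have "card W \<le> card (ext_triples V (join_side E v A) v \<union> (T \<union> D'))"
      by (intro card_mono[OF _ sub]) simp
    also have "\<dots> \<le> card (ext_triples V (join_side E v A) v) + card (T \<union> D')" by (rule card_Un_le)
    also have "card (T \<union> D') \<le> card T + card D'" by (rule card_Un_le)
    finally show ?thesis by simp
  qed
  ultimately show ?thesis using W T by linarith
qed

lemma vertex_star_bound:
  assumes V: "finite V" and n: "n = card V" and A: "A \<subseteq> V" and v: "v \<in> V" and E: "E \<subseteq> [V]\<^bsup>2\<^esup>"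
    and ext: "\<And>E'. E' \<subseteq> [V]\<^bsup>2\<^esup> \<Longrightarrow> Lambda 4 3 V E' \<le> Lambda 4 3 V E"
    and A1: "A1 = {x \<in> A. adj E v x}" and B1: "B1 = {x \<in> V - A. adj E v x}"
  shows "real (card (V - A)) ^ 3 + 3 * (real (card A))\<^sup>2 * card (V - A) \<le>
    star_poly (card A1) (real (card A) - card A1) (card B1) (real (card (V - A)) - card B1) +
    6 * card (mismatch (adj E) V A) * n + 6 * (real n)\<^sup>2"
proof -
  have "join_side E v A \<subseteq> [V]\<^bsup>2\<^esup>"
    using E A v by (auto simp: join_side_def)
  then have "Lambda 4 3 V (join_side E v A) \<le> Lambda 4 3 V E" by (rule ext)
  moreover have "6 * Lambda 4 3 V (join_side E v A) + card (ext_triples V E v) =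
      6 * Lambda 4 3 V E + card (ext_triples V (join_side E v A) v)"
    by (rule Lambda_change_vertex[OF V v]) (use adj_join_side(1)[of _ v _ E A] in \<open>auto simp: adj_def\<close>)
  ultimately have "card (ext_triples V (join_side E v A) v) \<le> card (ext_triples V E v)" by linarith
  then have "card (V - A) ^ 3 + 3 * card A ^ 2 * card (V - A) \<le>
      card (ext_triples V E v) + 3 * card (mismatch (adj E) V A) * n + 6 * n ^ 2"
    using card_ext_triples_join_ge[OF V n A v, of E] by linarith
  then have "real (card (V - A) ^ 3 + 3 * card A ^ 2 * card (V - A)) \<le>
      real (card (ext_triples V E v) + 3 * card (mismatch (adj E) V A) * n + 6 * n ^ 2)"
    by (simp only: of_nat_le_iff)
  then show ?thesis
    using card_ext_triples_le[OF V n A v A1 B1] by simp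
qed

section \<open>Edges between the cliques\<close>

definition with_cross :: "'a set \<Rightarrow> 'a set \<Rightarrow> ('a \<times> 'a) set \<Rightarrow> 'a set set" where
  "with_cross A B X = [A]\<^bsup>2\<^esup> \<union> [B]\<^bsup>2\<^esup> \<union> (\<lambda>(x, y). {x, y}) ` X"

lemma adj_with_cross:
  assumes dis: "A \<inter> B = {}" and X: "X \<subseteq> A \<times> B"
  shows "x \<in> A \<Longrightarrow> y \<in> A \<Longrightarrow> x \<noteq> y \<Longrightarrow> adj (with_cross A B X) x y"
    "x \<in> B \<Longrightarrow> y \<in> B \<Longrightarrow> x \<noteq> y \<Longrightarrow> adj (with_cross A B X) x y"
    "x \<in> A \<Longrightarrow> y \<in> B \<Longrightarrow> adj (with_cross A B X) x y \<longleftrightarrow> (x, y) \<in> X"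
    "x \<in> A \<Longrightarrow> y \<in> B \<Longrightarrow> adj (with_cross A B X) y x \<longleftrightarrow> (x, y) \<in> X"
proof -
  have *: "adj (with_cross A B X) x y \<longleftrightarrow> x \<noteq> y \<and> (x \<in> A \<and> y \<in> A \<or> x \<in> B \<and> y \<in> B) \<or> (x, y) \<in> X \<or> (y, x) \<in> X" for x y
    unfolding adj_def with_cross_def by (auto simp: image_iff doubleton_eq_iff)
  show "x \<in> A \<Longrightarrow> y \<in> A \<Longrightarrow> x \<noteq> y \<Longrightarrow> adj (with_cross A B X) x y"
    "x \<in> B \<Longrightarrow> y \<in> B \<Longrightarrow> x \<noteq> y \<Longrightarrow> adj (with_cross A B X) x y"
    "x \<in> A \<Longrightarrow> y \<in> B \<Longrightarrow> adj (with_cross A B X) x y \<longleftrightarrow> (x, y) \<in> X"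
    "x \<in> A \<Longrightarrow> y \<in> B \<Longrightarrow> adj (with_cross A B X) y x \<longleftrightarrow> (x, y) \<in> X"
    using dis X unfolding * by auto
qed

text \<open>For dv = dw = 0 both sides are equal. The quadratic terms in dv and dw are estimated
  with the degree bound D, and the size hypotheses make the resulting linear terms
  nonpositive.\<close>

lemma cross_arith:
  fixes a b m dv dw D :: int
  assumes "0 \<le> dv" "dv \<le> D" "0 \<le> dw" "dw \<le> D" "2 * a + 5 + 8 * D \<le> 4 * b" "2 * b + 5 + 8 * D \<le> 4 * a"
  shows "2 * ((a - 1) * (b - 1) - 2 * ((b - 1) * dw + (a - 1) * dv + (m - dv - dw)) + 3 * (dw * dv + dw * D + dv * D))
    - ((a - 1 - dw) * (a - 2 - dw) + (b - 1 - dv) * (b - 2 - dv)) \<le> (a + b) - 2 - (a - b)\<^sup>2 - 4 * m"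
proof -
  have "6 * (dw * dv) \<le> 3 * (dw * dw) + 3 * (dv * dv)"
    using zero_le_square[of "dw - dv"] by (simp add: algebra_simps)
  moreover have "dw * (2 * a + 5 + 8 * D) \<le> dw * (4 * b)" "dv * (2 * b + 5 + 8 * D) \<le> dv * (4 * a)"
    using assms by (auto intro: mult_left_mono)
  moreover have "dw * dw \<le> dw * D" "dv * dv \<le> dv * D" using assms by (auto intro: mult_left_mono)
  ultimately show ?thesis by (simp add: algebra_simps power2_eq_square)
qed

lemma finite_sections:
  assumes "finite X"
  shows "finite {y. (x, y) \<in> X}" "finite {x. (x, y) \<in> X}"
proof -
  show "finite {y. (x, y) \<in> X}"
    by (rule finite_subset[of _ "snd ` X"]) (use assms in force)+
  show "finite {x. (x, y) \<in> X}"
    by (rule finite_subset[of _ "fst ` X"]) (use assms in force)+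
qed

text \<open>Besides vw, a 4-set v, w, x, y with x and y in the same clique already has at least
  three edges, so only mixed x, y without a crossing edge can be gained. Lost are the pairs in A not
  joined to w, the pairs in B not joined to v, and mixed x, y with exactly one crossing edge. The
  first two kinds nearly cancel the gain; the mixed losses produce the decisive term -4 |X|.\<close>

lemma cross_step:
  assumes A: "finite A" and B: "finite B" and dis: "A \<inter> B = {}" and X: "X \<subseteq> A \<times> B"
    and v: "v \<in> A" and w: "w \<in> B" and new: "(v, w) \<notin> X"
    and degA: "\<And>x. x \<in> A \<Longrightarrow> card {y. (x, y) \<in> X} \<le> D"
    and degB: "\<And>y. y \<in> B \<Longrightarrow> card {x. (x, y) \<in> X} \<le> D"
    and sizes: "2 * card A + 5 + 8 * D \<le> 4 * card B" "2 * card B + 5 + 8 * D \<le> 4 * card A"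
  shows "2 * int (Lambda 4 3 (A \<union> B) (with_cross A B (insert (v, w) X))) \<le>
    2 * int (Lambda 4 3 (A \<union> B) (with_cross A B X)) +
    int (card A + card B) - 2 - (int (card A) - int (card B))\<^sup>2 - 4 * int (card X)"
proof -
  let ?V = "A \<union> B" and ?E = "with_cross A B X"
  define A' where "A' = A - {v}"
  define B' where "B' = B - {w}"
  have fin: "finite A'" "finite B'" "finite ?V" using A B by (auto simp: A'_def B'_def)
  have finX: "finite X" using X A B finite_subset by blast
  have vw: "v \<noteq> w" "v \<notin> B" "w \<notin> A" using v w dis by auto
  define none where "none x y \<longleftrightarrow> (x, w) \<notin> X \<and> (v, y) \<notin> X \<and> (x, y) \<notin> X" for x y
  define one where "one x y \<longleftrightarrow> of_bool ((x, w) \<in> X) + of_bool ((v, y) \<in> X) + of_bool ((x, y) \<in> X) = (1 :: nat)" for x y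
  define dw where "dw = card {x. (x, w) \<in> X}"
  define dv where "dv = card {y. (v, y) \<in> X}"
  define N0 where "N0 = {(x, y) \<in> A' \<times> B'. none x y}"
  define N1 where "N1 = {(x, y) \<in> A' \<times> B'. one x y}"
  define K1 where "K1 = A' - {x. (x, w) \<in> X}"
  define K2 where "K2 = B' - {y. (v, y) \<in> X}"
  note adj = adj_with_cross[OF dis X]
  have edges: "card (?E \<inter> [{v, w, x, y}]\<^bsup>2\<^esup>) =
      of_bool (adj ?E v w) + of_bool (adj ?E v x) + of_bool (adj ?E v y) +
      of_bool (adj ?E w x) + of_bool (adj ?E w y) + of_bool (adj ?E x y)"
    if "x \<in> ?V - {v, w}" "y \<in> ?V - {v, w}" "x \<noteq> y" for x y
    using card_edges4[of v w x y ?E] that vw by auto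
  have memA: "x \<in> ?V - {v, w}" "x \<in> A" "x \<noteq> v" if "x \<in> A'" for x using that dis w by (auto simp: A'_def)
  have memB: "y \<in> ?V - {v, w}" "y \<in> B" "y \<noteq> w" if "y \<in> B'" for y using that dis v by (auto simp: B'_def)
  have vw': "\<not> adj ?E v w" using adj(3)[OF v w] new by simp
  have eAA: "card (?E \<inter> [{v, w, x, y}]\<^bsup>2\<^esup>) = 3 + of_bool ((x, w) \<in> X) + of_bool ((y, w) \<in> X)"
    if "x \<in> A'" "y \<in> A'" "x \<noteq> y" for x y
    unfolding edges[OF memA(1)[OF that(1)] memA(1)[OF that(2)] that(3)]
    using memA(2,3)[OF that(1)] memA(2,3)[OF that(2)] that(3) vw' adj(1)[OF v] adj(1)[of x y] adj(4)[OF _ w]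
    by simp
  have eBB: "card (?E \<inter> [{v, w, x, y}]\<^bsup>2\<^esup>) = 3 + of_bool ((v, x) \<in> X) + of_bool ((v, y) \<in> X)"
    if "x \<in> B'" "y \<in> B'" "x \<noteq> y" for x y
    unfolding edges[OF memB(1)[OF that(1)] memB(1)[OF that(2)] that(3)]
    using memB(2,3)[OF that(1)] memB(2,3)[OF that(2)] that(3) vw' adj(2)[OF w] adj(2)[of x y] adj(3)[OF v]
    by simp
  have eAB: "card (?E \<inter> [{v, w, x, y}]\<^bsup>2\<^esup>) = 2 + of_bool ((x, w) \<in> X) + of_bool ((v, y) \<in> X) + of_bool ((x, y) \<in> X)"
    if "x \<in> A'" "y \<in> B'" for x y
  proof -
    have "x \<noteq> y" using memA(2)[OF that(1)] memB(2)[OF that(2)] dis by auto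
    show ?thesis
      unfolding edges[OF memA(1)[OF that(1)] memB(1)[OF that(2)] \<open>x \<noteq> y\<close>]
      using memA(2,3)[OF that(1)] memB(2,3)[OF that(2)] vw' adj(1)[OF v] adj(2)[OF w] adj(3)[OF v] adj(4)[OF _ w] adj(3)[of x y]
      by simp
  qed
  have eBA: "card (?E \<inter> [{v, w, y, x}]\<^bsup>2\<^esup>) = card (?E \<inter> [{v, w, x, y}]\<^bsup>2\<^esup>)" for x y
    by (simp add: insert_commute)
  have VAB: "?V - {v, w} = A' \<union> B'" using vw by (auto simp: A'_def B'_def)
  have disj: "A' \<inter> B' = {}" using dis by (auto simp: A'_def B'_def)
  have finN: "finite N0" "finite N1" "finite K1" "finite K2"
    using fin by (auto simp: N0_def N1_def K1_def K2_def intro: finite_subset[of _ "A' \<times> B'"])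
  have finE: "finite (ext_pairs ?V ?E v w 3)"
    by (rule finite_subset[of _ "?V \<times> ?V"]) (use fin in \<open>auto simp: ext_pairs_def\<close>)
  have "ext_pairs ?V ?E v w 2 \<subseteq> N0 \<union> prod.swap ` N0"
  proof
    fix t assume t: "t \<in> ext_pairs ?V ?E v w 2"
    obtain x y where xy: "t = (x, y)" by (cases t)
    have "x \<in> A' \<union> B'" "y \<in> A' \<union> B'" "x \<noteq> y" "card (?E \<inter> [{v, w, x, y}]\<^bsup>2\<^esup>) = 2"
      using t unfolding ext_pairs_def VAB by (auto simp: xy)
    then show "t \<in> N0 \<union> prod.swap ` N0"
      using eAA[of x y] eBB[of x y] eAB[of x y] eAB[of y x] eBA[of x y]
      by (auto simp: xy N0_def none_def image_iff)
  qed
  then have "card (ext_pairs ?V ?E v w 2) \<le> card (N0 \<union> prod.swap ` N0)"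
    by (rule card_mono[rotated]) (use finN in auto)
  also have "\<dots> \<le> card N0 + card (prod.swap ` N0)" by (rule card_Un_le)
  also have "card (prod.swap ` N0) \<le> card N0" using finN by (intro card_image_le)
  finally have D2: "card (ext_pairs ?V ?E v w 2) \<le> 2 * card N0" by simp
  have "{(x, y) \<in> K1 \<times> K1. x \<noteq> y} \<union> ({(x, y) \<in> K2 \<times> K2. x \<noteq> y} \<union> (N1 \<union> prod.swap ` N1)) \<subseteq> ext_pairs ?V ?E v w 3"
    unfolding ext_pairs_def VAB using disj
    by (auto simp: K1_def K2_def N1_def one_def eAA eBB eAB eBA)
  then have "card ({(x, y) \<in> K1 \<times> K1. x \<noteq> y} \<union> ({(x, y) \<in> K2 \<times> K2. x \<noteq> y} \<union> (N1 \<union> prod.swap ` N1))) \<le> card (ext_pairs ?V ?E v w 3)"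
    by (rule card_mono[OF finE])
  moreover have "card ({(x, y) \<in> K1 \<times> K1. x \<noteq> y} \<union> ({(x, y) \<in> K2 \<times> K2. x \<noteq> y} \<union> (N1 \<union> prod.swap ` N1))) =
     card {(x, y) \<in> K1 \<times> K1. x \<noteq> y} + (card {(x, y) \<in> K2 \<times> K2. x \<noteq> y} + (card N1 + card (prod.swap ` N1)))"
  proof -
    have f: "finite {(x, y) \<in> K1 \<times> K1. x \<noteq> y}" "finite {(x, y) \<in> K2 \<times> K2. x \<noteq> y}"
      using finN by (auto intro: finite_subset[of _ "K1 \<times> K1"] finite_subset[of _ "K2 \<times> K2"])
    have "N1 \<inter> prod.swap ` N1 = {}" using disj by (auto simp: N1_def)
    moreover have "{(x, y) \<in> K2 \<times> K2. x \<noteq> y} \<inter> (N1 \<union> prod.swap ` N1) = {}" using disj by (auto simp: N1_def K2_def)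
    moreover have "{(x, y) \<in> K1 \<times> K1. x \<noteq> y} \<inter> ({(x, y) \<in> K2 \<times> K2. x \<noteq> y} \<union> (N1 \<union> prod.swap ` N1)) = {}"
      using disj by (auto simp: N1_def K1_def K2_def)
    ultimately show ?thesis using f finN by (simp add: card_Un_disjoint)
  qed
  moreover have "card (prod.swap ` N1) = card N1" by (rule card_image) simp
  ultimately have D3: "card K1 * (card K1 - 1) + card K2 * (card K2 - 1) + 2 * card N1 \<le> card (ext_pairs ?V ?E v w 3)"
    unfolding card_off_diagonal[OF finN(3), symmetric] card_off_diagonal[OF finN(4), symmetric] by linarith
  have sub: "{x. (x, w) \<in> X} \<subseteq> A'" "{y. (v, y) \<in> X} \<subseteq> B'"
    using X new by (auto simp: A'_def B'_def)
  have cA': "int (card A') = int (card A) - 1" and cB': "int (card B') = int (card B) - 1"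
    using card_Suc_Diff1[OF A v] card_Suc_Diff1[OF B w] by (simp_all add: A'_def B'_def)
  have K1: "int (card K1) = int (card A) - 1 - int dw"
    unfolding K1_def dw_def using sub(1) fin cA' card_mono[OF fin(1) sub(1)]
    by (simp add: card_Diff_subset finite_subset of_nat_diff)
  have K2: "int (card K2) = int (card B) - 1 - int dv"
    unfolding K2_def dv_def using sub(2) fin cB' card_mono[OF fin(2) sub(2)]
    by (simp add: card_Diff_subset finite_subset of_nat_diff)
  have kk: "int (k * (k - 1)) = int k * (int k - 1)" for k :: nat by (cases k) (auto simp: algebra_simps)
  define p where "p x = (of_bool ((x, w) \<in> X) :: int)" for x
  define q where "q y = (of_bool ((v, y) \<in> X) :: int)" for y
  define r where "r x y = (of_bool ((x, y) \<in> X) :: int)" for x y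
  have sp: "(\<Sum>x\<in>A'. p x) = int dw"
    unfolding p_def dw_def using fin sub(1) by (simp add: Int_absorb1)
  have sq: "(\<Sum>y\<in>B'. q y) = int dv"
    unfolding q_def dv_def using fin sub(2) by (simp add: Int_absorb1)
  have sr: "(\<Sum>x\<in>A'. \<Sum>y\<in>B'. r x y) = int (card X) - int dv - int dw"
  proof -
    have "(\<Sum>x\<in>A'. \<Sum>y\<in>B'. r x y) = (\<Sum>t\<in>A' \<times> B'. of_bool (t \<in> X))"
      unfolding r_def by (simp add: sum.cartesian_product case_prod_unfold)
    also have "\<dots> = int (card ((A' \<times> B') \<inter> X))"
      using fin by (simp add: Int_def)
    also have "X = ((A' \<times> B') \<inter> X) \<union> ((\<lambda>y. (v, y)) ` {y. (v, y) \<in> X} \<union> (\<lambda>x. (x, w)) ` {x. (x, w) \<in> X})"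
      using X by (auto simp: A'_def B'_def)
    then have "card X = card ((A' \<times> B') \<inter> X) + (card ((\<lambda>y. (v, y)) ` {y. (v, y) \<in> X}) + card ((\<lambda>x. (x, w)) ` {x. (x, w) \<in> X}))"
    proof -
      assume eq: "X = ((A' \<times> B') \<inter> X) \<union> ((\<lambda>y. (v, y)) ` {y. (v, y) \<in> X} \<union> (\<lambda>x. (x, w)) ` {x. (x, w) \<in> X})"
      have f: "finite ((\<lambda>y. (v, y)) ` {y. (v, y) \<in> X})" "finite ((\<lambda>x. (x, w)) ` {x. (x, w) \<in> X})"
        using sub fin finite_subset by blast+
      have "(\<lambda>y. (v, y)) ` {y. (v, y) \<in> X} \<inter> (\<lambda>x. (x, w)) ` {x. (x, w) \<in> X} = {}" using new by auto
      moreover have "((A' \<times> B') \<inter> X) \<inter> ((\<lambda>y. (v, y)) ` {y. (v, y) \<in> X} \<union> (\<lambda>x. (x, w)) ` {x. (x, w) \<in> X}) = {}"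
        by (auto simp: A'_def B'_def)
      ultimately show ?thesis
        by (subst eq) (use f fin in \<open>simp add: card_Un_disjoint\<close>)
    qed
    moreover have "card ((\<lambda>y. (v, y)) ` {y. (v, y) \<in> X}) = dv" "card ((\<lambda>x. (x, w)) ` {x. (x, w) \<in> X}) = dw"
      unfolding dv_def dw_def by (rule card_image, simp add: inj_on_def)+
    ultimately show ?thesis by simp
  qed
  have rA: "(\<Sum>y\<in>B'. r x y) \<le> int D" if "x \<in> A'" for x
  proof -
    have "(\<Sum>y\<in>B'. r x y) = int (card (B' \<inter> {y. (x, y) \<in> X}))" unfolding r_def using fin by simp
    also have "\<dots> \<le> int (card {y. (x, y) \<in> X})"
      by (intro of_nat_mono card_mono finite_sections[OF finX]) auto
    also have "\<dots> \<le> int D" using degA[of x] that by (simp add: A'_def)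
    finally show ?thesis .
  qed
  have rB: "(\<Sum>x\<in>A'. r x y) \<le> int D" if "y \<in> B'" for y
  proof -
    have "(\<Sum>x\<in>A'. r x y) = int (card (A' \<inter> {x. (x, y) \<in> X}))" unfolding r_def using fin by simp
    also have "\<dots> \<le> int (card {x. (x, y) \<in> X})"
      by (intro of_nat_mono card_mono finite_sections[OF finX]) auto
    also have "\<dots> \<le> int D" using degB[of y] that by (simp add: B'_def)
    finally show ?thesis .
  qed
  have spq: "(\<Sum>x\<in>A'. \<Sum>y\<in>B'. p x * q y) = int dw * int dv"
    unfolding sum_distrib_left[symmetric] sum_distrib_right[symmetric] sp sq ..
  have spr: "(\<Sum>x\<in>A'. \<Sum>y\<in>B'. p x * r x y) \<le> int dw * int D"
  proof -
    have "(\<Sum>x\<in>A'. \<Sum>y\<in>B'. p x * r x y) = (\<Sum>x\<in>A'. p x * (\<Sum>y\<in>B'. r x y))" by (simp add: sum_distrib_left)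
    also have "\<dots> \<le> (\<Sum>x\<in>A'. p x * int D)" using rA by (intro sum_mono mult_left_mono) (auto simp: p_def)
    finally show ?thesis unfolding sum_distrib_right[symmetric] sp .
  qed
  have sqr: "(\<Sum>x\<in>A'. \<Sum>y\<in>B'. q y * r x y) \<le> int dv * int D"
  proof -
    have "(\<Sum>x\<in>A'. \<Sum>y\<in>B'. q y * r x y) = (\<Sum>y\<in>B'. q y * (\<Sum>x\<in>A'. r x y))"
      by (subst sum.swap) (simp add: sum_distrib_left)
    also have "\<dots> \<le> (\<Sum>y\<in>B'. q y * int D)" using rB by (intro sum_mono mult_left_mono) (auto simp: q_def)
    finally show ?thesis unfolding sum_distrib_right[symmetric] sq .
  qed
  have pairs: "int (card {(x, y) \<in> A' \<times> B'. P x y}) = (\<Sum>x\<in>A'. \<Sum>y\<in>B'. of_bool (P x y))" for P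
  proof -
    have "{(x, y) \<in> A' \<times> B'. P x y} = {t \<in> A' \<times> B'. P (fst t) (snd t)}" by auto
    then have "int (card {(x, y) \<in> A' \<times> B'. P x y}) = (\<Sum>t\<in>A' \<times> B'. of_bool (P (fst t) (snd t)))"
      using card_filter_eq_sum[of "A' \<times> B'" "\<lambda>t. P (fst t) (snd t)"] fin(1,2) by (metis finite_cartesian_product)
    then show ?thesis by (simp only: sum.cartesian_product' fst_conv snd_conv)
  qed
  have N0: "int (card N0) = (\<Sum>x\<in>A'. \<Sum>y\<in>B'. of_bool (none x y))"
    unfolding N0_def by (rule pairs)
  have N1: "int (card N1) = (\<Sum>x\<in>A'. \<Sum>y\<in>B'. of_bool (one x y))"
    unfolding N1_def by (rule pairs)
  have comb: "x \<le> y \<Longrightarrow> z \<le> 2 * x - t \<Longrightarrow> 2 * y - t \<le> u \<Longrightarrow> z \<le> u" for x y z t u :: int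
    by linarith
  have "int (card N0) - int (card N1) = (\<Sum>x\<in>A'. \<Sum>y\<in>B'. of_bool (none x y) - of_bool (one x y))"
    unfolding N0 N1 sum_subtractf ..
  \<comment> \<open>If 0, 1, 2 or 3 of the three crossing pairs are present, the left summand is 1,
    -1, 0, 0 and the right one 1, -1, 0, 4.\<close>
  also have "\<dots> \<le> (\<Sum>x\<in>A'. \<Sum>y\<in>B'. 1 - 2 * p x - 2 * q y - 2 * r x y + 3 * (p x * q y) + 3 * (p x * r x y) + 3 * (q y * r x y))"
    by (intro sum_mono) (auto simp: none_def one_def p_def q_def r_def)
  also have "\<dots> = int (card A') * int (card B') - 2 * (int (card B') * int dw) - 2 * (int (card A') * int dv)
      - 2 * (int (card X) - int dv - int dw) + 3 * (int dw * int dv)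
      + 3 * (\<Sum>x\<in>A'. \<Sum>y\<in>B'. p x * r x y) + 3 * (\<Sum>x\<in>A'. \<Sum>y\<in>B'. q y * r x y)"
  proof -
    have c: "(\<Sum>x\<in>A'. \<Sum>y\<in>B'. k * F x y) = k * (\<Sum>x\<in>A'. \<Sum>y\<in>B'. F x y)" for k :: int and F
      by (simp only: sum_distrib_left)
    have 1: "(\<Sum>x\<in>A'. \<Sum>y\<in>B'. p x) = int (card B') * int dw"
      by (simp add: sum_distrib_left[symmetric] sp)
    have 2: "(\<Sum>x\<in>A'. \<Sum>y\<in>B'. q y) = int (card A') * int dv"
      by (simp add: sq)
    have 3: "(\<Sum>x\<in>A'. \<Sum>y\<in>B'. (1 :: int)) = int (card A') * int (card B')" by simp
    show ?thesis unfolding sum.distrib sum_subtractf c 1 2 3 sr spq ..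
  qed
  finally have "int (card N0) - int (card N1) \<le> (int (card A) - 1) * (int (card B) - 1)
     - 2 * ((int (card B) - 1) * int dw + (int (card A) - 1) * int dv + (int (card X) - int dv - int dw))
     + 3 * (int dw * int dv + int dw * int D + int dv * int D)"
    using spr sqr unfolding cA' cB' by (simp add: algebra_simps)
  moreover have "int (card (ext_pairs ?V ?E v w 2)) - int (card (ext_pairs ?V ?E v w 3)) \<le>
     2 * (int (card N0) - int (card N1)) - ((int (card A) - 1 - int dw) * (int (card A) - 2 - int dw) + (int (card B) - 1 - int dv) * (int (card B) - 2 - int dv))"
  proof -
    have "int (card K1 * (card K1 - 1) + card K2 * (card K2 - 1) + 2 * card N1) \<le> int (card (ext_pairs ?V ?E v w 3))"
      using D3 by (simp only: of_nat_le_iff)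
    then show ?thesis using D2 unfolding of_nat_add kk K1 K2 by (simp add: algebra_simps)
  qed
  moreover have "2 * ((int (card A) - 1) * (int (card B) - 1) - 2 * ((int (card B) - 1) * int dw + (int (card A) - 1) * int dv + (int (card X) - int dv - int dw))
       + 3 * (int dw * int dv + int dw * int D + int dv * int D))
    - ((int (card A) - 1 - int dw) * (int (card A) - 2 - int dw) + (int (card B) - 1 - int dv) * (int (card B) - 2 - int dv))
    \<le> (int (card A) + int (card B)) - 2 - (int (card A) - int (card B))\<^sup>2 - 4 * int (card X)"
    by (rule cross_arith) (use degA[OF v] degB[OF w] sizes in \<open>auto simp: dv_def dw_def\<close>)
  ultimately have "int (card (ext_pairs ?V ?E v w 2)) - int (card (ext_pairs ?V ?E v w 3)) \<le>
     (int (card A) + int (card B)) - 2 - (int (card A) - int (card B))\<^sup>2 - 4 * int (card X)" by (rule comb)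
  moreover have "with_cross A B (insert (v, w) X) = insert {v, w} ?E" by (auto simp: with_cross_def)
  moreover have "{v, w} \<notin> ?E" using adj(3)[OF v w] new by (simp add: adj_def)
  then have "2 * Lambda 4 3 ?V (insert {v, w} ?E) + card (ext_pairs ?V ?E v w 3) =
      2 * Lambda 4 3 ?V ?E + card (ext_pairs ?V ?E v w 2)"
    by (intro Lambda_insert_edge) (use fin v w vw in auto)
  ultimately show ?thesis by simp
qed

text \<open>The crossing edges are inserted one by one; the degree bounds pass to subsets of X.
  Summing n - 2 - d^2 - 4 k over k < m gives m (n - d^2) - 2 m^2, where d is the size
  difference.\<close>

lemma Lambda_with_cross_le:
  assumes A: "finite A" and B: "finite B" and dis: "A \<inter> B = {}"
    and sizes: "2 * card A + 5 + 8 * D \<le> 4 * card B" "2 * card B + 5 + 8 * D \<le> 4 * card A"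
    and X: "finite X" "X \<subseteq> A \<times> B"
    and degA: "\<And>x. x \<in> A \<Longrightarrow> card {y. (x, y) \<in> X} \<le> D"
    and degB: "\<And>y. y \<in> B \<Longrightarrow> card {x. (x, y) \<in> X} \<le> D"
  shows "2 * int (Lambda 4 3 (A \<union> B) (with_cross A B X)) \<le>
    2 * int (Lambda 4 3 (A \<union> B) ([A]\<^bsup>2\<^esup> \<union> [B]\<^bsup>2\<^esup>)) +
    int (card X) * (int (card A + card B) - (int (card A) - int (card B))\<^sup>2) - 2 * (int (card X))\<^sup>2"
  using X degA degB
proof (induction X rule: finite_induct)
  case empty
  then show ?case by (simp add: with_cross_def)
next
  case (insert t X)
  obtain v w where t: "t = (v, w)" by (cases t)
  have XV: "X \<subseteq> A \<times> B" "v \<in> A" "w \<in> B" using insert.prems by (auto simp: t)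
  have fin: "finite {y. (x, y) \<in> insert t X}" "finite {x. (x, y) \<in> insert t X}" for x y
    using finite_sections[of "insert t X"] insert.hyps(1) by auto
  have dA: "card {y. (x, y) \<in> X} \<le> D" if "x \<in> A" for x
    by (rule order_trans[OF card_mono[OF fin(1)] insert.prems(2)[OF that]]) auto
  have dB: "card {x. (x, y) \<in> X} \<le> D" if "y \<in> B" for y
    by (rule order_trans[OF card_mono[OF fin(2)] insert.prems(3)[OF that]]) auto
  have new: "(v, w) \<notin> X" using insert.hyps t by simp
  have "2 * int (Lambda 4 3 (A \<union> B) (with_cross A B (insert (v, w) X))) \<le>
    2 * int (Lambda 4 3 (A \<union> B) (with_cross A B X)) +
    int (card A + card B) - 2 - (int (card A) - int (card B))\<^sup>2 - 4 * int (card X)"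
    by (rule cross_step[OF A B dis XV(1-3) new dA dB sizes])
  moreover note insert.IH[OF XV(1) dA dB]
  moreover have "card (insert (v, w) X) = Suc (card X)" using insert.hyps new by simp
  ultimately show ?case unfolding t by (simp add: algebra_simps power2_eq_square)
qed

section \<open>Maximal graphs\<close>

text \<open>Maximality on the fixed vertex set V, the only form in which it is used from here
  on.\<close>

definition extremal :: "'a set \<Rightarrow> 'a set set \<Rightarrow> bool" where
  "extremal V E \<longleftrightarrow> finite V \<and> E \<subseteq> [V]\<^bsup>2\<^esup> \<and> (\<forall>E'. E' \<subseteq> [V]\<^bsup>2\<^esup> \<longrightarrow> Lambda 4 3 V E' \<le> Lambda 4 3 V E)"

lemma finite_mismatch: "finite V \<Longrightarrow> finite (mismatch e V A)"
  by (rule finite_subset[of _ "V \<times> V"]) (auto simp: mismatch_def)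

text \<open>A 4-set without wrong pairs spans the same edges in both graphs; any other is charged to
  one of its wrong pairs together with its two remaining vertices.\<close>

lemma Lambda_le_cliques:
  assumes V: "finite V" and A: "A \<subseteq> V" and E: "E \<subseteq> [V]\<^bsup>2\<^esup>"
  shows "Lambda 4 3 V E \<le> Lambda 4 3 V ([A]\<^bsup>2\<^esup> \<union> [V - A]\<^bsup>2\<^esup>) + card (mismatch (adj E) V A) * card V ^ 2"
proof -
  let ?M = "mismatch (adj E) V A" and ?C = "[A]\<^bsup>2\<^esup> \<union> [V - A]\<^bsup>2\<^esup>"
  let ?Q = "\<lambda>E. {S \<in> [V]\<^bsup>4\<^esup>. card (E \<inter> [S]\<^bsup>2\<^esup>) = 3}"
  let ?f = "\<lambda>((x, y), (z, w)). {x, y, z, w}"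
  have fin: "finite (?Q D)" for D using finite_imp_finite_nsets[OF V] by simp
  have finM: "finite (?M \<times> (V \<times> V))" using V finite_mismatch by auto
  have "?Q E \<subseteq> ?Q ?C \<union> ?f ` (?M \<times> (V \<times> V))"
  proof
    fix S assume S: "S \<in> ?Q E"
    then have SV: "S \<subseteq> V" "finite S" "card S = 4" by (auto simp: nsets_def)
    show "S \<in> ?Q ?C \<union> ?f ` (?M \<times> (V \<times> V))"
    proof (cases "\<exists>x\<in>S. \<exists>y\<in>S. (x, y) \<in> ?M")
      case True
      then obtain x y where xy: "x \<in> S" "y \<in> S" "(x, y) \<in> ?M" by blast
      then have "x \<noteq> y" by (auto simp: mismatch_def)
      then have "card (S - {x, y}) = 2" using xy SV by (simp add: card_Diff_subset)
      then obtain z w where "S - {x, y} = {z, w}" by (auto simp: card_2_iff)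
      then have "S = {x, y, z, w}" "z \<in> V" "w \<in> V" using xy SV by auto
      then show ?thesis using xy(3) by (intro UnI2 image_eqI[of _ _ "((x, y), (z, w))"]) auto
    next
      case False
      have "t \<in> E \<longleftrightarrow> t \<in> ?C" if t: "t \<in> [S]\<^bsup>2\<^esup>" for t
      proof -
        obtain x y where xy: "t = {x, y}" "x \<in> S" "y \<in> S" "x \<noteq> y" using t by (rule nsets2_E)
        then have "adj E x y \<longleftrightarrow> (x \<in> A) = (y \<in> A)" using False SV by (auto simp: mismatch_def)
        then show ?thesis using xy SV by (auto simp: adj_def)
      qed
      then have "E \<inter> [S]\<^bsup>2\<^esup> = ?C \<inter> [S]\<^bsup>2\<^esup>" by blast
      then show ?thesis using S by simp
    qed
  qed
  then have "card (?Q E) \<le> card (?Q ?C \<union> ?f ` (?M \<times> (V \<times> V)))"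
    by (rule card_mono[rotated]) (use fin finM in simp)
  also have "\<dots> \<le> card (?Q ?C) + card (?f ` (?M \<times> (V \<times> V)))" by (rule card_Un_le)
  also have "card (?f ` (?M \<times> (V \<times> V))) \<le> card (?M \<times> (V \<times> V))" by (rule card_image_le[OF finM])
  finally show ?thesis unfolding Lambda_def by (simp add: card_cartesian_product power2_eq_square)
qed

text \<open>The competitor consists of cliques of sizes (n + s) / 2 and (n - s) / 2; the parity
  assumption makes these integers.\<close>

lemma extremal_ge:
  assumes ex: "extremal V E" and n: "n = real (card V)"
    and s: "even (card V + s)" "s \<le> card V"
  shows "48 * real (Lambda 4 3 V E) \<ge> (n\<^sup>2 - 3 * n + 4)\<^sup>2 - (3 * n - 4 - (real s)\<^sup>2)\<^sup>2"
proof -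
  have V: "finite V" using ex by (simp add: extremal_def)
  obtain k where k: "card V + s = 2 * k" using s(1) by (rule evenE)
  then have "k \<le> card V" using s(2) by linarith
  then obtain A where A: "A \<subseteq> V" "card A = k" by (meson obtain_subset_with_card_n)
  have finA: "finite A" using A V finite_subset by blast
  have "card (V - A) = card V - k" using A finA by (simp add: card_Diff_subset)
  then have B: "real (card (V - A)) = n - real k" using \<open>k \<le> card V\<close> by (simp add: n of_nat_diff)
  have k': "n + real s = 2 * real k" using k n by (simp flip: of_nat_add of_nat_mult)
  have "[A]\<^bsup>2\<^esup> \<union> [V - A]\<^bsup>2\<^esup> \<subseteq> [V]\<^bsup>2\<^esup>" using A nsets_mono[of A V 2] nsets_mono[of "V - A" V 2] by auto
  then have "Lambda 4 3 V ([A]\<^bsup>2\<^esup> \<union> [V - A]\<^bsup>2\<^esup>) \<le> Lambda 4 3 V E" using ex by (simp add: extremal_def)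
  then have "real (Lambda 4 3 V ([A]\<^bsup>2\<^esup> \<union> [V - A]\<^bsup>2\<^esup>)) \<le> real (Lambda 4 3 V E)" by (simp only: of_nat_le_iff)
  moreover have "48 * real (Lambda 4 3 (A \<union> (V - A)) ([A]\<^bsup>2\<^esup> \<union> [V - A]\<^bsup>2\<^esup>)) =
      (n\<^sup>2 - 3 * n + 4)\<^sup>2 - (3 * n - 4 - (real s)\<^sup>2)\<^sup>2"
    by (rule Lambda_cliques_real) (use finA V A B k' in auto)
  moreover have "A \<union> (V - A) = V" using A by auto
  ultimately show ?thesis by simp
qed

lemma extremal_lower_bound:
  assumes ex: "extremal V E" and n: "n = real (card V)" "card V \<ge> 10"
  shows "48 * real (Lambda 4 3 V E) \<ge> n ^ 4 - 6 * n ^ 3"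
proof -
  obtain s :: nat where s: "s \<le> 1" "even (card V + s)"
    using that[of 0] that[of 1] by (cases "even (card V)") auto
  have "(real s)\<^sup>2 \<le> 1" using s(1) by (simp add: power_le_one)
  then have "(3 * n - 4 - (real s)\<^sup>2)\<^sup>2 \<le> (3 * n - 4)\<^sup>2"
    using n by (intro power_mono) auto
  moreover have "(n\<^sup>2 - 3 * n + 4)\<^sup>2 - (3 * n - 4)\<^sup>2 = n ^ 4 - 6 * n ^ 3 + 8 * n\<^sup>2"
    by (simp add: power2_eq_square power3_eq_cube power4_eq_xxxx algebra_simps)
  moreover have "8 * n\<^sup>2 \<ge> 0" by simp
  moreover have "48 * real (Lambda 4 3 V E) \<ge> (n\<^sup>2 - 3 * n + 4)\<^sup>2 - (3 * n - 4 - (real s)\<^sup>2)\<^sup>2"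
    by (rule extremal_ge[OF ex n(1) s(2)]) (use s n in linarith)
  ultimately show ?thesis by linarith
qed

section \<open>Wrong pairs at one vertex and inside one part\<close>

definition misdeg :: "('a \<Rightarrow> 'a \<Rightarrow> bool) \<Rightarrow> 'a set \<Rightarrow> 'a set \<Rightarrow> 'a \<Rightarrow> 'a set" where
  "misdeg e V A v = {x \<in> V. (v, x) \<in> mismatch e V A}"

lemma card_mismatch_vertex:
  assumes V: "finite V" and v: "v \<in> V" and e: "sym_rel e"
  shows "card (mismatch e V A) = card {(x, y) \<in> mismatch e V A. x \<noteq> v \<and> y \<noteq> v} + 2 * card (misdeg e V A v)"
proof -
  let ?M = "mismatch e V A" and ?D = "misdeg e V A v"
  let ?R = "{(x, y) \<in> ?M. x \<noteq> v \<and> y \<noteq> v}"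
  have fin: "finite ?M" "finite ?D" "finite ?R"
    using V finite_mismatch[OF V] by (auto simp: misdeg_def intro: finite_subset[of _ ?M])
  have sym: "(x, y) \<in> ?M \<longleftrightarrow> (y, x) \<in> ?M" for x y
    using sym_rel.sym[OF e, of x y] by (auto simp: mismatch_def)
  have "v \<notin> ?D" by (auto simp: misdeg_def mismatch_def)
  then have dis: "?R \<inter> (Pair v ` ?D \<union> (\<lambda>x. (x, v)) ` ?D) = {}" "Pair v ` ?D \<inter> (\<lambda>x. (x, v)) ` ?D = {}" by auto
  have "?M = ?R \<union> (Pair v ` ?D \<union> (\<lambda>x. (x, v)) ` ?D)"
  proof (intro equalityI subsetI)
    fix t assume t: "t \<in> ?M"
    obtain x y where xy: "t = (x, y)" by (cases t)
    have "x \<in> V" "y \<in> V" using t by (auto simp: xy mismatch_def)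
    then show "t \<in> ?R \<union> (Pair v ` ?D \<union> (\<lambda>x. (x, v)) ` ?D)"
      using t sym[of x y] by (cases "x = v"; cases "y = v") (auto simp: xy misdeg_def)
  next
    fix t assume "t \<in> ?R \<union> (Pair v ` ?D \<union> (\<lambda>x. (x, v)) ` ?D)"
    then show "t \<in> ?M" using sym by (auto simp: misdeg_def)
  qed
  then have "card ?M = card ?R + (card (Pair v ` ?D) + card ((\<lambda>x. (x, v)) ` ?D))"
    using dis fin by (metis (no_types, lifting) card_Un_disjoint finite_UnI finite_imageI)
  moreover have "card (Pair v ` ?D) = card ?D" "card ((\<lambda>x. (x, v)) ` ?D) = card ?D"
    by (rule card_image, simp add: inj_on_def)+
  ultimately show ?thesis by simp
qed

text \<open>Moving v to the other part exchanges the right and the wrong pairs at v and changes no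
  other pair.\<close>

lemma min_mismatch_misdeg:
  assumes V: "finite V" and v: "v \<in> V" and A: "A \<subseteq> V" and e: "sym_rel e"
    and min: "\<And>A'. A' \<subseteq> V \<Longrightarrow> card (mismatch e V A) \<le> card (mismatch e V A')"
  shows "card (misdeg e V A v) \<le> card (V - {v} - misdeg e V A v)"
proof -
  define A' where "A' = (if v \<in> A then A - {v} else insert v A)"
  have "A' \<subseteq> V" using A v by (auto simp: A'_def)
  then have "card (mismatch e V A) \<le> card (mismatch e V A')" by (rule min)
  moreover have "{(x, y) \<in> mismatch e V A. x \<noteq> v \<and> y \<noteq> v} = {(x, y) \<in> mismatch e V A'. x \<noteq> v \<and> y \<noteq> v}"
    by (auto simp: mismatch_def A'_def)
  moreover have "misdeg e V A' v = V - {v} - misdeg e V A v"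
    using v by (auto simp: misdeg_def mismatch_def A'_def)
  ultimately show ?thesis
    using card_mismatch_vertex[OF V v e, of A] card_mismatch_vertex[OF V v e, of A'] by simp
qed

text \<open>\<open>vertex_dichotomy\<close> leaves open whether few or almost all pairs at v are
  wrong. Minimality of the bipartition bounds the wrong pairs by the right ones, hence by whichever
  of the two counts is small.\<close>

lemma misdeg_le:
  assumes ex: "extremal V E" and A: "A \<subseteq> V" and v: "v \<in> V" and n: "n = real (card V)" "n \<ge> 10 ^ 7"
    and bal: "\<bar>real (card A) - real (card (V - A))\<bar> \<le> n / 10 ^ 6"
    and f: "real (card (mismatch (adj E) V A)) \<le> n\<^sup>2 / 10 ^ 6"
    and min: "\<And>A'. A' \<subseteq> V \<Longrightarrow> card (mismatch (adj E) V A) \<le> card (mismatch (adj E) V A')"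
  shows "real (card (misdeg (adj E) V A v)) \<le> n / 100"
proof -
  let ?D = "misdeg (adj E) V A v" and ?B = "V - A"
  define A1 where "A1 = {x \<in> A. adj E v x}"
  define B1 where "B1 = {x \<in> ?B. adj E v x}"
  have V: "finite V" and E: "E \<subseteq> [V]\<^bsup>2\<^esup>" using ex by (auto simp: extremal_def)
  have finA: "finite A" using A V finite_subset by blast
  have sub: "A1 \<subseteq> A" "B1 \<subseteq> ?B" by (auto simp: A1_def B1_def)
  have fin: "finite A1" "finite B1" using sub finA V finite_subset by blast+
  have le: "card A1 \<le> card A" "card B1 \<le> card ?B" using sub finA V by (auto intro: card_mono)
  have dA: "real (card (A - A1)) = real (card A) - card A1" and dB: "real (card (?B - B1)) = real (card ?B) - card B1"
    using sub fin le by (simp_all add: card_Diff_subset of_nat_diff)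
  have "card A + card ?B = card V" using A V finA by (simp add: card_Diff_subset card_mono)
  then have sum: "real (card A) + real (card ?B) = n" using n by (simp flip: of_nat_add)
  have "real (card ?B) ^ 3 + 3 * (real (card A))\<^sup>2 * real (card ?B) \<le>
    star_poly (card A1) (real (card A) - card A1) (card B1) (real (card ?B) - card B1) +
    6 * real (card (mismatch (adj E) V A)) * n + 6 * n\<^sup>2"
    using vertex_star_bound[OF V refl A v E _ A1_def B1_def] ex by (simp add: extremal_def n(1))
  then have "(real (card A) - card A1) + card B1 \<le> n / 100 \<or> real (card A1) + (real (card ?B) - card B1) \<le> n / 100"
    by (intro vertex_dichotomy[OF _ _ _ _ sum n(2) bal f]) (use le in auto)
  then have small: "real (card (A - A1) + card B1) \<le> n / 100 \<or> real (card A1 + card (?B - B1)) \<le> n / 100"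
    using dA dB by simp
  have D: "?D \<subseteq> (if v \<in> A then (A - A1) \<union> B1 else A1 \<union> (?B - B1))"
    "V - {v} - ?D \<subseteq> (if v \<in> A then A1 \<union> (?B - B1) else (A - A1) \<union> B1)"
    using v by (auto simp: misdeg_def mismatch_def A1_def B1_def)
  have c: "card (A - A1 \<union> B1) \<le> card (A - A1) + card B1" "card (A1 \<union> (?B - B1)) \<le> card A1 + card (?B - B1)"
    by (rule card_Un_le)+
  have f1: "finite (A - A1 \<union> B1)" "finite (A1 \<union> (?B - B1))" using finA fin V by auto
  have "(card ?D \<le> card (A - A1) + card B1 \<and> card (V - {v} - ?D) \<le> card A1 + card (?B - B1)) \<or>
    (card ?D \<le> card A1 + card (?B - B1) \<and> card (V - {v} - ?D) \<le> card (A - A1) + card B1)"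
  proof (cases "v \<in> A")
    case True
    then show ?thesis using D c card_mono[OF f1(1), of ?D] card_mono[OF f1(2), of "V - {v} - ?D"] by auto
  next
    case False
    then show ?thesis using D c card_mono[OF f1(2), of ?D] card_mono[OF f1(1), of "V - {v} - ?D"] by auto
  qed
  moreover have "card ?D \<le> card (V - {v} - ?D)"
    by (rule min_mismatch_misdeg[OF V v A sym_rel_adj min])
  ultimately have "card ?D \<le> card (A - A1) + card B1 \<and> card ?D \<le> card A1 + card (?B - B1)" by linarith
  then have "real (card ?D) \<le> real (card (A - A1) + card B1)" "real (card ?D) \<le> real (card A1 + card (?B - B1))"
    by (simp_all only: of_nat_le_iff)
  then show ?thesis using small by linarith
qed

text \<open>Up to the exceptional pairs in W, the set u, v, x, y has five edges, two or one,
  according as both, one or none of x, y lie in A; never three. So inserting uv loses at most |W|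
  ordered pairs, while the mixed pairs, nearly n^2 / 4 of them, are gained.\<close>

lemma no_inner_mismatch:
  assumes ex: "extremal V E" and A: "A \<subseteq> V" and n: "n = real (card V)" "n \<ge> 10 ^ 7"
    and bal: "\<bar>real (card A) - real (card (V - A))\<bar> \<le> n / 10 ^ 6"
    and f: "real (card (mismatch (adj E) V A)) \<le> n\<^sup>2 / 10 ^ 6"
    and deg: "\<And>v. v \<in> V \<Longrightarrow> real (card (misdeg (adj E) V A v)) \<le> n / 100"
    and uv: "u \<in> A" "v \<in> A" "u \<noteq> v"
  shows "adj E u v"
proof (rule ccontr)
  assume no: "\<not> adj E u v"
  let ?M = "mismatch (adj E) V A" and ?D = "misdeg (adj E) V A" and ?B = "V - A"
  have V: "finite V" and E: "E \<subseteq> [V]\<^bsup>2\<^esup>" using ex by (auto simp: extremal_def)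
  have finA: "finite A" using A V finite_subset by blast
  have uV: "u \<in> V" "v \<in> V" using uv A by auto
  define W where "W = ?M \<union> ((?D u \<union> ?D v) \<times> V \<union> V \<times> (?D u \<union> ?D v))"
  have finD: "finite (?D x)" for x using V by (simp add: misdeg_def)
  have finW: "finite W" using finD V finite_mismatch[OF V] by (simp add: W_def)
  have "card W \<le> card ?M + (card ((?D u \<union> ?D v) \<times> V) + card (V \<times> (?D u \<union> ?D v)))"
    unfolding W_def by (rule order_trans[OF card_Un_le add_left_mono[OF card_Un_le]])
  also have "\<dots> = card ?M + 2 * (card (?D u \<union> ?D v) * card V)" by (simp add: card_cartesian_product)
  also have "\<dots> \<le> card ?M + 2 * ((card (?D u) + card (?D v)) * card V)"
    by (intro add_left_mono mult_left_mono mult_right_mono card_Un_le) auto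
  finally have "real (card W) \<le> real (card ?M + 2 * ((card (?D u) + card (?D v)) * card V))"
    by (simp only: of_nat_le_iff)
  also have "\<dots> = real (card ?M) + 2 * ((real (card (?D u)) + real (card (?D v))) * n)" by (simp add: n)
  also have "\<dots> \<le> n\<^sup>2 / 10 ^ 6 + 2 * ((n / 100 + n / 100) * n)"
    using deg[OF uV(1)] deg[OF uV(2)] f n by (intro add_mono mult_left_mono mult_right_mono) auto
  finally have W: "real (card W) \<le> n\<^sup>2 / 20" by (simp add: power2_eq_square)
  have e4: "card (E \<inter> [{u, v, x, y}]\<^bsup>2\<^esup>) = of_bool (x \<in> A) + of_bool (y \<in> A) + of_bool (x \<in> A) + of_bool (y \<in> A) + of_bool ((x \<in> A) = (y \<in> A))"
    if xy: "x \<in> V - {u, v}" "y \<in> V - {u, v}" "x \<noteq> y" "(x, y) \<notin> W" for x y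
  proof -
    have d: "distinct [u, v, x, y]" using xy uv by auto
    have "adj E u x = (x \<in> A)" "adj E v x = (x \<in> A)" "adj E u y = (y \<in> A)" "adj E v y = (y \<in> A)"
      "adj E x y = ((x \<in> A) = (y \<in> A))"
      using xy uv uV by (auto simp: W_def misdeg_def mismatch_def)
    then show ?thesis unfolding card_edges4[OF d] using no by simp
  qed
  have "ext_pairs V E u v 3 \<subseteq> W"
  proof
    fix t assume t: "t \<in> ext_pairs V E u v 3"
    obtain x y where xy: "t = (x, y)" by (cases t)
    show "t \<in> W"
    proof (rule ccontr)
      assume "t \<notin> W"
      then have "of_bool (x \<in> A) + of_bool (y \<in> A) + of_bool (x \<in> A) + of_bool (y \<in> A) + of_bool ((x \<in> A) = (y \<in> A)) = (3 :: nat)"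
        using e4[of x y] t by (auto simp: xy ext_pairs_def)
      then show False by (cases "x \<in> A"; cases "y \<in> A") auto
    qed
  qed
  then have D3: "card (ext_pairs V E u v 3) \<le> card W" by (rule card_mono[OF finW])
  have "(A - {u, v}) \<times> ?B \<subseteq> ext_pairs V E u v 2 \<union> W"
  proof
    fix t assume t: "t \<in> (A - {u, v}) \<times> ?B"
    obtain x y where xy: "t = (x, y)" by (cases t)
    have *: "x \<in> V - {u, v}" "y \<in> V - {u, v}" "x \<noteq> y" "x \<in> A" "y \<notin> A" using t uv A by (auto simp: xy)
    show "t \<in> ext_pairs V E u v 2 \<union> W"
      using e4[OF *(1-3)] * by (cases "(x, y) \<in> W") (auto simp: xy ext_pairs_def)
  qed
  then have "card ((A - {u, v}) \<times> ?B) \<le> card (ext_pairs V E u v 2 \<union> W)"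
    by (rule card_mono[rotated]) (use finW V in \<open>auto simp: ext_pairs_def intro: finite_subset[of _ "V \<times> V"]\<close>)
  also have "\<dots> \<le> card (ext_pairs V E u v 2) + card W" by (rule card_Un_le)
  finally have D2: "card (A - {u, v}) * card ?B \<le> card (ext_pairs V E u v 2) + card W" by (simp add: card_cartesian_product)
  have "insert {u, v} E \<subseteq> [V]\<^bsup>2\<^esup>" using E uV uv by auto
  then have "Lambda 4 3 V (insert {u, v} E) \<le> Lambda 4 3 V E" using ex by (simp add: extremal_def)
  moreover have "2 * Lambda 4 3 V (insert {u, v} E) + card (ext_pairs V E u v 3) = 2 * Lambda 4 3 V E + card (ext_pairs V E u v 2)"
    by (rule Lambda_insert_edge[OF V uV uv(3)]) (use no in \<open>simp add: adj_def\<close>)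
  ultimately have "card (ext_pairs V E u v 2) \<le> card (ext_pairs V E u v 3)" by linarith
  then have "card (A - {u, v}) * card ?B \<le> 2 * card W" using D2 D3 by linarith
  then have "real (card (A - {u, v}) * card ?B) \<le> real (2 * card W)" by (simp only: of_nat_le_iff)
  then have le: "real (card (A - {u, v})) * real (card ?B) \<le> n\<^sup>2 / 10" using W by simp
  have "card A + card ?B = card V" using A V finA by (simp add: card_Diff_subset card_mono)
  then have sum: "real (card A) + real (card ?B) = n" using n by (simp flip: of_nat_add)
  have "card (A - {u, v}) = card A - 2" using uv finA by (simp add: card_Diff_subset)
  then have "real (card (A - {u, v})) \<ge> real (card A) - 2" by simp
  have a: "real (card (A - {u, v})) \<ge> 2 / 5 * n" and b: "real (card ?B) \<ge> 2 / 5 * n"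
  proof -
    have "real (card A) - real (card ?B) \<le> n / 1000000" "real (card ?B) - real (card A) \<le> n / 1000000" "n \<ge> 10000000"
      using abs_le_D1[OF bal] abs_le_D2[OF bal] n(2) by simp_all
    then show "real (card (A - {u, v})) \<ge> 2 / 5 * n" "real (card ?B) \<ge> 2 / 5 * n"
      using sum \<open>real (card (A - {u, v})) \<ge> real (card A) - 2\<close> by linarith+
  qed
  have "(2 / 5 * n) * (2 / 5 * n) \<le> real (card (A - {u, v})) * real (card ?B)"
    using a b n by (intro mult_mono) auto
  then have "4 / 25 * n\<^sup>2 \<le> n\<^sup>2 / 10" using le by (simp add: power2_eq_square)
  moreover have "n\<^sup>2 > 0" using n by simp
  ultimately show False by linarith
qed

lemma mismatch_Compl: "A \<subseteq> V \<Longrightarrow> mismatch e V (V - A) = mismatch e V A"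
  by (auto simp: mismatch_def)

text \<open>The competitor need not be optimal: any squared difference strictly above n and at most
  3 n - 4 will do. This window contains the squares of two consecutive integers t + 1 and t + 2, one
  of which has the parity of n.\<close>

lemma exists_good_side:
  assumes "(n :: nat) \<ge> 16"
  shows "\<exists>s. n < s\<^sup>2 \<and> s\<^sup>2 \<le> 3 * n - 4 \<and> even (n + s) \<and> s \<le> n"
proof -
  define t where "t = nat \<lfloor>sqrt (real n)\<rfloor>"
  have "real t = of_int \<lfloor>sqrt (real n)\<rfloor>" by (simp add: t_def)
  then have t: "real t \<le> sqrt n" "sqrt n < real t + 1" by linarith+
  have "real t ^ 2 \<le> n" using power_mono[OF t(1), of 2] by simp
  then have t1: "t\<^sup>2 \<le> n" by (simp flip: of_nat_power)
  have "real n < (real t + 1)\<^sup>2" using power_strict_mono[OF t(2), of 2] by simp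
  then have t2: "n < (t + 1)\<^sup>2" by (metis of_nat_1 of_nat_add of_nat_less_iff of_nat_power)
  have "t \<ge> 4"
  proof (rule ccontr)
    assume "\<not> t \<ge> 4"
    then have "(t + 1)\<^sup>2 \<le> 4\<^sup>2" by (intro power_mono) auto
    then show False using t2 assms by simp
  qed
  then have "4 * t \<le> t\<^sup>2" by (simp add: power2_eq_square)
  moreover have "(t + 2)\<^sup>2 = t\<^sup>2 + 4 * t + 4" "(t + 1)\<^sup>2 = t\<^sup>2 + 2 * t + 1" by (simp_all add: power2_eq_square algebra_simps)
  ultimately have "(t + 2)\<^sup>2 \<le> 3 * n - 4" "(t + 1)\<^sup>2 \<le> 3 * n - 4" "t + 2 \<le> n" "n < (t + 2)\<^sup>2"
    using t1 t2 assms \<open>t \<ge> 4\<close> by linarith+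
  then show ?thesis
    using t2 by (cases "even (n + (t + 1))") (auto intro: exI[of _ "t + 1"] exI[of _ "t + 2"])
qed

text \<open>Against balanced cliques, (3 n - 4 - d^2)^2 is at most 17 n^2 plus the cost 48 f n^2 of
  the f wrong pairs. To conclude d^2 <= n^2 / 10^12 the right side must be below (3 n^2 / 10^13)^2,
  which dictates the constants 10^27 and 10^14.\<close>

lemma extremal_balanced:
  assumes ex: "extremal V E" and A: "A \<subseteq> V" and n: "n = real (card V)" "n \<ge> 10 ^ 14"
    and f: "real (card (mismatch (adj E) V A)) \<le> n\<^sup>2 / 10 ^ 27"
  shows "\<bar>real (card A) - real (card (V - A))\<bar> \<le> n / 10 ^ 6"
proof -
  let ?B = "V - A" and ?f = "real (card (mismatch (adj E) V A))"
  define d where "d = real (card A) - real (card ?B)"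
  have V: "finite V" and E: "E \<subseteq> [V]\<^bsup>2\<^esup>" using ex by (auto simp: extremal_def)
  have finA: "finite A" using A V finite_subset by blast
  have "card A + card ?B = card V" using A V finA by (simp add: card_Diff_subset card_mono)
  then have sum: "n = real (card A) + real (card ?B)" using n(1) by (simp flip: of_nat_add)
  have AV: "A \<union> ?B = V" using A by auto
  have L: "48 * real (Lambda 4 3 V ([A]\<^bsup>2\<^esup> \<union> [?B]\<^bsup>2\<^esup>)) = (n\<^sup>2 - 3 * n + 4)\<^sup>2 - (3 * n - 4 - d\<^sup>2)\<^sup>2"
    using Lambda_cliques_real[OF finA _ _ sum d_def] V unfolding AV by simp
  have "real (Lambda 4 3 V E) \<le> real (Lambda 4 3 V ([A]\<^bsup>2\<^esup> \<union> [?B]\<^bsup>2\<^esup>) + card (mismatch (adj E) V A) * card V ^ 2)"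
    using Lambda_le_cliques[OF V A E] by (simp only: of_nat_le_iff)
  then have "real (Lambda 4 3 V E) \<le> real (Lambda 4 3 V ([A]\<^bsup>2\<^esup> \<union> [?B]\<^bsup>2\<^esup>)) + ?f * n\<^sup>2" by (simp add: n(1))
  moreover have "48 * real (Lambda 4 3 V E) \<ge> n ^ 4 - 6 * n ^ 3"
  proof (rule extremal_lower_bound[OF ex n(1)])
    have "real 10 \<le> real (card V)" using n by simp
    then show "card V \<ge> 10" by (simp only: of_nat_le_iff)
  qed
  moreover have "(n\<^sup>2 - 3 * n + 4)\<^sup>2 = n ^ 4 - 6 * n ^ 3 + 17 * n\<^sup>2 - 24 * n + 16"
    by (simp add: power2_eq_square power3_eq_cube power4_eq_xxxx algebra_simps)
  ultimately have bound: "(3 * n - 4 - d\<^sup>2)\<^sup>2 \<le> 17 * n\<^sup>2 + 48 * (?f * n\<^sup>2)" using L n(2) by simp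
  have "?f * n\<^sup>2 \<le> (n\<^sup>2 / 10 ^ 27) * n\<^sup>2" using f by (rule mult_right_mono) simp
  moreover have "n\<^sup>2 \<le> n\<^sup>2 * (n\<^sup>2 / 10 ^ 28)"
  proof -
    have "(10 ^ 14)\<^sup>2 \<le> n\<^sup>2" using n(2) by (rule power_mono) simp
    then have "1 \<le> n\<^sup>2 / 10 ^ 28" by simp
    then show ?thesis using mult_left_mono[of 1 "n\<^sup>2 / 10 ^ 28" "n\<^sup>2"] by simp
  qed
  ultimately have "(3 * n - 4 - d\<^sup>2)\<^sup>2 \<le> 17 * (n\<^sup>2 * (n\<^sup>2 / 10 ^ 28)) + 48 * (n\<^sup>2 / 10 ^ 27 * n\<^sup>2)"
    using bound by linarith
  also have "\<dots> \<le> (3 * n\<^sup>2 / 10 ^ 13)\<^sup>2" using n(2) by (simp add: power2_eq_square zero_le_mult_iff)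
  finally have "\<bar>3 * n - 4 - d\<^sup>2\<bar> \<le> \<bar>3 * n\<^sup>2 / 10 ^ 13\<bar>" by (simp only: abs_le_square_iff)
  also have "\<dots> = 3 * n\<^sup>2 / 10 ^ 13" by simp
  finally have "d\<^sup>2 \<le> 3 * n + 3 * n\<^sup>2 / 10 ^ 13" using abs_le_D2 by fastforce
  moreover have "10 ^ 14 * n \<le> n\<^sup>2" using mult_right_mono[OF n(2), of n] n(2) by (simp add: power2_eq_square)
  moreover have "n\<^sup>2 \<ge> 0" by simp
  moreover have "x \<le> z / 10 ^ 12" if "x \<le> 3 * y + 3 * z / 10 ^ 13" "10 ^ 14 * y \<le> z" "0 \<le> z" for x y z :: real
    using that by simp
  ultimately have "d\<^sup>2 \<le> n\<^sup>2 / 10 ^ 12" by blast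
  then have "d\<^sup>2 \<le> (n / 10 ^ 6)\<^sup>2" by (simp add: power_divide)
  then have "\<bar>d\<bar> \<le> \<bar>n / 10 ^ 6\<bar>" by (simp only: abs_le_square_iff)
  then show ?thesis using n(2) by (simp add: d_def)
qed

text \<open>The competitor consists of two cliques whose sizes differ by the square root of s: the gain from m
  edges between the cliques is at most quadratic in n minus the squared size difference, which is less than
  what is lost against sizes differing by slightly more than the square root of n.\<close>

lemma cross_edges_not_extremal:
  fixes n d m F L :: real
  assumes n: "n \<ge> 16" and m: "m \<ge> 1" and d: "d\<^sup>2 \<ge> 0"
    and upper: "48 * L \<le> F - (3 * n - 4 - d\<^sup>2)\<^sup>2 + 24 * (m * (n - d\<^sup>2) - 2 * m\<^sup>2)"
    and lower: "48 * L \<ge> F - (3 * n - 4 - d\<^sup>2)\<^sup>2" "48 * L \<ge> F - (3 * n - 4 - s)\<^sup>2"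
    and s: "n < s" "s \<le> 3 * n - 4"
  shows False
proof -
  define y where "y = n - d\<^sup>2"
  have yn: "y \<le> n" using d by (simp add: y_def)
  have m2: "m\<^sup>2 > 0" using m by simp
  have neg: "p \<le> 0 \<Longrightarrow> 0 < q \<Longrightarrow> 24 * (p - 2 * q) < 0" for p q :: real
    by (rule mult_pos_neg) linarith+
  show False
  proof (cases "y \<le> 0")
    case True
    then have "m * y \<le> 0" using m by (simp add: mult_nonneg_nonpos)
    then have "24 * (m * y - 2 * m\<^sup>2) < 0" using m2 by (rule neg)
    then show False using upper lower(1) unfolding y_def by linarith
  next
    case False
    \<comment> \<open>Over real m, the expression \<open>m * y - 2 * m\<^sup>2\<close> is largest at
      m = y / 4, with value y^2 / 8.\<close>
    have "24 * (m * y - 2 * m\<^sup>2) \<le> 3 * y\<^sup>2"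
      using zero_le_power2[of "y - 4 * m"] by (simp add: power2_eq_square algebra_simps)
    moreover have "(3 * n - 4 - d\<^sup>2)\<^sup>2 = (2 * n - 4)\<^sup>2 + 3 * y\<^sup>2 + 2 * (y * (2 * n - 4 - y))"
      by (simp add: y_def power2_eq_square algebra_simps)
    moreover have "y * (2 * n - 4 - y) \<ge> 0" using False yn n by (intro mult_nonneg_nonneg) auto
    ultimately have "48 * L \<le> F - (2 * n - 4)\<^sup>2" using upper unfolding y_def by linarith
    moreover have "(3 * n - 4 - s)\<^sup>2 < (2 * n - 4)\<^sup>2" using s by (intro power_strict_mono) auto
    ultimately show False using lower(2) by linarith
  qed
qed

lemma extremal_near_cliques:
  assumes ex: "extremal V E" and n: "n = real (card V)" "n \<ge> 10 ^ 14"
    and near: "A0 \<subseteq> V" "real (card (mismatch (adj E) V A0)) \<le> n\<^sup>2 / 10 ^ 27"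
  shows "union_of_two_cliques V E"
proof -
  have V: "finite V" and E: "E \<subseteq> [V]\<^bsup>2\<^esup>" using ex by (auto simp: extremal_def)
  obtain A where A: "A \<subseteq> V" and min: "\<And>A'. A' \<subseteq> V \<Longrightarrow> card (mismatch (adj E) V A) \<le> card (mismatch (adj E) V A')"
    using ex_has_least_nat[of "\<lambda>A. A \<subseteq> V" A0 "\<lambda>A. card (mismatch (adj E) V A)"] near(1) by blast
  let ?M = "mismatch (adj E) V A"
  define B where "B = V - A"
  have "real (card ?M) \<le> real (card (mismatch (adj E) V A0))" using min[OF near(1)] by (simp only: of_nat_le_iff)
  then have f: "real (card ?M) \<le> n\<^sup>2 / 10 ^ 27" using near(2) by linarith
  have bal: "\<bar>real (card A) - real (card B)\<bar> \<le> n / 10 ^ 6"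
    unfolding B_def by (rule extremal_balanced[OF ex A n f])
  have n7: "n \<ge> 10 ^ 7" and f6: "real (card ?M) \<le> n\<^sup>2 / 10 ^ 6" using n f by simp_all
  have deg: "real (card (misdeg (adj E) V A v)) \<le> n / 100" if "v \<in> V" for v
    by (rule misdeg_le[OF ex A that n(1) n7 bal[unfolded B_def] f6 min])
  have inA: "adj E u v" if "u \<in> A" "v \<in> A" "u \<noteq> v" for u v
    by (rule no_inner_mismatch[OF ex A n(1) n7 bal[unfolded B_def] f6 deg that])
  have BV: "B \<subseteq> V" and VB: "V - B = A" using A by (auto simp: B_def)
  have MB: "mismatch (adj E) V B = ?M" unfolding B_def by (rule mismatch_Compl[OF A])
  have inB: "adj E u v" if "u \<in> B" "v \<in> B" "u \<noteq> v" for u v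
  proof (rule no_inner_mismatch[OF ex BV n(1) n7 _ _ _ that])
    show "\<bar>real (card B) - real (card (V - B))\<bar> \<le> n / 10 ^ 6" using bal unfolding VB by linarith
    show "real (card (mismatch (adj E) V B)) \<le> n\<^sup>2 / 10 ^ 6" using f6 by (simp add: MB)
    show "real (card (misdeg (adj E) V B v)) \<le> n / 100" if "v \<in> V" for v
      using deg[OF that] by (simp add: misdeg_def MB)
  qed
  have dis: "A \<inter> B = {}" and AB: "A \<union> B = V" using A by (auto simp: B_def)
  have fin: "finite A" "finite B" using AB V by auto
  define X where "X = {(x, y) \<in> A \<times> B. adj E x y}"
  have X: "X \<subseteq> A \<times> B" "finite X" using fin by (auto simp: X_def intro: finite_subset[of _ "A \<times> B"])
  have EX: "E = with_cross A B X"
  proof (intro equalityI subsetI)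
    fix t assume t: "t \<in> E"
    then have "t \<in> [V]\<^bsup>2\<^esup>" using E by blast
    then obtain x y where xy: "t = {x, y}" "x \<in> V" "y \<in> V" "x \<noteq> y" by (rule nsets2_E)
    have "adj E x y" "adj E y x" using t xy by (auto simp: adj_def insert_commute)
    then show "t \<in> with_cross A B X"
      using xy AB unfolding with_cross_def X_def by (auto simp: image_iff insert_commute)
  next
    fix t assume "t \<in> with_cross A B X"
    then consider "t \<in> [A]\<^bsup>2\<^esup>" | "t \<in> [B]\<^bsup>2\<^esup>" | "t \<in> (\<lambda>(x, y). {x, y}) ` X" by (auto simp: with_cross_def)
    then show "t \<in> E"
    proof cases
      case 1 then show ?thesis using inA by (auto simp: adj_def elim!: nsets2_E)
    next
      case 2 then show ?thesis using inB by (auto simp: adj_def elim!: nsets2_E)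
    next
      case 3 then show ?thesis by (auto simp: X_def adj_def)
    qed
  qed
  \<comment> \<open>The bound n / 100 rounded down, as the degree bound for crossing edges is a
    natural number. The term 8 D in \<open>sizes\<close> is then at most 0.08 n, against a slack of
    about n.\<close>
  define D where "D = nat \<lfloor>n / 100\<rfloor>"
  have Dn: "real D \<le> n / 100" unfolding D_def by (rule of_nat_floor) (use n(2) in simp)
  have le_D: "k \<le> D" if "real k \<le> n / 100" for k using that by (simp add: D_def le_nat_floor)
  have degA: "card {y. (x, y) \<in> X} \<le> D" if x: "x \<in> A" for x
  proof -
    have "{y. (x, y) \<in> X} \<subseteq> misdeg (adj E) V A x"
      using A dis AB by (auto simp: X_def misdeg_def mismatch_def)
    then have "card {y. (x, y) \<in> X} \<le> card (misdeg (adj E) V A x)"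
      by (rule card_mono[rotated]) (use V in \<open>simp add: misdeg_def\<close>)
    moreover have "x \<in> V" using x A by blast
    ultimately show ?thesis using le_D[OF deg] by force
  qed
  have degB: "card {x. (x, y) \<in> X} \<le> D" if y: "y \<in> B" for y
  proof -
    have "{x. (x, y) \<in> X} \<subseteq> misdeg (adj E) V A y"
      using A dis AB adj_commute[of E y] by (auto simp: X_def misdeg_def mismatch_def)
    then have "card {x. (x, y) \<in> X} \<le> card (misdeg (adj E) V A y)"
      by (rule card_mono[rotated]) (use V in \<open>simp add: misdeg_def\<close>)
    moreover have "y \<in> V" using y AB by blast
    ultimately show ?thesis using le_D[OF deg] by force
  qed
  have "card A + card B = card V" using card_Un_disjoint[OF fin dis] AB by simp
  then have sum: "n = real (card A) + real (card B)" using n(1) by (simp flip: of_nat_add)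
  have bal': "real (card A) - real (card B) \<le> n / 1000000" "real (card B) - real (card A) \<le> n / 1000000" "n \<ge> 100000000000000"
    using abs_le_D1[OF bal] abs_le_D2[OF bal] n(2) by simp_all
  have "real (2 * card A + 5 + 8 * D) \<le> real (4 * card B)" "real (2 * card B + 5 + 8 * D) \<le> real (4 * card A)"
    using bal' sum Dn by simp_all
  then have sizes: "2 * card A + 5 + 8 * D \<le> 4 * card B" "2 * card B + 5 + 8 * D \<le> 4 * card A"
    by (simp_all only: of_nat_le_iff)
  define d where "d = real (card A) - real (card B)"
  define m where "m = real (card X)"
  define L where "L = real (Lambda 4 3 V E)"
  define L0 where "L0 = real (Lambda 4 3 V ([A]\<^bsup>2\<^esup> \<union> [B]\<^bsup>2\<^esup>))"
  have L0: "48 * L0 = (n\<^sup>2 - 3 * n + 4)\<^sup>2 - (3 * n - 4 - d\<^sup>2)\<^sup>2"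
    using Lambda_cliques_real[OF fin dis sum d_def] unfolding AB L0_def .
  have "2 * int (Lambda 4 3 V E) \<le> 2 * int (Lambda 4 3 V ([A]\<^bsup>2\<^esup> \<union> [B]\<^bsup>2\<^esup>)) +
    int (card X) * (int (card A + card B) - (int (card A) - int (card B))\<^sup>2) - 2 * (int (card X))\<^sup>2"
    using Lambda_with_cross_le[OF fin dis sizes X(2,1) degA degB] unfolding AB EX[symmetric] .
  then have "real_of_int (2 * int (Lambda 4 3 V E)) \<le> real_of_int (2 * int (Lambda 4 3 V ([A]\<^bsup>2\<^esup> \<union> [B]\<^bsup>2\<^esup>)) +
    int (card X) * (int (card A + card B) - (int (card A) - int (card B))\<^sup>2) - 2 * (int (card X))\<^sup>2)"
    by (simp only: of_int_le_iff)
  then have "2 * L \<le> 2 * L0 + m * (n - d\<^sup>2) - 2 * m\<^sup>2"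
    unfolding L_def L0_def m_def sum d_def by simp
  then have upper: "48 * L \<le> (n\<^sup>2 - 3 * n + 4)\<^sup>2 - (3 * n - 4 - d\<^sup>2)\<^sup>2 + 24 * (m * (n - d\<^sup>2) - 2 * m\<^sup>2)"
    using L0 by (simp add: right_diff_distrib)
  have "[A]\<^bsup>2\<^esup> \<union> [B]\<^bsup>2\<^esup> \<subseteq> [V]\<^bsup>2\<^esup>" using A BV nsets_mono[of A V 2] nsets_mono[of B V 2] by auto
  then have "Lambda 4 3 V ([A]\<^bsup>2\<^esup> \<union> [B]\<^bsup>2\<^esup>) \<le> Lambda 4 3 V E" using ex by (simp add: extremal_def)
  then have "L0 \<le> L" unfolding L_def L0_def by (simp only: of_nat_le_iff)
  then have lower: "48 * L \<ge> (n\<^sup>2 - 3 * n + 4)\<^sup>2 - (3 * n - 4 - d\<^sup>2)\<^sup>2" using L0 by linarith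
  have "real 16 \<le> real (card V)" using n by simp
  then have c16: "16 \<le> card V" by (simp only: of_nat_le_iff)
  obtain s where s: "card V < s\<^sup>2" "s\<^sup>2 \<le> 3 * card V - 4" "even (card V + s)" "s \<le> card V"
    using exists_good_side[OF c16] by blast
  have "real (card V) < real (s\<^sup>2)" using s(1) by (simp only: of_nat_less_iff)
  moreover have "real (s\<^sup>2 + 4) \<le> real (3 * card V)" using s(2) c16 by (simp only: of_nat_le_iff)
  ultimately have s': "n < (real s)\<^sup>2" "(real s)\<^sup>2 \<le> 3 * n - 4" unfolding n(1) by simp_all
  have "X = {}"
  proof (rule ccontr)
    assume "X \<noteq> {}"
    then have "card X \<ge> 1" using X(2) by (simp add: Suc_le_eq card_gt_0_iff)
    then have "m \<ge> 1" by (simp add: m_def)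
    then show False
      by (rule cross_edges_not_extremal[OF _ _ _ upper lower extremal_ge[OF ex n(1) s(3,4), folded L_def] s', rotated])
        (use n(2) in simp_all)
  qed
  then have "E = [A]\<^bsup>2\<^esup> \<union> [B]\<^bsup>2\<^esup>" unfolding EX by (simp add: with_cross_def)
  moreover have "A \<noteq> {}" "B \<noteq> {}" using sizes by auto
  ultimately show ?thesis unfolding union_of_two_cliques_def using dis AB by blast
qed

theorem theorem4p2:
  shows "\<exists>n0 :: nat. \<forall>n \<ge> n0. \<forall>(V :: 'a set) E.
    simple_graph V E \<and> card V = n \<and> Lambda 4 3 V E = Lambda_max 4 3 n \<longrightarrow>
    union_of_two_cliques V E \<or> complete_bipartite V E"
proof -
  have "(1 / 10 ^ 27 :: real) > 0" by simp
  \<comment> \<open>78840 = 540 times 6 plus 75600: the coefficient 6 is the deficit of n^3 in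
    \<open>extremal_lower_bound\<close>, the rest comes from
    \<open>card_nontight_le\<close>.\<close>
  then obtain n1 where n1: "\<And>V e n. \<lbrakk>finite V; n = card V; n \<ge> n1; sym_rel (e :: 'a \<Rightarrow> 'a \<Rightarrow> bool);
      card {xs \<in> dlists_of V 6. odd_l e xs \<in> {5..15}} \<le> 78840 * n ^ 5\<rbrakk> \<Longrightarrow>
      \<exists>A \<subseteq> V. real (card (mismatch e V A)) \<le> 1 / 10 ^ 27 * real n ^ 2 \<or>
        real (card (mismatch (\<lambda>x y. \<not> e x y) V A)) \<le> 1 / 10 ^ 27 * real n ^ 2"
    by (rule small_mismatch[where K = 78840 and 'a = 'a]) blast
  show ?thesis
  proof (intro exI[of _ "max n1 (10 ^ 14)"] allI impI)
    fix n :: nat and V :: "'a set" and E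
    assume n: "max n1 (10 ^ 14) \<le> n" and G: "simple_graph V E \<and> card V = n \<and> Lambda 4 3 V E = Lambda_max 4 3 n"
    then have V: "finite V" and E: "E \<subseteq> [V]\<^bsup>2\<^esup>" and card: "card V = n" by (auto simp: simple_graph_def)
    have max: "Lambda 4 3 V E' \<le> Lambda 4 3 V E" if "E' \<subseteq> [V]\<^bsup>2\<^esup>" for E'
      using Lambda_le_max[OF V that, of 4 3] G by simp
    then have ex: "extremal V E" using V E by (simp add: extremal_def)
    define N where "N = real n"
    have N: "N = real (card V)" "N \<ge> 10 ^ 14"
    proof -
      have "real (10 ^ 14) \<le> real n" using n by (simp only: of_nat_le_iff)
      then show "N \<ge> 10 ^ 14" by (simp add: N_def)
    qed (simp add: N_def card)
    have "real 10 \<le> N" using N(2) by simp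
    then have c10: "card V \<ge> 10" unfolding N(1) by (simp only: of_nat_le_iff)
    have "real_of_int (int n ^ 4 - 48 * int (Lambda 4 3 V E)) \<le> real_of_int (6 * int n ^ 3)"
      using extremal_lower_bound[OF ex N(1) c10] by (simp add: N_def)
    then have "int n ^ 4 - 48 * int (Lambda 4 3 V E) \<le> 6 * int n ^ 3" by (simp only: of_int_le_iff)
    then have "540 * int n ^ 2 * (int n ^ 4 - 48 * int (Lambda 4 3 V E)) \<le> 540 * int n ^ 2 * (6 * int n ^ 3)"
      by (intro mult_left_mono) auto
    also have "\<dots> = 3240 * int n ^ 5" by (simp add: power_numeral_reduce)
    finally have "int (card {xs \<in> dlists_of V 6. odd_l (adj E) xs \<in> {5..15}}) \<le> int (78840 * n ^ 5)"
      using card_nontight_le[OF V, of E] unfolding card by simp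
    then have "card {xs \<in> dlists_of V 6. odd_l (adj E) xs \<in> {5..15}} \<le> 78840 * n ^ 5" by (simp only: of_nat_le_iff)
    then obtain A where A: "A \<subseteq> V" and near: "real (card (mismatch (adj E) V A)) \<le> 1 / 10 ^ 27 * real n ^ 2 \<or>
        real (card (mismatch (\<lambda>x y. \<not> adj E x y) V A)) \<le> 1 / 10 ^ 27 * real n ^ 2"
      using n1[OF V card[symmetric] _ sym_rel_adj, of E] n by auto
    show "union_of_two_cliques V E \<or> complete_bipartite V E"
    proof (cases "real (card (mismatch (adj E) V A)) \<le> 1 / 10 ^ 27 * real n ^ 2")
      case True
      then have "real (card (mismatch (adj E) V A)) \<le> N\<^sup>2 / 10 ^ 27" by (simp add: N_def)
      then show ?thesis using extremal_near_cliques[OF ex N A] by blast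
    next
      case False
      \<comment> \<open>The loopless form of the negated relation; wrong pairs are the same for
        both, as \<open>mismatch\<close> excludes the diagonal.\<close>
      define E' where "E' = [V]\<^bsup>2\<^esup> - E"
      have "Lambda 4 3 V E' = Lambda 4 3 V E" unfolding E'_def by (rule Lambda_compl[OF V])
      then have ex': "extremal V E'" using max V by (auto simp: extremal_def E'_def)
      have "mismatch (adj E') V A = mismatch (\<lambda>x y. \<not> adj E x y) V A"
        by (auto simp: mismatch_def adj_def E'_def)
      then have "real (card (mismatch (adj E') V A)) \<le> N\<^sup>2 / 10 ^ 27" using near False by (simp add: N_def)
      then have "union_of_two_cliques V E'" using extremal_near_cliques[OF ex' N A] by blast
      then obtain P Q where PQ: "P \<noteq> {}" "Q \<noteq> {}" "P \<inter> Q = {}" "P \<union> Q = V" "E' = [P]\<^bsup>2\<^esup> \<union> [Q]\<^bsup>2\<^esup>"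
        unfolding union_of_two_cliques_def by blast
      have "E = [V]\<^bsup>2\<^esup> - E'" using E by (auto simp: E'_def)
      also have "\<dots> = {{a, b} | a b. a \<in> P \<and> b \<in> Q}"
      proof (intro equalityI subsetI)
        fix t assume t: "t \<in> [V]\<^bsup>2\<^esup> - E'"
        then have "t \<in> [V]\<^bsup>2\<^esup>" by blast
        then obtain x y where "t = {x, y}" "x \<in> V" "y \<in> V" "x \<noteq> y" by (rule nsets2_E)
        then show "t \<in> {{a, b} | a b. a \<in> P \<and> b \<in> Q}"
          using t PQ by (auto simp: insert_commute)
      next
        fix t assume "t \<in> {{a, b} | a b. a \<in> P \<and> b \<in> Q}"
        then obtain a b where "t = {a, b}" "a \<in> P" "b \<in> Q" by blast
        then show "t \<in> [V]\<^bsup>2\<^esup> - E'" using PQ by auto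
      qed
      finally show ?thesis unfolding complete_bipartite_def using PQ by blast
    qed
  qed
qed

end
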